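(* For every $u(0) \in X_c$, there exists a unique solution $u(t) \in X_c$ to the linearized log--KdV equation $$u_t = \partial_x L u, \qquad L = -\partial_x^2 + \tfrac14 (x^2 - 6),$$ for every $t \in \mathbb{R}^+$, satisfying $E_c(u(t)) = E_c(u(0))$.
   Context: $L^2_1(\mathbb{R})$ is the space of square integrable functions with the weight $(1+x^2)^{1/2}$, i.e. $\int_{\mathbb R}(1+x^2)u^2\,dx<\infty$. With $V(x) = e^{\frac12 - \frac{x^2}{4}}$, $$X_c := \left\{ u \in H^1(\mathbb{R}) \cap L^2_1(\mathbb{R}) : \ \langle V, u \rangle_{L^2} = 0 \right\},$$ and $E_c(u) = \langle Lu,u\rangle_{L^2} = \int_{\mathbb{R}} [u_x^2 + \frac14 x^2 u^2 - \frac32 u^2]\,dx$. The evolution is understood through the expansion $u(t) = \sum_{n \ge 0} c_n(t) u_n$, $c_n(t) = \langle u_n, u(t)\rangle_{L^2}$, in the orthonormal basis of Hermite functions $u_n(x) = (2^n n! \sqrt{2\pi})^{-1/2} H_n(x/\sqrt2) e^{-x^2/4}$ (where $Lu_n = (n-1)u_n$ and $H_n$ are the Hermite polynomials), which turns the equation into the lattice system $2 \dot c_n = n\sqrt{n+1}\, c_{n+1} - (n-2)\sqrt{n}\, c_{n-1}$, $n \in \mathbb{N}_0$. In $X_c$ one has $c_0 = 0$ (invariant in time), $\dot c_1 = \frac{1}{\sqrt2} c_2$, and $a_n := \sqrt{n}\, c_{n+1}$, $n \in \mathbb{N}=\{1,2,\dots\}$, is an $\ell^2(\mathbb{N})$ sequence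 satisfying $2 \dot a_n = \sqrt{n(n+1)(n+2)}\, a_{n+1} - \sqrt{(n-1)n(n+1)}\, a_{n-1}$. The latter system is written via $a_n = i^n f_n$ as $\dot f = \frac{i}{2} J f$ with $(J f)_n = \sqrt{n(n+1)(n+2)} f_{n+1} + \sqrt{(n-1) n (n+1)} f_{n-1}$, and is solved by $e^{\frac{i}{2}\mathcal{J}t}$, where $\mathcal{J}$ is the self-adjoint realization of $J$ in $\ell^2(\mathbb{N})$ with domain $\{ f \in \ell^2(\mathbb{N}) : Jf \in \ell^2(\mathbb{N}),\ \lim_{n\to\infty} \sqrt{n(n+1)(n+2)}(v_n f_{n+1} - v_{n+1} f_n) = 0\}$, with $v$ the solution of $Jv=0$, $v_1=1$. *)

theory Defs
  imports "HOL-Probability.Probability"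
begin

section \<open>Function spaces on the real line\<close>

text \<open>Elements of \<open>L\<^sup>2\<close> are represented by Borel functions; two representatives stand for
  the same element iff they agree almost everywhere.\<close>

definition square_int :: "(real \<Rightarrow> real) \<Rightarrow> bool" where
  "square_int u \<longleftrightarrow> u \<in> borel_measurable lborel \<and> integrable lborel (\<lambda>x. (u x)\<^sup>2)"

definition L2_inner :: "(real \<Rightarrow> real) \<Rightarrow> (real \<Rightarrow> real) \<Rightarrow> real" where
  "L2_inner u w = (\<integral>x. u x * w x \<partial>lborel)"

definition test_function :: "(real \<Rightarrow> real) \<Rightarrow> bool" where
  "test_function \<phi> \<longleftrightarrow>
     (\<forall>k x. ((deriv ^^ k) \<phi>) differentiable (at x)) \<and> compact (closure {x. \<phi> x \<noteq> 0})"

definition is_weak_deriv :: "(real \<Rightarrow> real) \<Rightarrow> (real \<Rightarrow> real) \<Rightarrow> bool" where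
  "is_weak_deriv u g \<longleftrightarrow>
     (\<forall>\<phi>. test_function \<phi> \<longrightarrow> L2_inner u (deriv \<phi>) = - L2_inner g \<phi>)"

definition in_H1 :: "(real \<Rightarrow> real) \<Rightarrow> bool" where
  "in_H1 u \<longleftrightarrow> square_int u \<and> (\<exists>g. square_int g \<and> is_weak_deriv u g)"

text \<open>The weak derivative is unique up to null sets, so the choice is harmless under integrals.\<close>

definition weak_deriv :: "(real \<Rightarrow> real) \<Rightarrow> real \<Rightarrow> real" where
  "weak_deriv u = (SOME g. square_int g \<and> is_weak_deriv u g)"

definition in_L2_1 :: "(real \<Rightarrow> real) \<Rightarrow> bool" where
  "in_L2_1 u \<longleftrightarrow> square_int u \<and> integrable lborel (\<lambda>x. (1 + x\<^sup>2) * (u x)\<^sup>2)"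

definition V :: "real \<Rightarrow> real" where
  "V x = exp (1/2 - x\<^sup>2 / 4)"

definition X_c :: "(real \<Rightarrow> real) set" where
  "X_c = {u. in_H1 u \<and> in_L2_1 u \<and> L2_inner V u = 0}"

definition E_c :: "(real \<Rightarrow> real) \<Rightarrow> real" where
  "E_c u = (\<integral>x. (weak_deriv u x)\<^sup>2 + 1/4 * x\<^sup>2 * (u x)\<^sup>2 - 3/2 * (u x)\<^sup>2 \<partial>lborel)"


section \<open>The operator L and the Hermite functions\<close>

definition L_op :: "(real \<Rightarrow> real) \<Rightarrow> real \<Rightarrow> real" where
  "L_op \<phi> x = - deriv (deriv \<phi>) x + 1/4 * (x\<^sup>2 - 6) * \<phi> x"

fun hermite :: "nat \<Rightarrow> real \<Rightarrow> real" where
  "hermite 0 y = 1"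
| "hermite (Suc 0) y = 2 * y"
| "hermite (Suc (Suc n)) y = 2 * y * hermite (Suc n) y - 2 * real (Suc n) * hermite n y"

definition hermite_fun :: "nat \<Rightarrow> real \<Rightarrow> real" where
  "hermite_fun n x =
     hermite n (x / sqrt 2) * exp (- (x\<^sup>2 / 4)) / sqrt (2 ^ n * fact n * sqrt (2 * pi))"

definition hermite_coeff :: "nat \<Rightarrow> (real \<Rightarrow> real) \<Rightarrow> real" where
  "hermite_coeff n u = L2_inner (hermite_fun n) u"


lemma hermite_three_term:
  "hermite (Suc n) y = 2 * y * hermite n y - 2 * real n * hermite (n - 1) y"
  by (cases n) auto

lemma hermite_deriv:
  "(hermite n has_real_derivative 2 * real n * hermite (n - 1) y) (at y)"
proof (induction n arbitrary: y rule: less_induct)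
  case (less n)
  consider "n = 0" | "n = 1" | m where "n = Suc (Suc m)"
    by (metis One_nat_def not0_implies_Suc)
  then show ?case
  proof cases
    case 1
    have "hermite 0 = (\<lambda>_. 1)" by auto
    then show ?thesis using 1 by simp
  next
    case 2
    have "hermite (Suc 0) = (\<lambda>y. 2 * y)" by auto
    then show ?thesis using 2 by (auto intro!: derivative_eq_intros)
  next
    case (3 m)
    have eq: "hermite n =
        (\<lambda>y. 2 * y * hermite (Suc m) y - 2 * real (Suc m) * hermite m y)"
      using 3 by auto
    have a: "(hermite (Suc m) has_real_derivative 2 * real (Suc m) * hermite m y) (at y)"
      using less[of "Suc m"] 3 by simp
    have b: "(hermite m has_real_derivative 2 * real m * hermite (m - 1) y) (at y)"
      using less[of m] 3 by simp
    show ?thesis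
      unfolding eq using 3
      by (auto intro!: derivative_eq_intros a b simp del: hermite.simps)
         (simp add: hermite_three_term[of m] algebra_simps)
  qed
qed


lemma hermite_fun_three_term:
  "x * hermite_fun n x = sqrt (n + 1) * hermite_fun (Suc n) x + sqrt n * hermite_fun (n - 1) x"
  and hermite_fun_lower:
  "sqrt n * hermite_fun (n - 1) x
     = sqrt 2 * real n * hermite (n - 1) (x / sqrt 2) * exp (- (x\<^sup>2 / 4))
         / sqrt (2 ^ n * fact n * sqrt (2 * pi))"
proof -
  define y where "y = x / sqrt 2"
  define D where "D = sqrt (2 ^ n * fact n * sqrt (2 * pi))"
  define e where "e = exp (- (x\<^sup>2 / 4))"
  have D: "D > 0" unfolding D_def by simp
  have x: "x = sqrt 2 * y" by (simp add: y_def)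
  have "sqrt (2 ^ Suc n * fact (Suc n) * sqrt (2 * pi))
      = sqrt (2 * ((n + 1) * (2 ^ n * fact n * sqrt (2 * pi))))"
    by (rule arg_cong[of _ _ sqrt]) (simp add: algebra_simps)
  then have DS: "sqrt (2 ^ Suc n * fact (Suc n) * sqrt (2 * pi)) = sqrt 2 * (sqrt (n + 1) * D)"
    unfolding D_def by (simp only: real_sqrt_mult)
  have up: "sqrt (n + 1) * hermite_fun (Suc n) x = hermite (Suc n) y * e / (sqrt 2 * D)"
    unfolding hermite_fun_def DS e_def y_def by simp
  have down: "sqrt n * hermite_fun (n - 1) x = sqrt 2 * real n * hermite (n - 1) y * e / D"
  proof (cases n)
    case (Suc m)
    define M where "M = sqrt (2 ^ m * fact m * sqrt (2 * pi))"
    have M: "M > 0" unfolding M_def by simp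
    have "sqrt (2 ^ n * fact n * sqrt (2 * pi))
        = sqrt (2 * (n * (2 ^ m * fact m * sqrt (2 * pi))))"
      unfolding Suc by (rule arg_cong[of _ _ sqrt]) (simp add: algebra_simps)
    then have DM: "D = sqrt 2 * (sqrt n * M)"
      unfolding D_def M_def by (simp only: real_sqrt_mult)
    have h: "hermite_fun (n - 1) x = hermite (n - 1) y * e / M"
      using Suc by (simp add: hermite_fun_def M_def y_def e_def)
    have "real n = sqrt n * sqrt n" by simp
    then have "sqrt 2 * real n * hermite (n - 1) y * e / D
        = sqrt 2 * (sqrt n * sqrt n) * hermite (n - 1) y * e / D"
      by metis
    then show ?thesis
      unfolding h DM using M Suc by (simp add: field_simps)
  qed simp
  then show "sqrt n * hermite_fun (n - 1) x
     = sqrt 2 * real n * hermite (n - 1) (x / sqrt 2) * exp (- (x\<^sup>2 / 4))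
         / sqrt (2 ^ n * fact n * sqrt (2 * pi))"
    by (simp only: y_def D_def e_def)
  have h: "hermite_fun n x = hermite n y * e / D"
    by (simp add: hermite_fun_def D_def y_def e_def)
  have "2 * (y * hermite n y) = hermite (Suc n) y + 2 * real n * hermite (n - 1) y"
    unfolding hermite_three_term[of n] by simp
  moreover have "x * hermite_fun n x = 2 * (y * hermite n y) * e / (sqrt 2 * D)"
  proof -
    have "2 * z / sqrt 2 = sqrt 2 * z" for z :: real
        using real_div_sqrt[of 2] by (metis mult.commute times_divide_eq_right zero_le_numeral)
      then have "x = 2 * y / sqrt 2" using x by simp
    then show ?thesis unfolding h using D by simp
  qed
  ultimately have "x * hermite_fun n x
      = (hermite (Suc n) y + 2 * real n * hermite (n - 1) y) * e / (sqrt 2 * D)"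
    by metis
  also have "\<dots> = hermite (Suc n) y * e / (sqrt 2 * D) + sqrt 2 * real n * hermite (n - 1) y * e / D"
    using D by (simp add: field_simps)
  finally show "x * hermite_fun n x
      = sqrt (n + 1) * hermite_fun (Suc n) x + sqrt n * hermite_fun (n - 1) x"
    unfolding up down .
qed

lemma hermite_fun_deriv:
  "(hermite_fun n has_real_derivative
     sqrt n * hermite_fun (n - 1) x - x / 2 * hermite_fun n x) (at x)"
proof -
  define D where "D = sqrt (2 ^ n * fact n * sqrt (2 * pi))"
  have D: "D > 0" unfolding D_def by simp
  have inner: "((\<lambda>x. hermite n (x / sqrt 2)) has_real_derivative
      2 * real n * hermite (n - 1) (x / sqrt 2) * (1 / sqrt 2)) (at x)"
    by (rule DERIV_chain2[OF hermite_deriv]) (rule DERIV_cdivide[OF DERIV_ident])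
  have outer: "((\<lambda>x. exp (- (x\<^sup>2 / 4))) has_real_derivative exp (- (x\<^sup>2 / 4)) * (- (x / 2))) (at x)"
    by (auto intro!: derivative_eq_intros)
  have "2 / sqrt 2 = sqrt (2::real)" by (rule real_div_sqrt) simp
  then have "2 * real n * hermite (n - 1) (x / sqrt 2) * (1 / sqrt 2)
      = sqrt 2 * real n * hermite (n - 1) (x / sqrt 2)"
    by (simp add: field_simps)
  with inner have "((\<lambda>x. hermite n (x / sqrt 2)) has_real_derivative
      sqrt 2 * real n * hermite (n - 1) (x / sqrt 2)) (at x)"
    by simp
  from DERIV_cdivide[OF DERIV_mult[OF this outer], of D]
  have "(hermite_fun n has_real_derivative
      (sqrt 2 * real n * hermite (n - 1) (x / sqrt 2) * exp (- (x\<^sup>2 / 4))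
        + exp (- (x\<^sup>2 / 4)) * (- (x / 2)) * hermite n (x / sqrt 2)) / D) (at x)"
    by (simp add: hermite_fun_def[abs_def] D_def)
  moreover have "(sqrt 2 * real n * hermite (n - 1) (x / sqrt 2) * exp (- (x\<^sup>2 / 4))
        + exp (- (x\<^sup>2 / 4)) * (- (x / 2)) * hermite n (x / sqrt 2)) / D
      = sqrt n * hermite_fun (n - 1) x - x / 2 * hermite_fun n x"
    unfolding hermite_fun_lower hermite_fun_def[of n] D_def[symmetric]
    using D by (simp add: field_simps)
  ultimately show ?thesis by simp
qed

lemma hermite_fun_deriv_raise:
  "(hermite_fun n has_real_derivative
     x / 2 * hermite_fun n x - sqrt (n + 1) * hermite_fun (Suc n) x) (at x)"
proof (rule DERIV_cong[OF hermite_fun_deriv])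
  have "x / 2 * hermite_fun n x = x * hermite_fun n x / 2" by simp
  then show "sqrt n * hermite_fun (n - 1) x - x / 2 * hermite_fun n x
      = x / 2 * hermite_fun n x - sqrt (n + 1) * hermite_fun (Suc n) x"
    using hermite_fun_three_term[of x n] by argo
qed

lemma deriv_hermite_fun:
  "deriv (hermite_fun n) =
     (\<lambda>x. (sqrt n * hermite_fun (n - 1) x - sqrt (n + 1) * hermite_fun (Suc n) x) / 2)"
proof (rule ext, rule DERIV_imp_deriv, rule DERIV_cong[OF hermite_fun_deriv])
  fix x
  have "x / 2 * hermite_fun n x = x * hermite_fun n x / 2" by simp
  then show "sqrt n * hermite_fun (n - 1) x - x / 2 * hermite_fun n x
      = (sqrt n * hermite_fun (n - 1) x - sqrt (n + 1) * hermite_fun (Suc n) x) / 2"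
    using hermite_fun_three_term[of x n] by argo
qed

lemma deriv2_hermite_fun:
  "(deriv (hermite_fun n) has_real_derivative
     (x\<^sup>2 / 4 - 1 / 2 - real n) * hermite_fun n x) (at x)"
proof -
  have eq: "deriv (hermite_fun n) =
      (\<lambda>x. x / 2 * hermite_fun n x - sqrt (n + 1) * hermite_fun (Suc n) x)"
    by (rule ext, rule DERIV_imp_deriv, rule hermite_fun_deriv_raise)
  have "(deriv (hermite_fun n) has_real_derivative
      (1 / 2 * hermite_fun n x
        + (x / 2 * hermite_fun n x - sqrt (n + 1) * hermite_fun (Suc n) x) * (x / 2))
      - sqrt (n + 1) * (sqrt (Suc n) * hermite_fun (Suc n - 1) x - x / 2 * hermite_fun (Suc n) x))
      (at x)"
    unfolding eq
    by (intro DERIV_diff DERIV_mult DERIV_cmult hermite_fun_deriv_raise hermite_fun_deriv)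
       (auto intro!: derivative_eq_intros)
  moreover have "sqrt (n + 1) * (sqrt (Suc n) * z) = (real n + 1) * z" for z
    by (simp add: add.commute flip: mult.assoc)
  ultimately show ?thesis
    by (simp add: algebra_simps power2_eq_square)
qed

lemma L_op_hermite_fun: "L_op (hermite_fun n) x = (real n - 1) * hermite_fun n x"
  unfolding L_op_def DERIV_imp_deriv[OF deriv2_hermite_fun]
  by (simp add: algebra_simps)

lemma L_op_deriv_hermite_fun:
  "L_op (deriv (hermite_fun n)) x =
     ((real n - 2) * sqrt n * hermite_fun (n - 1) x
       - real n * sqrt (n + 1) * hermite_fun (Suc n) x) / 2"
proof -
  have d1: "(hermite_fun m has_real_derivative deriv (hermite_fun m) z) (at z)" for m z
    using hermite_fun_deriv[of m z] by (simp add: DERIV_imp_deriv)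
  have d2: "(deriv (hermite_fun m) has_real_derivative deriv (deriv (hermite_fun m)) z) (at z)"
    for m z
    using deriv2_hermite_fun[of m z] by (simp add: DERIV_imp_deriv)
  have 1: "deriv (deriv (hermite_fun n)) =
      (\<lambda>x. (sqrt n * deriv (hermite_fun (n - 1)) x
             - sqrt (n + 1) * deriv (hermite_fun (Suc n)) x) / 2)"
    unfolding deriv_hermite_fun[of n]
    by (rule ext, rule DERIV_imp_deriv, intro DERIV_cdivide DERIV_diff DERIV_cmult d1)
  have 2: "deriv (deriv (deriv (hermite_fun n))) x =
      (sqrt n * deriv (deriv (hermite_fun (n - 1))) x
        - sqrt (n + 1) * deriv (deriv (hermite_fun (Suc n))) x) / 2"
    unfolding 1 by (rule DERIV_imp_deriv, intro DERIV_cdivide DERIV_diff DERIV_cmult d2)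
  have "L_op (deriv (hermite_fun n)) x =
      (sqrt n * L_op (hermite_fun (n - 1)) x - sqrt (n + 1) * L_op (hermite_fun (Suc n)) x) / 2"
  proof -
    have alg: "- ((a * p - b * q) / 2) + c * ((a * r - b * t) / 2)
        = (a * (- p + c * r) - b * (- q + c * t)) / 2" for a b c p q r t :: real
      by (simp add: field_simps)
    show ?thesis
      unfolding L_op_def 2 unfolding deriv_hermite_fun[of n] by (rule alg)
  qed
  then show ?thesis
    unfolding L_op_hermite_fun by (cases n) (simp_all add: algebra_simps)
qed


lemma square_int_integrable_mult:
  assumes "square_int f" "square_int g"
  shows "integrable lborel (\<lambda>x. f x * g x)"
proof (rule Bochner_Integration.integrable_bound)
  show "integrable lborel (\<lambda>x. (f x)\<^sup>2 + (g x)\<^sup>2)"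
    using assms by (auto simp: square_int_def)
  show "(\<lambda>x. f x * g x) \<in> borel_measurable lborel"
    using assms by (auto simp: square_int_def)
  have "\<bar>f x * g x\<bar> \<le> (f x)\<^sup>2 + (g x)\<^sup>2" for x
  proof -
    have "2 * (\<bar>f x\<bar> * \<bar>g x\<bar>) \<le> (f x)\<^sup>2 + (g x)\<^sup>2"
      using sum_squares_bound[of "\<bar>f x\<bar>" "\<bar>g x\<bar>"] by simp
    moreover have "0 \<le> \<bar>f x\<bar> * \<bar>g x\<bar>" by simp
    ultimately show ?thesis unfolding abs_mult by linarith
  qed
  then show "AE x in lborel. norm (f x * g x) \<le> norm ((f x)\<^sup>2 + (g x)\<^sup>2)"
    by (auto intro!: AE_I2)
qed

lemma square_int_lin:
  assumes "square_int f" "square_int g"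
  shows "square_int (\<lambda>x. a * f x + b * g x)"
proof -
  have "(\<lambda>x. (a * f x + b * g x)\<^sup>2)
      = (\<lambda>x. a\<^sup>2 * (f x)\<^sup>2 + b\<^sup>2 * (g x)\<^sup>2 + 2 * a * b * (f x * g x))"
    by (auto simp: power2_eq_square algebra_simps)
  then show ?thesis
    using assms square_int_integrable_mult[OF assms] by (auto simp: square_int_def)
qed

lemma square_int_hermite_gauss:
  "square_int (\<lambda>x. x ^ k * (hermite n (x / sqrt 2) * exp (- (x\<^sup>2 / 4))))"
proof (induction n arbitrary: k rule: less_induct)
  case (less n)
  have base: "square_int (\<lambda>x. x ^ k * exp (- (x\<^sup>2 / 4)))" for k
  proof -
    have "(\<lambda>x::real. (x ^ k * exp (- (x\<^sup>2 / 4)))\<^sup>2)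
        = (\<lambda>x. sqrt (2 * pi) * (std_normal_density x * x ^ (2 * k)))"
      by (auto simp: std_normal_density_def power_mult_distrib power_mult[symmetric]
          mult.commute exp_double[symmetric] fun_eq_iff)
    then show ?thesis
      using integrable_std_normal_moment[of "2 * k"] by (auto simp: square_int_def)
  qed
  show ?case
  proof (cases n)
    case 0
    then show ?thesis using base by simp
  next
    case (Suc m)
    have a: "square_int (\<lambda>x. x ^ Suc k * (hermite m (x / sqrt 2) * exp (- (x\<^sup>2 / 4))))"
      using less Suc by blast
    have b: "square_int (\<lambda>x. x ^ k * (hermite (m - 1) (x / sqrt 2) * exp (- (x\<^sup>2 / 4))))"
      using less Suc by (meson diff_le_self le_imp_less_Suc)
    show ?thesis
      using square_int_lin[OF a b, of "2 / sqrt 2" "- 2 * real m"]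
      unfolding Suc hermite_three_term[of m] by (simp add: algebra_simps)
  qed
qed

lemma square_int_hermite_fun: "square_int (hermite_fun n)"
proof -
  define D where "D = sqrt (2 ^ n * fact n * sqrt (2 * pi))"
  have "hermite_fun n = (\<lambda>x. 1 / D * (x ^ 0 * (hermite n (x / sqrt 2) * exp (- (x\<^sup>2 / 4))))
      + 0 * (x ^ 0 * (hermite n (x / sqrt 2) * exp (- (x\<^sup>2 / 4)))))"
    by (auto simp: hermite_fun_def D_def)
  then show ?thesis
    by (simp only: square_int_lin[OF square_int_hermite_gauss square_int_hermite_gauss])
qed

lemma projected_equation_lattice:
  assumes "square_int w"
  shows "- L2_inner (L_op (deriv (hermite_fun n))) w =
    (real n * sqrt (n + 1) * hermite_coeff (n + 1) w
      - (real n - 2) * sqrt n * hermite_coeff (n - 1) w) / 2"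
proof -
  have i: "integrable lborel (\<lambda>x. hermite_fun m x * w x)" for m
    using square_int_integrable_mult[OF square_int_hermite_fun assms] .
  have "L2_inner (L_op (deriv (hermite_fun n))) w =
      (\<integral>x. (real n - 2) * sqrt n / 2 * (hermite_fun (n - 1) x * w x)
         - real n * sqrt (n + 1) / 2 * (hermite_fun (Suc n) x * w x) \<partial>lborel)"
    unfolding L2_inner_def L_op_deriv_hermite_fun
    by (rule Bochner_Integration.integral_cong) (auto simp: field_simps)
  also have "\<dots> = (real n - 2) * sqrt n / 2 * hermite_coeff (n - 1) w
         - real n * sqrt (n + 1) / 2 * hermite_coeff (n + 1) w"
    unfolding hermite_coeff_def L2_inner_def
    by (subst Bochner_Integration.integral_diff) (use i in auto)
  finally show ?thesis by (simp add: field_simps)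
qed


section \<open>The Jacobi operator\<close>

text \<open>Sequences over \<open>{1, 2, \<dots>}\<close> are functions on \<^typ>\<open>nat\<close> whose value at \<open>0\<close> is irrelevant:
  it enters \<open>jacobi f 1\<close> with the factor \<open>jacobi_weight 0 = 0\<close>, and nothing else below.\<close>

definition ell2 :: "(nat \<Rightarrow> complex) \<Rightarrow> bool" where
  "ell2 f \<longleftrightarrow> (\<lambda>n. (cmod (f n))\<^sup>2) summable_on {1..}"

definition ell2_norm :: "(nat \<Rightarrow> complex) \<Rightarrow> real" where
  "ell2_norm f = sqrt (\<Sum>\<^sub>\<infinity>n\<in>{1..}. (cmod (f n))\<^sup>2)"

definition jacobi_weight :: "nat \<Rightarrow> real" where
  "jacobi_weight n = sqrt (real n * real (n + 1) * real (n + 2))"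

definition jacobi :: "(nat \<Rightarrow> complex) \<Rightarrow> nat \<Rightarrow> complex" where
  "jacobi f n = of_real (jacobi_weight n) * f (n + 1) + of_real (jacobi_weight (n - 1)) * f (n - 1)"

text \<open>The domain of the self-adjoint realization. The difference expression is in the limit
  circle case at infinity, hence the boundary condition; \<open>v\<close> is determined on \<open>{1, 2, \<dots>}\<close> by the
  two conditions imposed on it.\<close>

definition jacobi_dom :: "(nat \<Rightarrow> complex) set" where
  "jacobi_dom = {f. ell2 f \<and> ell2 (jacobi f) \<and>
     (\<exists>v. v 1 = 1 \<and> (\<forall>n\<ge>1. jacobi v n = 0) \<and>
       (\<lambda>n. of_real (jacobi_weight n) * (v n * f (n + 1) - v (n + 1) * f n)) \<longlonglongrightarrow> 0)}"

text \<open>Mild solutions on \<open>[0, \<infinity>)\<close> of the Cauchy problem \<open>f' = (\<i>/2) \<J> f\<close> in \<open>\<ell>\<^sup>2\<close>, \<open>\<J>\<close> being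
  \<^const>\<open>jacobi\<close> on \<^const>\<open>jacobi_dom\<close>, that is the orbits of the group \<open>exp (\<i> \<J> t / 2)\<close> through
  arbitrary initial data, which need not lie in the domain: \<open>f\<close> is norm continuous,
  \<open>\<integral>\<^sub>0\<^sup>t f ds\<close> is in the domain of \<open>\<J>\<close>, and \<open>f t = f 0 + (\<i>/2) \<J> (\<integral>\<^sub>0\<^sup>t f ds)\<close>.\<close>

definition jacobi_evolution :: "(real \<Rightarrow> nat \<Rightarrow> complex) \<Rightarrow> bool" where
  "jacobi_evolution f \<longleftrightarrow>
     (\<forall>t\<ge>0. ell2 (f t)) \<and>
     (\<forall>t\<ge>0. ((\<lambda>s. ell2_norm (\<lambda>n. f s n - f t n)) \<longlongrightarrow> 0) (at t within {0..})) \<and>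
     (\<forall>t\<ge>0. (\<lambda>n. integral {0..t} (\<lambda>s. f s n)) \<in> jacobi_dom \<and>
        (\<forall>n\<ge>1. f t n = f 0 n + \<i> / 2 * jacobi (\<lambda>n. integral {0..t} (\<lambda>s. f s n)) n))"


section \<open>Solutions of the linearized log-KdV equation\<close>

text \<open>The sequence \<open>f\<close> with \<open>\<i>\<^sup>n f\<^sub>n = a\<^sub>n\<close> and \<open>a\<^sub>n = \<surd>n c\<^sub>n\<^sub>+\<^sub>1\<close>.\<close>

definition jacobi_coords :: "(real \<Rightarrow> real) \<Rightarrow> nat \<Rightarrow> complex" where
  "jacobi_coords w n = of_real (sqrt n * hermite_coeff (n + 1) w) / \<i> ^ n"

text \<open>The third clause is the component of \<open>u\<^sub>t = \<partial>\<^sub>x L u\<close> along the \<open>n\<close>-th Hermite function, with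
  \<open>\<partial>\<^sub>x L\<close> moved onto that function by parts; by \<open>projected_equation_lattice\<close> it is the
  lattice system \<open>2 c\<^sub>n' = n \<surd>(n+1) c\<^sub>n\<^sub>+\<^sub>1 - (n-2) \<surd>n c\<^sub>n\<^sub>-\<^sub>1\<close>. The lattice system alone does not
  determine the evolution in \<^const>\<open>X_c\<close>, since the Jacobi difference expression has several
  self-adjoint realizations; the last clause selects the one above.\<close>

definition linearized_logKdV_solution ::
    "(real \<Rightarrow> real) \<Rightarrow> (real \<Rightarrow> real \<Rightarrow> real) \<Rightarrow> bool" where
  "linearized_logKdV_solution u0 u \<longleftrightarrow>
     (\<forall>t\<ge>0. u t \<in> X_c) \<and>
     (AE x in lborel. u 0 x = u0 x) \<and>
     (\<forall>n. \<forall>t\<ge>0. ((\<lambda>s. hermite_coeff n (u s)) has_real_derivative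
        - L2_inner (L_op (deriv (hermite_fun n))) (u t)) (at t within {0..})) \<and>
     jacobi_evolution (\<lambda>t. jacobi_coords (u t))"

end

theory Submission
  imports Defs "HOL-Complex_Analysis.Great_Picard"
begin

text \<open>In the coordinates \<open>a\<^sub>n = \<surd>n c\<^sub>n\<^sub>+\<^sub>1\<close> the equation reads \<open>2 a' = skew a\<close> with a formally
  skew-symmetric Jacobi difference expression, and \<open>E\<^sub>c (u) = \<Sum> a\<^sub>n\<^sup>2\<close> on \<open>X\<^sub>c\<close>. The null solution lives on odd
  indices and has explicit hypergeometric entries, so the boundary condition at infinity only
  says that \<open>null_flux k * a (2 * k) \<rightarrow> 0\<close> for explicit weights. Truncations at odd size satisfy that condition
  with bounds uniform in the size, hence a componentwise limit of the truncated flows is a mild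
  solution. Uniqueness holds because the energy flux through index \<open>2 k\<close> of the primitive of a
  difference of solutions vanishes as \<open>k \<rightarrow> \<infinity>\<close>; applied to the time-reversed flow it yields
  conservation of the norm. Completeness of the Hermite functions and Parseval's identity for
  \<open>x u / 2 \<plusminus> u'\<close> translate all this back to functions on the line.\<close>


section \<open>The null solution of the Jacobi expression\<close>

text \<open>The weights grow like n^(3/2), so square summability alone does not force the flux
  \<open>jacobi_weight N * a N * a (N + 1)\<close> to vanish; energy may leak through infinity
  unless the boundary condition is used. Dividing by the null solution splits the flux at N = 2 k
  into \<open>null_flux k * a (2 * k)\<close>, which tends to 0 by that condition, and
  \<open>a (2 * k + 1) / null_odd k\<close>, which stays bounded. A mild solution need not lie in
  the domain, but its primitive does; this is why the energy argument runs on primitives. Truncated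
  flows conserve the norm, yet a componentwise limit may lose norm; time reversal, realized by the
  signs (-1)^n, supplies the missing inequality. The passage to a_n hides c_1: the factor sqrt 0
  removes it, and the energy does not see it because its eigenvalue under L is 0. It is recovered by
  integrating c_1' = c_2 / sqrt 2.\<close>

text \<open>Under \<open>a\<^sub>n = \<i>\<^sup>n f\<^sub>n\<close> the operator \<open>\<i> J\<close> becomes the real skew-symmetric expression \<open>skew\<close>.\<close>

definition skew :: "(nat \<Rightarrow> real) \<Rightarrow> nat \<Rightarrow> real" where
  "skew a n = jacobi_weight n * a (n + 1) - jacobi_weight (n - 1) * a (n - 1)"

text \<open>The recursion is \<open>skew v (Suc n) = 0\<close> solved for the entry at n + 2. Since
  \<open>jacobi_weight 0 = 0\<close>, it forces the entry at 2, and then every even entry, to be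
  0.\<close>

fun jacobi_null :: "nat \<Rightarrow> real" where
  "jacobi_null 0 = 0"
| "jacobi_null (Suc 0) = 1"
| "jacobi_null (Suc (Suc n)) = jacobi_weight n / jacobi_weight (Suc n) * jacobi_null n"

text \<open>The entries of the null solution at even indices vanish. Its Wronskian with \<open>a\<close> at \<open>2 k\<close> and at
  \<open>2 k - 1\<close> is \<open>null_flux k * a (2 * k)\<close> up to sign. Square summability of \<open>null_odd\<close> and \<open>1 / null_flux\<close> below is
  the limit circle case.\<close>

definition null_odd :: "nat \<Rightarrow> real" where
  "null_odd k = jacobi_null (2 * k + 1)"

definition null_flux :: "nat \<Rightarrow> real" where
  "null_flux k = jacobi_weight (2 * k) * null_odd k"

lemma jacobi_weight_0 [simp]: "jacobi_weight 0 = 0"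
  by (simp add: jacobi_weight_def)

lemma jacobi_weight_pos: "n \<ge> 1 \<Longrightarrow> jacobi_weight n > 0"
  by (simp add: jacobi_weight_def)

lemma jacobi_weight_nonneg [simp]: "jacobi_weight n \<ge> 0"
  by (simp add: jacobi_weight_def)

lemma jacobi_weight_sq: "(jacobi_weight n)\<^sup>2 = real n * (real n + 1) * (real n + 2)"
  by (simp add: jacobi_weight_def add.commute)

lemma skew_0 [simp]: "skew a 0 = 0"
  by (simp add: skew_def)

lemma skew_diff: "skew (\<lambda>n. a n - b n) n = skew a n - skew b n"
  by (simp add: skew_def algebra_simps)

lemma jacobi_null_even: "jacobi_null (2 * k) = 0"
  by (induction k) auto

lemma jacobi_null_step:
  assumes "n \<ge> 1"
  shows "jacobi_weight n * jacobi_null (n + 1) = jacobi_weight (n - 1) * jacobi_null (n - 1)"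
proof -
  obtain m where n: "n = Suc m" using assms by (cases n) auto
  show ?thesis using jacobi_weight_pos[of n] by (simp add: n)
qed

lemma null_odd_0 [simp]: "null_odd 0 = 1"
  by (simp add: null_odd_def)

lemma null_flux_0 [simp]: "null_flux 0 = 0"
  by (simp add: null_flux_def)

lemma null_flux_Suc: "null_flux (Suc k) = jacobi_weight (2 * k + 1) * null_odd k"
  using jacobi_null_step[of "2 * k + 2"] by (simp add: null_flux_def null_odd_def)

lemma null_odd_pos: "null_odd k > 0"
proof (induction k)
  case (Suc k)
  have "jacobi_weight (2 * Suc k) * null_odd (Suc k) > 0"
    using null_flux_Suc[of k] Suc jacobi_weight_pos[of "2 * k + 1"] by (simp add: null_flux_def)
  then show ?case
    by (rule zero_less_mult_pos) (rule jacobi_weight_pos, simp)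
qed simp

lemma null_flux_Suc_pos: "null_flux (Suc k) > 0"
  unfolding null_flux_def using null_odd_pos[of "Suc k"] jacobi_weight_pos[of "2 * Suc k"] by simp

text \<open>Squaring removes the roots, and the two weights share the factors (2 k + 2) (2 k + 3).
  The remaining ratio (2 k + 1) / (2 k + 4) means that \<open>null_odd\<close> squared decays like
  k^(-3/2).\<close>

lemma null_odd_sq_step: "(2 * real k + 4) * (null_odd (Suc k))\<^sup>2 = (2 * real k + 1) * (null_odd k)\<^sup>2"
proof -
  have "(jacobi_weight (2 * Suc k) * null_odd (Suc k))\<^sup>2 = (jacobi_weight (2 * k + 1) * null_odd k)\<^sup>2"
    using null_flux_Suc[of k] by (simp add: null_flux_def)
  then have "((2 * real k + 2) * (2 * real k + 3)) * ((2 * real k + 4) * (null_odd (Suc k))\<^sup>2)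
      = ((2 * real k + 2) * (2 * real k + 3)) * ((2 * real k + 1) * (null_odd k)\<^sup>2)"
    unfolding power_mult_distrib jacobi_weight_sq by (simp add: algebra_simps)
  moreover have "(2 * real k + 2) * (2 * real k + 3) \<noteq> 0"
    using of_nat_0_le_iff[of k, where ?'a = real] by (simp add: add_nonneg_eq_0_iff)
  ultimately show ?thesis using mult_left_cancel by blast
qed

text \<open>The ratio (2 k + 5) / (2 k + 2) makes \<open>null_flux\<close> squared grow like
  k^(3/2), so its reciprocal is summable too.\<close>

lemma null_flux_sq_step:
  "(2 * real k + 2) * (null_flux (Suc (Suc k)))\<^sup>2 = (2 * real k + 5) * (null_flux (Suc k))\<^sup>2"
proof -
  have "2 * real k + 2 > 0" by simp
  have "(null_flux (Suc (Suc k)))\<^sup>2 = (2 * real k + 3) * (2 * real k + 4) * (2 * real k + 5) * (null_odd (Suc k))\<^sup>2"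
    unfolding null_flux_Suc power_mult_distrib jacobi_weight_sq by (simp add: algebra_simps)
  moreover have "(null_flux (Suc k))\<^sup>2 = (2 * real k + 2) * (2 * real k + 3) * (2 * real k + 4) * (null_odd (Suc k))\<^sup>2"
    unfolding null_flux_def power_mult_distrib jacobi_weight_sq by (simp add: algebra_simps)
  ultimately show ?thesis by simp
qed

text \<open>The series of \<open>null_odd\<^sup>2\<close> and \<open>1 / null_flux\<^sup>2\<close> telescope, because their terms are
  hypergeometric.\<close>

lemma summable_telescope:
  fixes r e :: "nat \<Rightarrow> real"
  assumes "\<And>k. r k \<ge> 0" "\<And>k. e k \<ge> 0" "\<And>k. e k - e (Suc k) = r k"
  shows "summable r"
proof (rule summableI_nonneg_bounded)
  fix n
  have "(\<Sum>k<n. r k) = e 0 - e n"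
    using sum_lessThan_telescope'[of e n] assms(3) by simp
  then show "(\<Sum>k<n. r k) \<le> e 0" using assms(2)[of n] by simp
qed (use assms in auto)

lemma summable_null_odd_sq: "summable (\<lambda>k. (null_odd k)\<^sup>2)"
\<comment> \<open>The factor is chosen to become 2 k + 4 at \<open>Suc k\<close>, where
  \<open>null_odd_sq_step\<close> turns it into 2 k + 1; the difference leaves exactly one copy of
  the term.\<close>
proof (rule summable_telescope[where e = "\<lambda>k. (2 * real k + 2) * (null_odd k)\<^sup>2"])
  fix k
  show "(2 * real k + 2) * (null_odd k)\<^sup>2 - (2 * real (Suc k) + 2) * (null_odd (Suc k))\<^sup>2 = (null_odd k)\<^sup>2"
    using null_odd_sq_step[of k] by (simp add: distrib_right add.commute)
qed auto

lemma summable_inverse_null_flux_sq: "summable (\<lambda>k. (1 / null_flux (Suc k))\<^sup>2)"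
\<comment> \<open>As before: the factor becomes 2 k + 5 at \<open>Suc k\<close>, and
  \<open>null_flux_sq_step\<close> turns this into 2 k + 2, one less than 2 k + 3.\<close>
proof (rule summable_telescope[where e = "\<lambda>k. (2 * real k + 3) * (1 / null_flux (Suc k))\<^sup>2"])
  fix k
  have "(null_flux (Suc k))\<^sup>2 > 0" "(null_flux (Suc (Suc k)))\<^sup>2 > 0"
    using null_flux_Suc_pos by (simp_all add: less_imp_neq[symmetric])
  then have e: "(2 * real k + 5) * (1 / (null_flux (Suc (Suc k)))\<^sup>2) = (2 * real k + 2) * (1 / (null_flux (Suc k))\<^sup>2)"
    using null_flux_sq_step[of k] by (simp add: frac_eq_eq del: null_flux_0)
  have "2 * real (Suc k) + 3 = 2 * real k + 5" by simp
  with e show "(2 * real k + 3) * (1 / null_flux (Suc k))\<^sup>2 - (2 * real (Suc k) + 3) * (1 / null_flux (Suc (Suc k)))\<^sup>2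
      = (1 / null_flux (Suc k))\<^sup>2"
    unfolding power_one_over by (simp only:) (simp add: diff_divide_distrib[symmetric])
qed auto

section \<open>Discrete Lagrange identities for the null solution\<close>

lemma skew_odd: "null_flux (Suc k) * a (2 * k + 2) - null_flux k * a (2 * k) = null_odd k * skew a (2 * k + 1)"
  by (simp add: null_flux_Suc skew_def) (simp add: null_flux_def algebra_simps)

text \<open>Reduction of order: the quotient by the null solution moves only by the inhomogeneity.
  With \<open>skew_odd\<close>, the expression decouples into two first-order recursions, the odd
  equations driving the even entries and the even equations the odd ones.\<close>

lemma skew_even:
  "null_flux (Suc k) * (a (2 * k + 3) / null_odd (Suc k) - a (2 * k + 1) / null_odd k) = skew a (2 * k + 2)"
proof -
  have "null_flux (Suc k) * (a (2 * k + 3) / null_odd (Suc k)) = jacobi_weight (2 * k + 2) * a (2 * k + 3)"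
    unfolding null_flux_def using null_odd_pos[of "Suc k"] by simp
  moreover have "null_flux (Suc k) * (a (2 * k + 1) / null_odd k) = jacobi_weight (2 * k + 1) * a (2 * k + 1)"
    unfolding null_flux_Suc using null_odd_pos[of "k"] by simp
  ultimately show ?thesis by (simp add: skew_def right_diff_distrib numeral_3_eq_3)
qed

section \<open>Square-sum bounds through partial sums\<close>

definition l2_bound :: "(nat \<Rightarrow> real) \<Rightarrow> real \<Rightarrow> bool" where
  "l2_bound x M \<longleftrightarrow> (\<forall>N. (\<Sum>n<N. (x n)\<^sup>2) \<le> M)"

lemma l2_bound_sum:
  assumes "l2_bound x M" "finite J" "inj_on h J"
  shows "(\<Sum>j\<in>J. (x (h j))\<^sup>2) \<le> M"
proof -
  obtain N where N: "h ` J \<subseteq> {..<N}"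
    using assms(2) by (meson finite_imageI finite_nat_iff_bounded)
  have "(\<Sum>j\<in>J. (x (h j))\<^sup>2) = (\<Sum>n\<in>h ` J. (x n)\<^sup>2)"
    using assms(3) by (simp add: sum.reindex)
  also have "\<dots> \<le> (\<Sum>n<N. (x n)\<^sup>2)"
    using N by (intro sum_mono2) auto
  finally show ?thesis using assms(1) unfolding l2_bound_def by (meson order_trans)
qed

lemma l2_bound_nonneg: "l2_bound x M \<Longrightarrow> M \<ge> 0"
  unfolding l2_bound_def by (metis lessThan_0 sum.empty)

text \<open>Link to infinite sums. The partial-sum form is the working one because a bound with a
  fixed constant passes to componentwise limits at once.\<close>

lemma l2_bound_iff_suminf:
  "l2_bound x M \<longleftrightarrow> summable (\<lambda>n. (x n)\<^sup>2) \<and> (\<Sum>n. (x n)\<^sup>2) \<le> M"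
proof
  assume l: "l2_bound x M"
  then have "summable (\<lambda>n. (x n)\<^sup>2)"
    by (intro summableI_nonneg_bounded[of _ M]) (auto simp: l2_bound_def)
  with l show "summable (\<lambda>n. (x n)\<^sup>2) \<and> (\<Sum>n. (x n)\<^sup>2) \<le> M"
    by (auto simp: l2_bound_def intro!: suminf_le_const)
next
  assume "summable (\<lambda>n. (x n)\<^sup>2) \<and> (\<Sum>n. (x n)\<^sup>2) \<le> M"
  then show "l2_bound x M"
    unfolding l2_bound_def by (meson order_trans sum_le_suminf finite_lessThan zero_le_power2)
qed

lemma l2_bound_pair_sum:
  assumes "l2_bound x M" "finite J" "inj_on h J" "(\<Sum>j\<in>J. (y j)\<^sup>2) \<le> R"
  shows "\<bar>\<Sum>j\<in>J. y j * x (h j)\<bar> \<le> sqrt (R * M)"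
proof -
  have "(\<Sum>j\<in>J. y j * x (h j))\<^sup>2 \<le> (\<Sum>j\<in>J. (y j)\<^sup>2) * (\<Sum>j\<in>J. (x (h j))\<^sup>2)"
    by (rule Cauchy_Schwarz_ineq_sum)
  also have "\<dots> \<le> R * M"
    using assms l2_bound_sum[OF assms(1-3)] sum_nonneg[of J "\<lambda>j. (y j)\<^sup>2"]
    by (intro mult_mono) (auto intro: sum_nonneg)
  finally show ?thesis by (simp add: real_le_rsqrt)
qed

lemma l2_bound_diff:
  assumes "l2_bound x M" "l2_bound y R"
  shows "l2_bound (\<lambda>n. x n - y n) (2 * M + 2 * R)"
  unfolding l2_bound_def
proof
  fix N
  have "(x n - y n)\<^sup>2 \<le> 2 * (x n)\<^sup>2 + 2 * (y n)\<^sup>2" for n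
    using sum_squares_bound[of "x n" "- y n"] by (simp add: power2_diff)
  then have "(\<Sum>n<N. (x n - y n)\<^sup>2) \<le> (\<Sum>n<N. 2 * (x n)\<^sup>2 + 2 * (y n)\<^sup>2)"
    by (intro sum_mono)
  also have "\<dots> = 2 * (\<Sum>n<N. (x n)\<^sup>2) + 2 * (\<Sum>n<N. (y n)\<^sup>2)"
    by (simp add: sum.distrib sum_distrib_left)
  also have "\<dots> \<le> 2 * M + 2 * R"
    using assms unfolding l2_bound_def by (intro add_mono mult_left_mono) auto
  finally show "(\<Sum>n<N. (x n - y n)\<^sup>2) \<le> 2 * M + 2 * R" .
qed

lemma l2_bound_cmult: "l2_bound x M \<Longrightarrow> l2_bound (\<lambda>n. c * x n) (c\<^sup>2 * M)"
  unfolding l2_bound_def power_mult_distrib sum_distrib_left[symmetric]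
  by (simp add: mult_left_mono)

lemma l2_bound_abs_le:
  assumes "l2_bound x M" "\<And>n. \<bar>x' n\<bar> \<le> \<bar>x n\<bar>"
  shows "l2_bound x' M"
  unfolding l2_bound_def
proof
  fix N
  have "(\<Sum>n<N. (x' n)\<^sup>2) \<le> (\<Sum>n<N. (x n)\<^sup>2)"
    using assms(2) by (intro sum_mono) (simp add: abs_le_square_iff)
  then show "(\<Sum>n<N. (x' n)\<^sup>2) \<le> M"
    using assms(1) unfolding l2_bound_def by (meson order_trans)
qed

text \<open>Telescoping \<open>skew_even\<close> from index 1, where \<open>null_odd 0 = 1\<close>,
  leaves a pairing of \<open>skew a\<close> with \<open>1 / null_flux\<close>; Cauchy-Schwarz bounds
  it uniformly in k.\<close>

lemma odd_component_bound:
  assumes "l2_bound (skew a) M"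
  shows "\<bar>a (2 * k + 1) / null_odd k\<bar> \<le> \<bar>a 1\<bar> + sqrt ((\<Sum>k. (1 / null_flux (Suc k))\<^sup>2) * M)"
proof -
  have "a (2 * k + 1) / null_odd k = a 1 + (\<Sum>j<k. (1 / null_flux (Suc j)) * skew a (2 * j + 2))"
  proof (induction k)
    case (Suc k)
    have "a (2 * Suc k + 1) / null_odd (Suc k) - a (2 * k + 1) / null_odd k = 1 / null_flux (Suc k) * skew a (2 * k + 2)"
      using skew_even[of k a] null_flux_Suc_pos[of k] by (simp add: field_simps numeral_3_eq_3)
    then show ?case using Suc by simp
  qed simp
  moreover have "\<bar>\<Sum>j<k. (1 / null_flux (Suc j)) * skew a (2 * j + 2)\<bar>
      \<le> sqrt ((\<Sum>k. (1 / null_flux (Suc k))\<^sup>2) * M)"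
    by (rule l2_bound_pair_sum[OF assms])
       (auto intro!: sum_le_suminf summable_inverse_null_flux_sq simp: inj_on_def)
  ultimately show ?thesis by simp
qed

lemma even_component_telescope:
  assumes "k \<le> K"
  shows "null_flux K * a (2 * K) - null_flux k * a (2 * k) = (\<Sum>j=k..<K. null_odd j * skew a (2 * j + 1))"
  using assms
proof (induction K rule: dec_induct)
  case (step n)
  then show ?case using skew_odd[of n a] by simp
qed simp

definition null_odd_tail :: "nat \<Rightarrow> real" where
  "null_odd_tail k = (\<Sum>j. (null_odd (j + k))\<^sup>2)"

lemma null_odd_tail_tendsto: "null_odd_tail \<longlonglongrightarrow> 0"
  unfolding null_odd_tail_def using suminf_exist_split2[OF summable_null_odd_sq] .

lemma null_odd_tail_sum: "(\<Sum>j=k..<K. (null_odd j)\<^sup>2) \<le> null_odd_tail k"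
proof -
  have "(\<Sum>j=k..<K. (null_odd j)\<^sup>2) = (\<Sum>j<K - k. (null_odd (j + k))\<^sup>2)"
    by (rule sum.reindex_bij_witness[of _ "\<lambda>j. j + k" "\<lambda>j. j - k"]) auto
  also have "\<dots> \<le> null_odd_tail k"
    unfolding null_odd_tail_def
    by (intro sum_le_suminf) (use summable_ignore_initial_segment[OF summable_null_odd_sq] in auto)
  finally show ?thesis .
qed

lemma null_odd_tail_le: "null_odd_tail k \<le> null_odd_tail 0"
proof -
  have "(\<Sum>j<k. (null_odd j)\<^sup>2) \<ge> 0" by (intro sum_nonneg) auto
  then show ?thesis
    unfolding null_odd_tail_def using suminf_split_initial_segment[OF summable_null_odd_sq, of k] by simp
qed

text \<open>Telescoping back from the zero at 2 K. The bound is free of K and tends to 0 in k, which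
  is how the boundary condition survives the limit of truncations. \<open>x\<close> stands in for
  \<open>skew a\<close> because a truncated flow obeys the equation only up to its size.\<close>

lemma even_component_bound_finite:
  assumes "l2_bound x M" "\<And>j. j < K \<Longrightarrow> skew a (2 * j + 1) = x (2 * j + 1)" "a (2 * K) = 0" "k \<le> K"
  shows "\<bar>null_flux k * a (2 * k)\<bar> \<le> sqrt (null_odd_tail k * M)"
proof -
  have "\<bar>\<Sum>j=k..<K. null_odd j * x (2 * j + 1)\<bar> \<le> sqrt (null_odd_tail k * M)"
    by (rule l2_bound_pair_sum[OF assms(1)]) (auto simp: null_odd_tail_sum inj_on_def)
  moreover have "(\<Sum>j=k..<K. null_odd j * x (2 * j + 1)) = (\<Sum>j=k..<K. null_odd j * skew a (2 * j + 1))"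
    using assms(2) by (intro sum.cong) auto
  ultimately show ?thesis
    using even_component_telescope[OF assms(4), of a] assms(3) by simp
qed

text \<open>The same telescoping with K \<rightarrow> \<infinity>: the boundary condition replaces
  the zero at a finite index.\<close>

lemma even_component_bound:
  assumes "l2_bound (skew a) M" "(\<lambda>k. null_flux k * a (2 * k)) \<longlonglongrightarrow> 0"
  shows "\<bar>null_flux k * a (2 * k)\<bar> \<le> sqrt (null_odd_tail 0 * M)"
proof -
  have "\<bar>null_flux K * a (2 * K) - null_flux k * a (2 * k)\<bar> \<le> sqrt (null_odd_tail 0 * M)" if "k \<le> K" for K
    unfolding even_component_telescope[OF that]
    using order_trans[OF null_odd_tail_sum null_odd_tail_le]
    by (intro l2_bound_pair_sum[OF assms(1)]) (auto simp: inj_on_def)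
  then have "eventually (\<lambda>K. \<bar>null_flux K * a (2 * K) - null_flux k * a (2 * k)\<bar> \<le> sqrt (null_odd_tail 0 * M)) sequentially"
    by (rule eventually_mono[OF eventually_ge_at_top[of k]])
  moreover have "(\<lambda>K. \<bar>null_flux K * a (2 * K) - null_flux k * a (2 * k)\<bar>) \<longlonglongrightarrow> \<bar>0 - null_flux k * a (2 * k)\<bar>"
    by (intro tendsto_intros assms(2))
  ultimately have "\<bar>0 - null_flux k * a (2 * k)\<bar> \<le> sqrt (null_odd_tail 0 * M)"
    by (intro tendsto_upperbound[OF _ _ sequentially_bot])
  then show ?thesis by simp
qed

section \<open>Energy flux and uniqueness\<close>

lemma sum_mult_skew:
  "(\<Sum>n=1..N. a n * skew a n) = jacobi_weight N * a N * a (N + 1)"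
proof (induction N)
  case (Suc N)
  then show ?case by (simp add: skew_def algebra_simps)
qed simp

text \<open>Energy estimate for the primitive \<open>G\<close>, which starts at 0 and satisfies G' =
  g = skew G / 2. The partial sum of its squares up to 2 k is the time integral of the flux at 2 k;
  that flux is dominated and tends to 0, so \<open>G\<close> vanishes and with it
  \<open>g\<close>.\<close>

lemma skew_evolution_zero:
  fixes g :: "real \<Rightarrow> nat \<Rightarrow> real"
  defines "G \<equiv> \<lambda>t n. integral {0..t} (\<lambda>s. g s n)"
  assumes cont: "\<And>n. continuous_on {0..T} (\<lambda>s. g s n)"
    and bd: "\<And>t. t \<in> {0..T} \<Longrightarrow> l2_bound (g t) M"
    and eq: "\<And>t n. t \<in> {0..T} \<Longrightarrow> n \<ge> 1 \<Longrightarrow> g t n = skew (G t) n / 2"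
    and bc: "\<And>t. t \<in> {0..T} \<Longrightarrow> (\<lambda>k. null_flux k * G t (2 * k)) \<longlonglongrightarrow> 0"
    and t: "t \<in> {0..T}" and n: "n \<ge> 1"
  shows "g t n = 0"
proof -
  have G: "((\<lambda>s. G s m) has_real_derivative g s m) (at s within {0..T})" if "s \<in> {0..T}" for s m
    unfolding G_def by (rule integral_has_real_derivative[OF cont that])
  have Gcont: "continuous_on {0..T} (\<lambda>s. G s m)" for m
    by (rule DERIV_continuous_on[OF G])
  have energy: "(\<Sum>m=1..N. (G r m)\<^sup>2) = integral {0..r} (\<lambda>s. jacobi_weight N * G s N * G s (N + 1))"
    if r: "r \<in> {0..T}" for N r
  proof -
    have "((\<lambda>s. jacobi_weight N * G s N * G s (N + 1)) has_integral
        ((\<Sum>m=1..N. (G r m)\<^sup>2) - (\<Sum>m=1..N. (G 0 m)\<^sup>2))) {0..r}"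
    proof (rule fundamental_theorem_of_calculus)
      fix s assume "s \<in> {0..r}"
      then have s: "s \<in> {0..T}" using r by auto
      have "((\<lambda>s. \<Sum>m=1..N. (G s m)\<^sup>2) has_real_derivative (\<Sum>m=1..N. 2 * G s m * g s m))
          (at s within {0..T})"
        by (auto intro!: derivative_eq_intros G[OF s] simp: mult_ac)
      moreover have "(\<Sum>m=1..N. 2 * G s m * g s m) = (\<Sum>m=1..N. G s m * skew (G s) m)"
        by (intro sum.cong) (auto simp: eq[OF s])
      ultimately have "((\<lambda>s. \<Sum>m=1..N. (G s m)\<^sup>2) has_real_derivative
          jacobi_weight N * G s N * G s (N + 1)) (at s within {0..T})"
        by (simp add: sum_mult_skew del: One_nat_def)
      then have "((\<lambda>s. \<Sum>m=1..N. (G s m)\<^sup>2) has_vector_derivative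
          jacobi_weight N * G s N * G s (N + 1)) (at s within {0..T})"
        by (simp only: has_real_derivative_iff_has_vector_derivative)
      moreover have "{0..r} \<subseteq> {0..T}" using r by simp
      ultimately show "((\<lambda>s. \<Sum>m=1..N. (G s m)\<^sup>2) has_vector_derivative
          jacobi_weight N * G s N * G s (N + 1)) (at s within {0..r})"
        by (rule has_vector_derivative_within_subset)
    qed (use r in auto)
    moreover have "G 0 m = 0" for m by (simp add: G_def)
    ultimately show ?thesis by (simp add: integral_unique)
  qed
  \<comment> \<open>\<open>T * sqrt M\<close> will bound \<open>G s 1\<close> as an integral of
    \<open>g\<close>; the factor 4 comes from \<open>skew (G s) = 2 * g s\<close>.\<close>
  define B where "B = T * sqrt M + sqrt ((\<Sum>k. (1 / null_flux (Suc k))\<^sup>2) * (4 * M))"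
  have tail0: "null_odd_tail 0 \<ge> 0" using null_odd_tail_sum[of 0 0] by simp
  have M: "M \<ge> 0" using l2_bound_nonneg[OF bd[OF t]] .
  have T: "T \<ge> 0" using t by auto
  have skewb: "l2_bound (skew (G s)) (4 * M)" if "s \<in> {0..T}" for s
  proof (rule l2_bound_abs_le)
    show "l2_bound (\<lambda>n. 2 * g s n) (4 * M)"
      using l2_bound_cmult[OF bd[OF that], of 2] by simp
    show "\<bar>skew (G s) m\<bar> \<le> \<bar>2 * g s m\<bar>" for m
      using eq[OF that, of m] by (cases "m = 0") auto
  qed
  have G1: "\<bar>G s 1\<bar> \<le> T * sqrt M" if s: "s \<in> {0..T}" for s
  proof -
    have "norm (integral {0..s} (\<lambda>r. g r 1)) \<le> sqrt M * (s - 0)"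
    proof (rule integral_bound)
      show "continuous_on {0..s} (\<lambda>r. g r 1)"
        using continuous_on_subset[OF cont] s by auto
      show "norm (g r 1) \<le> sqrt M" if "r \<in> {0..s}" for r
        using l2_bound_sum[OF bd, of r "{1}" id] s that by (auto simp: real_le_rsqrt)
    qed (use s in auto)
    also have "\<dots> \<le> sqrt M * T" using s M by (intro mult_left_mono) auto
    finally show ?thesis by (simp add: G_def mult.commute)
  qed
  have odd: "\<bar>G s (2 * k + 1) / null_odd k\<bar> \<le> B" if s: "s \<in> {0..T}" for s k
    using odd_component_bound[OF skewb[OF s], of k] G1[OF s] by (simp add: B_def)
  have B0: "B \<ge> 0" using odd[OF t, of 0] by linarith
  \<comment> \<open>The splitting that makes the flux controllable: a factor tending to 0 times a
    bounded one.\<close>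
  have flux: "jacobi_weight (2 * k) * G s (2 * k) * G s (2 * k + 1)
      = null_flux k * G s (2 * k) * (G s (2 * k + 1) / null_odd k)" for s k
    using null_odd_pos[of k] by (simp add: null_flux_def)
  have zero: "G r m = 0" if r: "r \<in> {0..T}" and m: "m \<ge> 1" for r m
  proof -
    have "(\<lambda>k. integral {0..r} (\<lambda>s. jacobi_weight (2 * k) * G s (2 * k) * G s (2 * k + 1)))
        \<longlonglongrightarrow> integral {0..r} (\<lambda>s. 0)"
    proof (rule dominated_convergence(2)[where h = "\<lambda>s. sqrt (null_odd_tail 0 * (4 * M)) * B"])
      fix k
      have "continuous_on {0..r} (\<lambda>s. jacobi_weight (2 * k) * G s (2 * k) * G s (2 * k + 1))"
        using r by (intro continuous_intros continuous_on_subset[OF Gcont]) auto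
      then show "(\<lambda>s. jacobi_weight (2 * k) * G s (2 * k) * G s (2 * k + 1)) integrable_on {0..r}"
        by (rule integrable_continuous_real)
      fix s assume "s \<in> {0..r}"
      then have s: "s \<in> {0..T}" using r by auto
      show "norm (jacobi_weight (2 * k) * G s (2 * k) * G s (2 * k + 1)) \<le> sqrt (null_odd_tail 0 * (4 * M)) * B"
        unfolding flux real_norm_def abs_mult[of _ "_ / _"]
        using even_component_bound[OF skewb[OF s] bc[OF s], of k] odd[OF s, of k] B0 M tail0
        by (intro mult_mono) auto
    next
      fix s assume "s \<in> {0..r}"
      then have s: "s \<in> {0..T}" using r by auto
      have "(\<lambda>k. \<bar>null_flux k * G s (2 * k)\<bar> * B) \<longlonglongrightarrow> \<bar>0\<bar> * B"
        by (intro tendsto_intros bc[OF s])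
      then have "(\<lambda>k. \<bar>null_flux k * G s (2 * k)\<bar> * B) \<longlonglongrightarrow> 0" by simp
      then show "(\<lambda>k. jacobi_weight (2 * k) * G s (2 * k) * G s (2 * k + 1)) \<longlonglongrightarrow> 0"
      proof (rule Lim_null_comparison[rotated])
        show "\<forall>\<^sub>F k in sequentially. norm (jacobi_weight (2 * k) * G s (2 * k) * G s (2 * k + 1))
            \<le> \<bar>null_flux k * G s (2 * k)\<bar> * B"
          unfolding flux real_norm_def abs_mult[of _ "_ / _"]
          using odd[OF s] by (intro always_eventually allI mult_left_mono) auto
      qed
    qed auto
    then have lim: "(\<lambda>k. \<Sum>m=1..2*k. (G r m)\<^sup>2) \<longlonglongrightarrow> 0"
      unfolding energy[OF r] by simp
    have "(G r m)\<^sup>2 \<le> 0"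
    proof (rule LIMSEQ_le_const[OF lim], intro exI allI impI)
      fix k assume "k \<ge> m"
      then show "(G r m)\<^sup>2 \<le> (\<Sum>m=1..2*k. (G r m)\<^sup>2)"
        using m by (intro member_le_sum) auto
    qed
    then show ?thesis by simp
  qed
  \<comment> \<open>At n = 1 the entry at index 0, about which \<open>zero\<close> is silent,
    carries the weight 0.\<close>
  have "skew (G t) n = 0"
    using zero[OF t] n by (cases "n = 1") (auto simp: skew_def)
  then show ?thesis using eq[OF t n] by simp
qed

text \<open>Truncation at an odd size \<open>N\<close> respects the boundary condition at infinity, because the null
  solution vanishes at \<open>N + 1\<close>; even sizes would select another self-adjoint realization.\<close>

definition galerkin :: "nat \<Rightarrow> (nat \<Rightarrow> real) \<Rightarrow> nat \<Rightarrow> real" where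
  "galerkin N a n = (if 1 \<le> n \<and> n \<le> N then skew a n / 2 else 0)"

text \<open>A finite linear system, solved by its exponential series: \<open>c k\<close> is the k-th
  power of the generator applied to the data, and termwise differentiation shifts k by one.\<close>

lemma galerkin_flow:
  assumes supp: "\<And>n. n \<notin> {1..N} \<Longrightarrow> x n = 0"
  obtains b :: "real \<Rightarrow> nat \<Rightarrow> real" where
    "\<And>n. b 0 n = x n"
    "\<And>t n. ((\<lambda>s. b s n) has_real_derivative galerkin N (b t) n) (at t)"
    "\<And>t n. n \<notin> {1..N} \<Longrightarrow> b t n = 0"
proof -
  define c where "c k = (galerkin N ^^ k) x" for k
  have cSuc: "c (Suc k) = galerkin N (c k)" for k by (simp add: c_def)
  have c0: "c k n = 0" if "n \<notin> {1..N}" for k n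
    using that supp by (cases k) (auto simp: c_def galerkin_def)
  \<comment> \<open>\<open>C\<close> dominates every row sum of weights and \<open>D\<close> is the
    l1 norm of the data; the factor 1/2 of the generator is given away.\<close>
  define C where "C = (\<Sum>n\<le>N. jacobi_weight n + jacobi_weight (n - 1))"
  define D where "D = (\<Sum>n\<le>N. \<bar>x n\<bar>)"
  have C0: "C \<ge> 0" and D0: "D \<ge> 0" by (auto simp: C_def D_def intro!: sum_nonneg)
  have Cn: "jacobi_weight n + jacobi_weight (n - 1) \<le> C" if "n \<le> N" for n
    unfolding C_def using that
    by (intro member_le_sum[where f = "\<lambda>n. jacobi_weight n + jacobi_weight (n - 1)"]) auto
  have cb: "\<bar>c k n\<bar> \<le> C ^ k * D" for k n
  proof (induction k arbitrary: n)
    case 0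
    show ?case
    proof (cases "n \<le> N")
      case True
      then show ?thesis unfolding D_def c_def by (auto intro!: member_le_sum[where f = "\<lambda>n. \<bar>x n\<bar>"])
    next
      case False
      then show ?thesis using supp D0 by (auto simp: c_def)
    qed
  next
    case (Suc k)
    show ?case
    proof (cases "n \<in> {1..N}")
      case True
      have "\<bar>skew (c k) n\<bar> \<le> jacobi_weight n * \<bar>c k (n + 1)\<bar> + jacobi_weight (n - 1) * \<bar>c k (n - 1)\<bar>"
        unfolding skew_def by (rule order_trans[OF abs_triangle_ineq4]) (simp add: abs_mult)
      also have "\<dots> \<le> jacobi_weight n * (C ^ k * D) + jacobi_weight (n - 1) * (C ^ k * D)"
        by (intro add_mono mult_left_mono Suc.IH) auto
      also have "\<dots> = (jacobi_weight n + jacobi_weight (n - 1)) * (C ^ k * D)"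
        by (simp add: distrib_right)
      also have "\<dots> \<le> C * (C ^ k * D)"
        using True C0 D0 by (intro mult_right_mono Cn) auto
      finally show ?thesis using True by (simp add: cSuc galerkin_def)
    next
      case False
      then show ?thesis using C0 D0 by (simp add: c0)
    qed
  qed
  have summ: "summable (\<lambda>k. c k n / fact k * t ^ k)" for n and t :: real
  proof (rule summable_comparison_test')
    show "summable (\<lambda>k. D * ((C * \<bar>t\<bar>) ^ k /\<^sub>R fact k))"
      by (intro summable_mult summable_exp_generic)
    show "norm (c k n / fact k * t ^ k) \<le> D * ((C * \<bar>t\<bar>) ^ k /\<^sub>R fact k)" for k
      using mult_right_mono[OF cb[of k n], of "\<bar>t\<bar> ^ k / fact k"]
      by (simp add: abs_mult power_abs power_mult_distrib field_simps)
  qed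
  define b where "b t n = (\<Sum>k. c k n / fact k * t ^ k)" for t n
  show ?thesis
  proof
    show "b 0 n = x n" for n
      using powser_zero[of "\<lambda>k. c k n / fact k"] by (simp add: b_def c_def)
    show "b t n = 0" if "n \<notin> {1..N}" for t n
      using that by (simp add: b_def c0)
    show "((\<lambda>s. b s n) has_real_derivative galerkin N (b t) n) (at t)" for t n
    proof -
      have dif: "diffs (\<lambda>k. c k n / fact k) = (\<lambda>k. c (Suc k) n / fact k)"
        by (simp add: diffs_def fun_eq_iff del: of_nat_Suc)
      have "((\<lambda>s. b s n) has_real_derivative (\<Sum>k. c (Suc k) n / fact k * t ^ k)) (at t)"
        using termdiffs_strong_converges_everywhere[of "\<lambda>k. c k n / fact k" t] summ
        unfolding dif b_def by blast
      moreover have "(\<Sum>k. c (Suc k) n / fact k * t ^ k) = galerkin N (b t) n"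
      proof (cases "n \<in> {1..N}")
        case True
        have "c (Suc k) n / fact k * t ^ k
            = jacobi_weight n / 2 * (c k (n + 1) / fact k * t ^ k)
              - jacobi_weight (n - 1) / 2 * (c k (n - 1) / fact k * t ^ k)" for k
          using True by (simp add: cSuc galerkin_def skew_def field_simps)
        then have "(\<Sum>k. c (Suc k) n / fact k * t ^ k)
            = jacobi_weight n / 2 * b t (n + 1) - jacobi_weight (n - 1) / 2 * b t (n - 1)"
          unfolding b_def by (simp only: suminf_diff[symmetric] suminf_mult[symmetric] summable_mult summ)
        then show ?thesis using True by (simp add: galerkin_def skew_def field_simps)
      next
        case False
        then show ?thesis by (auto simp: c0 galerkin_def)
      qed
      ultimately show ?thesis by simp
    qed
  qed
qed

text \<open>The flux through the end of the truncation contains the entry at N + 1, which is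
  0.\<close>

lemma galerkin_flow_norm:
  assumes d: "\<And>t n. ((\<lambda>s. b s n) has_real_derivative galerkin N (b t) n) (at t)"
    and supp: "\<And>t n. n \<notin> {1..N} \<Longrightarrow> b t n = 0"
  shows "(\<Sum>n=1..N. (b t n)\<^sup>2) = (\<Sum>n=1..N. (b 0 n)\<^sup>2)"
proof -
  have "((\<lambda>t. \<Sum>n=1..N. (b t n)\<^sup>2) has_real_derivative 0) (at t)" for t
  proof -
    have "((\<lambda>t. \<Sum>n=1..N. (b t n)\<^sup>2) has_real_derivative (\<Sum>n=1..N. 2 * b t n * galerkin N (b t) n)) (at t)"
      by (auto intro!: derivative_eq_intros d simp: mult_ac)
    moreover have "(\<Sum>n=1..N. 2 * b t n * galerkin N (b t) n) = (\<Sum>n=1..N. b t n * skew (b t) n)"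
      by (intro sum.cong) (auto simp: galerkin_def)
    ultimately show ?thesis by (simp add: sum_mult_skew supp del: One_nat_def)
  qed
  then show ?thesis
    using DERIV_isconst_all[of "\<lambda>t. \<Sum>n=1..N. (b t n)\<^sup>2" t 0] by simp
qed

section \<open>The real evolution\<close>

text \<open>Truncations at size 2 K + 1 with estimates free of K: the norm is conserved, and the
  derivative of an entry involves only two neighbours, each bounded by \<open>sqrt S\<close>, so the
  Lipschitz constant depends on n alone.\<close>

lemma skew_flow_approx:
  assumes S: "l2_bound x S" and x0: "x 0 = 0"
  obtains b :: "nat \<Rightarrow> real \<Rightarrow> nat \<Rightarrow> real" where
    "\<And>K t. l2_bound (b K t) S"
    "\<And>K t. b K t 0 = 0"
    "\<And>K t. b K t (2 * K + 2) = 0"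
    "\<And>K s t n. \<bar>b K s n - b K t n\<bar> \<le> jacobi_weight n * sqrt S * \<bar>s - t\<bar> + jacobi_weight (n - 1) * sqrt S * \<bar>s - t\<bar>"
    "\<And>K t n. t \<ge> 0 \<Longrightarrow> 1 \<le> n \<Longrightarrow> n \<le> 2 * K + 1 \<Longrightarrow>
       b K t n = x n + skew (\<lambda>n. integral {0..t} (\<lambda>s. b K s n)) n / 2"
proof -
  have "\<exists>b. (\<forall>n. b 0 n = (if n \<le> 2 * K + 1 then x n else 0)) \<and>
      (\<forall>t n. ((\<lambda>s. b s n) has_real_derivative galerkin (2 * K + 1) (b t) n) (at t)) \<and>
      (\<forall>t n. n \<notin> {1..2 * K + 1} \<longrightarrow> b t n = 0)" for K
  proof -
    have "(if n \<le> 2 * K + 1 then x n else 0) = 0" if "n \<notin> {1..2 * K + 1}" for n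
      using that x0 by (cases "n = 0") auto
    from galerkin_flow[of "2 * K + 1" "\<lambda>n. if n \<le> 2 * K + 1 then x n else 0", OF this]
    show ?thesis by metis
  qed
  then obtain b where
    b0: "\<And>K n. b K 0 n = (if n \<le> 2 * K + 1 then x n else 0)" and
    bd: "\<And>K t n. ((\<lambda>s. b K s n) has_real_derivative galerkin (2 * K + 1) (b K t) n) (at t)" and
    bs: "\<And>K t n. n \<notin> {1..2 * K + 1} \<Longrightarrow> b K t n = 0"
    by metis
  have bl: "l2_bound (b K t) S" for K t
    unfolding l2_bound_def
  proof
    fix M
    have "(\<Sum>n<M. (b K t n)\<^sup>2) = (\<Sum>n\<in>{..<M} \<inter> {1..2 * K + 1}. (b K t n)\<^sup>2)"
      by (rule sum.mono_neutral_right) (auto simp: bs)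
    also have "\<dots> \<le> (\<Sum>n=1..2 * K + 1. (b K t n)\<^sup>2)"
      by (rule sum_mono2) auto
    also have "\<dots> = (\<Sum>n=1..2 * K + 1. (b K 0 n)\<^sup>2)"
      by (rule galerkin_flow_norm[OF bd bs])
    also have "\<dots> = (\<Sum>n=1..2 * K + 1. (x n)\<^sup>2)"
      by (rule sum.cong) (auto simp: b0)
    also have "\<dots> \<le> S"
      using l2_bound_sum[OF S, of "{1..2 * K + 1}" "\<lambda>n. n"] by simp
    finally show "(\<Sum>n<M. (b K t n)\<^sup>2) \<le> S" .
  qed
  have ba: "\<bar>b K t n\<bar> \<le> sqrt S" for K t n
    using l2_bound_sum[OF bl, of "{n}" "\<lambda>n. n" K t] by (simp add: real_le_rsqrt)
  have S0: "S \<ge> 0" using l2_bound_nonneg[OF S] .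
  have ga: "\<bar>galerkin N (b K t) n\<bar> \<le> jacobi_weight n * sqrt S + jacobi_weight (n - 1) * sqrt S" for N K t n
  proof (cases "n \<in> {1..N}")
    case True
    have "\<bar>skew (b K t) n\<bar> \<le> jacobi_weight n * \<bar>b K t (n + 1)\<bar> + jacobi_weight (n - 1) * \<bar>b K t (n - 1)\<bar>"
      unfolding skew_def by (rule order_trans[OF abs_triangle_ineq4]) (simp add: abs_mult)
    also have "\<dots> \<le> jacobi_weight n * sqrt S + jacobi_weight (n - 1) * sqrt S"
      by (intro add_mono mult_left_mono ba) auto
    finally show ?thesis using True by (simp add: galerkin_def)
  next
    case False
    then show ?thesis using S0 by (auto simp: galerkin_def)
  qed
  have lip: "\<bar>b K s n - b K t n\<bar> \<le> (jacobi_weight n * sqrt S + jacobi_weight (n - 1) * sqrt S) * \<bar>s - t\<bar>" for K s t n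
    using field_differentiable_bound[of UNIV "\<lambda>s. b K s n" "\<lambda>t. galerkin (2 * K + 1) (b K t) n"
        "jacobi_weight n * sqrt S + jacobi_weight (n - 1) * sqrt S" s t] bd ga by simp
  have bc: "continuous_on A (\<lambda>s. b K s n)" for A K n
    using DERIV_isCont[OF bd] by (auto intro: continuous_at_imp_continuous_on)
  have fund: "b K t n = x n + skew (\<lambda>n. integral {0..t} (\<lambda>s. b K s n)) n / 2"
    if t: "t \<ge> 0" and n: "1 \<le> n" "n \<le> 2 * K + 1" for K t n
  proof -
    have h1: "((\<lambda>s. galerkin (2 * K + 1) (b K s) n) has_integral (b K t n - b K 0 n)) {0..t}"
      using t bd by (intro fundamental_theorem_of_calculus)
        (auto simp: has_real_derivative_iff_has_vector_derivative[symmetric] intro: DERIV_subset)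
    have h2: "((\<lambda>s. (jacobi_weight n * b K s (n + 1) - jacobi_weight (n - 1) * b K s (n - 1)) / 2)
        has_integral (jacobi_weight n * integral {0..t} (\<lambda>s. b K s (n + 1))
          - jacobi_weight (n - 1) * integral {0..t} (\<lambda>s. b K s (n - 1))) / 2) {0..t}"
      by (intro has_integral_divide has_integral_diff has_integral_mult_right integrable_integral
          integrable_continuous_real bc)
    have h3: "galerkin (2 * K + 1) (b K s) n
        = (jacobi_weight n * b K s (n + 1) - jacobi_weight (n - 1) * b K s (n - 1)) / 2" for s
      using n by (simp add: galerkin_def skew_def)
    have "b K t n - b K 0 n = (jacobi_weight n * integral {0..t} (\<lambda>s. b K s (n + 1))
          - jacobi_weight (n - 1) * integral {0..t} (\<lambda>s. b K s (n - 1))) / 2"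
      by (rule has_integral_unique[OF h1[unfolded h3] h2])
    then show ?thesis using n by (simp add: b0 skew_def field_simps)
  qed
  show ?thesis
    by (rule that[of b]) (use bl bs lip fund in \<open>auto simp: distrib_right\<close>)
qed

text \<open>Arzela-Ascoli by diagonalization: extract a subsequence converging at rational times,
  then let the common Lipschitz constant carry the Cauchy property to all times. Pointwise
  convergence suffices, as time integrals pass to the limit by dominated convergence.\<close>

lemma equi_lipschitz_subsequence:
  fixes b :: "nat \<Rightarrow> real \<Rightarrow> nat \<Rightarrow> real"
  assumes bound: "\<And>K t n. \<bar>b K t n\<bar> \<le> B"
    and lip: "\<And>K s t n. \<bar>b K s n - b K t n\<bar> \<le> C n * \<bar>s - t\<bar>"
  obtains k a where "strict_mono (k :: nat \<Rightarrow> nat)" "\<And>t n. (\<lambda>j. b (k j) t n) \<longlonglongrightarrow> a t n"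
proof -
  have C0: "C n \<ge> 0" for n using lip[of 0 1 n 0] by simp
  have "countable (\<rat> \<times> (UNIV :: nat set) :: (real \<times> nat) set)"
    by (simp add: countable_rat)
  then obtain k where k: "strict_mono (k :: nat \<Rightarrow> nat)"
    and lim: "\<And>p. p \<in> \<rat> \<times> UNIV \<Longrightarrow> \<exists>l. (\<lambda>j. (\<lambda>K p. b K (fst p) (snd p)) (k j) p) \<longlonglongrightarrow> l"
    by (rule function_convergent_subsequence[of "\<rat> \<times> UNIV" "\<lambda>K p. b K (fst p) (snd p)" B])
       (auto simp: bound)
  have "\<exists>l. (\<lambda>j. b (k j) t n) \<longlonglongrightarrow> l" for t n
  proof -
    have "Cauchy (\<lambda>j. b (k j) t n)"
    proof (rule metric_CauchyI)
      fix e :: real assume e: "e > 0"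
      \<comment> \<open>Adding 1 to \<open>C n\<close> keeps the denominator positive when
        \<open>C n\<close> is 0.\<close>
      define d where "d = e / (3 * (C n + 1))"
      have d: "d > 0" using e C0[of n] by (simp add: d_def)
      obtain q where q: "q \<in> \<rat>" "t < q" "q < t + d"
        using Rats_dense_in_real[of t "t + d"] d by auto
      have Cd: "C n * \<bar>t - q\<bar> < e / 3"
      proof -
        have "C n * \<bar>t - q\<bar> \<le> C n * d" using q C0[of n] by (intro mult_left_mono) auto
        also have "\<dots> < (C n + 1) * d" using d by (simp add: distrib_right)
        also have "\<dots> = e / 3" using C0[of n] by (simp add: d_def field_simps add_nonneg_eq_0_iff)
        finally show ?thesis .
      qed
      obtain l where l: "(\<lambda>j. b (k j) q n) \<longlonglongrightarrow> l" using lim[of "(q, n)"] q(1) by auto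
      then obtain M where M: "\<And>i j. i \<ge> M \<Longrightarrow> j \<ge> M \<Longrightarrow> dist (b (k i) q n) (b (k j) q n) < e / 3"
        using metric_CauchyD[OF LIMSEQ_imp_Cauchy[OF l], of "e / 3"] e by auto
      show "\<exists>M. \<forall>i\<ge>M. \<forall>j\<ge>M. dist (b (k i) t n) (b (k j) t n) < e"
      proof (intro exI allI impI)
        fix i j assume "i \<ge> M" "j \<ge> M"
        then have "\<bar>b (k i) q n - b (k j) q n\<bar> < e / 3" using M by (simp add: dist_real_def)
        moreover have "\<bar>b (k i) t n - b (k i) q n\<bar> < e / 3" "\<bar>b (k j) t n - b (k j) q n\<bar> < e / 3"
          using lip[of "k i" t n q] lip[of "k j" t n q] Cd by linarith+
        ultimately show "dist (b (k i) t n) (b (k j) t n) < e" unfolding dist_real_def by linarith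
      qed
    qed
    then show ?thesis using Cauchy_convergent convergent_def by blast
  qed
  then obtain a where "\<And>t n. (\<lambda>j. b (k j) t n) \<longlonglongrightarrow> a t n" by metis
  with k show ?thesis using that by blast
qed

text \<open>The real counterpart of a mild solution, on a finite horizon so that time can be
  reversed. As for mild solutions, the equation and the boundary condition concern the primitive.
  Norm bounds are stated separately as \<open>l2_bound\<close>, because their constants are compared
  later.\<close>

definition skew_evolution :: "real \<Rightarrow> (nat \<Rightarrow> real) \<Rightarrow> (real \<Rightarrow> nat \<Rightarrow> real) \<Rightarrow> bool" where
  "skew_evolution T x a \<longleftrightarrow>
     (\<forall>n. continuous_on {0..T} (\<lambda>s. a s n)) \<and>
     (\<forall>t\<in>{0..T}. \<forall>n\<ge>1. a t n = x n + skew (\<lambda>n. integral {0..t} (\<lambda>s. a s n)) n / 2) \<and>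
     (\<forall>t\<in>{0..T}. (\<lambda>k. null_flux k * integral {0..t} (\<lambda>s. a s (2 * k))) \<longlonglongrightarrow> 0)"

lemma skew_evolution_exists:
  assumes S: "l2_bound x S" and x0: "x 0 = 0"
  obtains a where "\<And>T. skew_evolution T x a" "\<And>t. l2_bound (a t) S" "\<And>t. a t 0 = 0"
proof -
  obtain b where bl: "\<And>K t. l2_bound (b K t) S" and b0: "\<And>K t. b K t 0 = 0"
    and bN: "\<And>K t. b K t (2 * K + 2) = 0"
    and lip: "\<And>K s t n. \<bar>b K s n - b K t n\<bar> \<le> jacobi_weight n * sqrt S * \<bar>s - t\<bar> + jacobi_weight (n - 1) * sqrt S * \<bar>s - t\<bar>"
    and fund: "\<And>K t n. t \<ge> 0 \<Longrightarrow> 1 \<le> n \<Longrightarrow> n \<le> 2 * K + 1 \<Longrightarrow>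
       b K t n = x n + skew (\<lambda>n. integral {0..t} (\<lambda>s. b K s n)) n / 2"
    using skew_flow_approx[OF S x0] by blast
  define C where "C n = jacobi_weight n * sqrt S + jacobi_weight (n - 1) * sqrt S" for n
  have lipC: "\<bar>b K s n - b K t n\<bar> \<le> C n * \<bar>s - t\<bar>" for K s t n
    using lip[of K s n t] by (simp add: C_def distrib_right)
  have ba: "\<bar>b K t n\<bar> \<le> sqrt S" for K t n
    using l2_bound_sum[OF bl, of "{n}" "\<lambda>n. n" K t] by (simp add: real_le_rsqrt)
  obtain k a where k: "strict_mono (k :: nat \<Rightarrow> nat)" and lim: "\<And>t n. (\<lambda>j. b (k j) t n) \<longlonglongrightarrow> a t n"
    using equi_lipschitz_subsequence[of b "sqrt S" C, OF ba lipC] by blast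
  have alip: "\<bar>a s n - a t n\<bar> \<le> C n * \<bar>s - t\<bar>" for s t n
    by (rule LIMSEQ_le_const2[OF tendsto_rabs[OF tendsto_diff[OF lim lim]]]) (use lipC in auto)
  have lipcont: "continuous_on A f" if "\<And>s t. \<bar>f s - f t\<bar> \<le> c * \<bar>s - t\<bar>" for f :: "real \<Rightarrow> real" and A c
  proof -
    have "c \<ge> 0" using that[of 0 1] by simp
    then have "c-lipschitz_on A f" by (intro lipschitz_onI) (auto simp: dist_real_def that)
    then show ?thesis by (rule lipschitz_on_continuous_on)
  qed
  have acont: "continuous_on A (\<lambda>s. a s n)" for A n
    by (rule lipcont[OF alip])
  have bcont: "continuous_on A (\<lambda>s. b K s n)" for A K n
    by (rule lipcont[OF lipC])
  have Flim: "(\<lambda>j. integral {0..t} (\<lambda>s. b (k j) s n)) \<longlonglongrightarrow> integral {0..t} (\<lambda>s. a s n)" for t n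
    by (rule dominated_convergence(2)[where h = "\<lambda>_. sqrt S"])
       (auto intro!: integrable_continuous_real bcont lim ba)
  show ?thesis
  proof (rule that)
    show "l2_bound (a t) S" for t
      unfolding l2_bound_def
    proof
      fix N
      show "(\<Sum>n<N. (a t n)\<^sup>2) \<le> S"
        by (rule LIMSEQ_le_const2[of "\<lambda>j. \<Sum>n<N. (b (k j) t n)\<^sup>2"])
           (use bl in \<open>auto simp: l2_bound_def intro!: tendsto_sum tendsto_power lim\<close>)
    qed
    show "a t 0 = 0" for t
      using LIMSEQ_unique[OF lim[of t 0]] by (simp add: b0)
    show "skew_evolution T x a" for T
      unfolding skew_evolution_def
    proof (intro conjI allI ballI impI)
      show "continuous_on {0..T} (\<lambda>s. a s n)" for n by (rule acont)
      fix t assume "t \<in> {0..T}"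
      then have t: "t \<ge> 0" by simp
      show "a t n = x n + skew (\<lambda>n. integral {0..t} (\<lambda>s. a s n)) n / 2" if n: "n \<ge> 1" for n
      proof (rule LIMSEQ_unique[OF lim])
        have "(\<lambda>j. x n + skew (\<lambda>n. integral {0..t} (\<lambda>s. b (k j) s n)) n / 2)
            \<longlonglongrightarrow> x n + skew (\<lambda>n. integral {0..t} (\<lambda>s. a s n)) n / 2"
          unfolding skew_def by (intro tendsto_intros Flim) simp
        moreover have "\<forall>\<^sub>F j in sequentially. x n + skew (\<lambda>n. integral {0..t} (\<lambda>s. b (k j) s n)) n / 2 = b (k j) t n"
        proof (rule eventually_sequentiallyI)
          fix j assume "n \<le> j"
          then have "n \<le> 2 * k j + 1" using seq_suble[OF k, of j] by simp
          then show "x n + skew (\<lambda>n. integral {0..t} (\<lambda>s. b (k j) s n)) n / 2 = b (k j) t n"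
            using fund[OF t n] by simp
        qed
        ultimately show "(\<lambda>j. b (k j) t n) \<longlonglongrightarrow> x n + skew (\<lambda>n. integral {0..t} (\<lambda>s. a s n)) n / 2"
          by (rule Lim_transform_eventually)
      qed
      \<comment> \<open>By the truncated equation, \<open>skew\<close> of the primitive is 2 (b -
        x), with squared norm at most 4 (2 S + 2 S) = 16 S. The truncation of size
        \<open>2 * k j + 1\<close> is 0 at \<open>2 * (k j + 1)\<close>, where the telescoping
        starts.\<close>
      have bnd: "\<bar>null_flux i * integral {0..t} (\<lambda>s. a s (2 * i))\<bar> \<le> sqrt (null_odd_tail i * (16 * S))" for i
      proof (rule LIMSEQ_le_const2[OF tendsto_rabs[OF tendsto_mult[OF tendsto_const Flim]]], intro exI allI impI)
        fix j assume "i \<le> j"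
        then have ij: "i \<le> k j + 1" using seq_suble[OF k, of j] by simp
        show "\<bar>null_flux i * integral {0..t} (\<lambda>s. b (k j) s (2 * i))\<bar> \<le> sqrt (null_odd_tail i * (16 * S))"
        proof (rule even_component_bound_finite[where K = "k j + 1" and x = "\<lambda>n. 2 * (b (k j) t n - x n)"
              and a = "\<lambda>n. integral {0..t} (\<lambda>s. b (k j) s n)"])
          show "l2_bound (\<lambda>n. 2 * (b (k j) t n - x n)) (16 * S)"
            using l2_bound_cmult[OF l2_bound_diff[OF bl S], of 2] by simp
          show "skew (\<lambda>n. integral {0..t} (\<lambda>s. b (k j) s n)) (2 * i + 1) = 2 * (b (k j) t (2 * i + 1) - x (2 * i + 1))"
            if "i < k j + 1" for i
            using fund[OF t, of "2 * i + 1" "k j"] that by simp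
          show "integral {0..t} (\<lambda>s. b (k j) s (2 * (k j + 1))) = 0"
            using bN[of "k j"] by simp
        qed (rule ij)
      qed
      have "(\<lambda>i. sqrt (null_odd_tail i * (16 * S))) \<longlonglongrightarrow> sqrt (0 * (16 * S))"
        by (intro tendsto_intros null_odd_tail_tendsto)
      then have "(\<lambda>i. sqrt (null_odd_tail i * (16 * S))) \<longlonglongrightarrow> 0" by simp
      then show "(\<lambda>i. null_flux i * integral {0..t} (\<lambda>s. a s (2 * i))) \<longlonglongrightarrow> 0"
        by (rule Lim_null_comparison[rotated]) (use bnd in auto)
    qed
  qed
qed

section \<open>Uniqueness, time reversal and conservation of the norm\<close>

lemma skew_evolution_integrable:
  assumes "skew_evolution T x a" "t \<in> {0..T}"
  shows "(\<lambda>s. a s n) integrable_on {0..t}"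
proof (rule integrable_continuous_real)
  have "continuous_on {0..T} (\<lambda>s. a s n)" using assms(1) unfolding skew_evolution_def by simp
  then show "continuous_on {0..t} (\<lambda>s. a s n)"
    by (rule continuous_on_subset) (use assms(2) in auto)
qed

lemma skew_evolution_unique:
  assumes a: "skew_evolution T x a" and b: "skew_evolution T x b"
    and bd: "\<And>t. t \<in> {0..T} \<Longrightarrow> l2_bound (a t) M" "\<And>t. t \<in> {0..T} \<Longrightarrow> l2_bound (b t) R"
    and t: "t \<in> {0..T}" and n: "n \<ge> 1"
  shows "a t n = b t n"
proof -
  note ci = skew_evolution_integrable[OF a] skew_evolution_integrable[OF b]
  have "a t n - b t n = 0"
  proof (rule skew_evolution_zero[of T "\<lambda>t n. a t n - b t n" "2 * M + 2 * R"])
    show "continuous_on {0..T} (\<lambda>s. a s n - b s n)" for n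
      using a b unfolding skew_evolution_def by (auto intro: continuous_on_diff)
    fix t assume t: "t \<in> {0..T}"
    show "l2_bound (\<lambda>n. a t n - b t n) (2 * M + 2 * R)"
      by (intro l2_bound_diff bd t)
    show "a t n - b t n = skew (\<lambda>n. integral {0..t} (\<lambda>s. a s n - b s n)) n / 2" if "n \<ge> 1" for n
    proof -
      have "a t n = x n + skew (\<lambda>n. integral {0..t} (\<lambda>s. a s n)) n / 2"
        "b t n = x n + skew (\<lambda>n. integral {0..t} (\<lambda>s. b s n)) n / 2"
        using a b t that unfolding skew_evolution_def by auto
      then show ?thesis
        by (simp add: Henstock_Kurzweil_Integration.integral_diff ci[OF t] skew_diff diff_divide_distrib)
    qed
    have "(\<lambda>k. null_flux k * integral {0..t} (\<lambda>s. a s (2 * k)) - null_flux k * integral {0..t} (\<lambda>s. b s (2 * k))) \<longlonglongrightarrow> 0 - 0"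
      using a b t unfolding skew_evolution_def by (intro tendsto_diff) auto
    then show "(\<lambda>k. null_flux k * integral {0..t} (\<lambda>s. a s (2 * k) - b s (2 * k))) \<longlonglongrightarrow> 0"
      by (simp add: Henstock_Kurzweil_Integration.integral_diff ci[OF t] right_diff_distrib)
  qed (use t n in auto)
  then show ?thesis by simp
qed

text \<open>\<open>skew\<close> couples only indices of opposite parity, so conjugation by (-1)^n
  changes its sign and compensates the sign from reversing time. Even entries keep their sign, hence
  the boundary condition is preserved.\<close>

lemma skew_evolution_reverse:
  assumes a: "skew_evolution T x a"
  shows "skew_evolution T (\<lambda>n. (- 1) ^ n * a T n) (\<lambda>s n. (- 1) ^ n * a (T - s) n)"
  unfolding skew_evolution_def
proof (intro conjI allI ballI impI)
  define F where "F t n = integral {0..t} (\<lambda>s. a s n)" for t n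
  have cont: "continuous_on {0..T} (\<lambda>s. a s n)" for n
    using a unfolding skew_evolution_def by auto
  show "continuous_on {0..T} (\<lambda>s. (- 1) ^ n * a (T - s) n)" for n
    by (intro continuous_intros continuous_on_compose2[OF cont]) auto
  fix t assume t: "t \<in> {0..T}"
  \<comment> \<open>The primitive of the reversed flow is a difference of two primitives of
    \<open>a\<close>, so it inherits the boundary condition by linearity.\<close>
  have rev: "integral {0..t} (\<lambda>s. (- 1) ^ n * a (T - s) n) = (- 1) ^ n * (F T n - F (T - t) n)" for n
  proof -
    have "integral {0..t} (\<lambda>s. a (T - s) n) = integral {-t..0} (\<lambda>s. a (s + T) n)"
      using Henstock_Kurzweil_Integration.integral_reflect_real[of 0 "-t" "\<lambda>s. a (s + T) n"] by simp
    also have "\<dots> = integral {-t + T..0 + T} (\<lambda>s. a s n)"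
      using Henstock_Kurzweil_Integration.integral_shift[of "-t" T 0 "\<lambda>s. a s n"] t
      by (simp add: o_def continuous_on_subset[OF cont])
    also have "\<dots> = F T n - F (T - t) n"
      unfolding F_def
      using Henstock_Kurzweil_Integration.integral_combine[of 0 "T - t" T "\<lambda>s. a s n"]
        skew_evolution_integrable[OF a, of T n] t by simp
    finally show ?thesis by simp
  qed
  show "(- 1) ^ n * a (T - t) n = (- 1) ^ n * a T n
      + skew (\<lambda>n. integral {0..t} (\<lambda>s. (- 1) ^ n * a (T - s) n)) n / 2" if n: "n \<ge> 1" for n
  proof -
    have "(- 1) ^ (n + 1) = - ((- 1) ^ n :: real)" by simp
    moreover have "(- 1) ^ (n - 1) = - ((- 1) ^ n :: real)" using n by (cases n) auto
    ultimately have "skew (\<lambda>n. (- 1) ^ n * (F T n - F (T - t) n)) n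
        = - ((- 1) ^ n) * (skew (F T) n - skew (F (T - t)) n)"
      unfolding skew_def by (simp add: algebra_simps)
    moreover have "a T n = x n + skew (F T) n / 2" "a (T - t) n = x n + skew (F (T - t)) n / 2"
      using a t n unfolding skew_evolution_def F_def by auto
    then have "skew (F T) n - skew (F (T - t)) n = 2 * (a T n - a (T - t) n)" by simp
    ultimately have "skew (\<lambda>n. (- 1) ^ n * (F T n - F (T - t) n)) n / 2
        = - ((- 1) ^ n) * (a T n - a (T - t) n)" by simp
    then show ?thesis unfolding rev by (simp only:) (simp add: right_diff_distrib)
  qed
  have "(\<lambda>k. null_flux k * F T (2 * k) - null_flux k * F (T - t) (2 * k)) \<longlonglongrightarrow> 0 - 0"
    using a t unfolding skew_evolution_def F_def by (intro tendsto_diff) auto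
  then show "(\<lambda>k. null_flux k * integral {0..t} (\<lambda>s. (- 1) ^ (2 * k) * a (T - s) (2 * k))) \<longlonglongrightarrow> 0"
    unfolding rev by (simp add: right_diff_distrib)
qed

lemma skew_evolution_initial:
  assumes "skew_evolution T x a" "T \<ge> 0" "n \<ge> 1"
  shows "a 0 n = x n"
  using assms by (auto simp: skew_evolution_def skew_def)

text \<open>The evolution built from the sign-changed final state keeps the bound \<open>R\<close>.
  By uniqueness it is the reversed flow, which at time \<open>T\<close> has returned to
  \<open>x\<close> up to signs. The bound \<open>M\<close> feeds the uniqueness argument.\<close>

lemma skew_evolution_backward_bound:
  assumes a: "skew_evolution T x a" and T: "T \<ge> 0"
    and bd: "\<And>t. t \<in> {0..T} \<Longrightarrow> l2_bound (a t) M" and R: "l2_bound (a T) R"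
    and x0: "x 0 = 0" "a T 0 = 0"
  shows "l2_bound x R"
proof -
  have y0: "(- 1) ^ 0 * a T 0 = 0" by (simp add: x0)
  have y: "l2_bound (\<lambda>n. (- 1) ^ n * a T n) R"
    by (rule l2_bound_abs_le[OF R]) (simp add: abs_mult)
  obtain c where c: "\<And>T'. skew_evolution T' (\<lambda>n. (- 1) ^ n * a T n) c"
    and cb: "\<And>t. l2_bound (c t) R"
    by (rule skew_evolution_exists[OF y y0]) (rule that)
  show ?thesis
  proof (rule l2_bound_abs_le[OF cb])
    show "\<bar>x n\<bar> \<le> \<bar>c T n\<bar>" for n
    proof (cases "n = 0")
      case False
      then have n: "n \<ge> 1" by simp
      have "l2_bound (\<lambda>n. (- 1) ^ n * a (T - s) n) M" if "s \<in> {0..T}" for s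
        by (rule l2_bound_abs_le[OF bd[of "T - s"]]) (use that in \<open>auto simp: abs_mult\<close>)
      from skew_evolution_unique[OF skew_evolution_reverse[OF a] c this cb, of T n]
      have "(- 1) ^ n * a 0 n = c T n" using T n by simp
      then show ?thesis
        using skew_evolution_initial[OF a T n] by (auto simp: abs_mult dest: sym)
    qed (simp add: x0)
  qed
qed

text \<open>The norm is conserved because the time-reversed evolution is again one.\<close>

lemma skew_evolution_conservative:
  assumes sx: "summable (\<lambda>n. (x n)\<^sup>2)" and x0: "x 0 = 0"
  obtains a where "\<And>T. skew_evolution T x a" "\<And>t. a t 0 = 0" "\<And>n. a 0 n = x n"
    "\<And>t. t \<ge> 0 \<Longrightarrow> (\<lambda>n. (a t n)\<^sup>2) sums (\<Sum>n. (x n)\<^sup>2)"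
proof -
  have S: "l2_bound x (\<Sum>n. (x n)\<^sup>2)" using sx by (simp add: l2_bound_iff_suminf)
  obtain a where a: "\<And>T. skew_evolution T x a" and ab: "\<And>t. l2_bound (a t) (\<Sum>n. (x n)\<^sup>2)"
    and a0: "\<And>t. a t 0 = 0"
    using skew_evolution_exists[OF S x0] by blast
  show ?thesis
  proof (rule that[OF a a0])
    show "a 0 n = x n" for n
      using skew_evolution_initial[OF a[of 0], of n] a0 x0 by (cases "n = 0") auto
    fix t :: real assume t: "t \<ge> 0"
    have sa: "summable (\<lambda>n. (a t n)\<^sup>2)" and le: "(\<Sum>n. (a t n)\<^sup>2) \<le> (\<Sum>n. (x n)\<^sup>2)"
      using ab[of t] by (auto simp: l2_bound_iff_suminf)
    have "l2_bound (a t) (\<Sum>n. (a t n)\<^sup>2)" using sa by (simp add: l2_bound_iff_suminf)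
    then have "l2_bound x (\<Sum>n. (a t n)\<^sup>2)"
      by (intro skew_evolution_backward_bound[OF a t ab]) (auto simp: x0 a0)
    then have "(\<Sum>n. (x n)\<^sup>2) \<le> (\<Sum>n. (a t n)\<^sup>2)" by (simp add: l2_bound_iff_suminf)
    with le have "(\<Sum>n. (a t n)\<^sup>2) = (\<Sum>n. (x n)\<^sup>2)" by simp
    then show "(\<lambda>n. (a t n)\<^sup>2) sums (\<Sum>n. (x n)\<^sup>2)" using summable_sums[OF sa] by simp
  qed
qed

text \<open>Entrywise continuity with a constant norm gives norm continuity: the tail at time s
  equals \<open>S\<close> minus a finite sum, so it is small near t whenever it is small at
  t.\<close>

lemma norm_continuous_if_conservative:
  fixes a :: "real \<Rightarrow> nat \<Rightarrow> real"
  assumes cont: "\<And>n. continuous_on {0..} (\<lambda>s. a s n)"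
    and S: "\<And>t. t \<ge> 0 \<Longrightarrow> (\<lambda>n. (a t n)\<^sup>2) sums S" and t: "t \<ge> 0"
  shows "((\<lambda>s. \<Sum>n. (a s n - a t n)\<^sup>2) \<longlongrightarrow> 0) (at t within {0..})"
proof (rule tendstoI)
  fix e :: real assume e: "e > 0"
  have "(\<lambda>N. \<Sum>n<N. (a t n)\<^sup>2) \<longlonglongrightarrow> S" using S[OF t] by (simp add: sums_def)
  then have "\<forall>\<^sub>F N in sequentially. S - e / 4 < (\<Sum>n<N. (a t n)\<^sup>2)"
    by (rule order_tendstoD(1)) (use e in simp)
  then obtain N where N: "S - e / 4 < (\<Sum>n<N. (a t n)\<^sup>2)"
    using eventually_happens' sequentially_bot by blast
  \<comment> \<open>A majorant of the squared distance: the first N entries exactly, the rest by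
    twice the two tails. It is continuous in s, and at s = t it equals four times the tail at t,
    which explains e / 4 above.\<close>
  define B where "B s = (\<Sum>n<N. (a s n - a t n)\<^sup>2) + (2 * (S - (\<Sum>n<N. (a s n)\<^sup>2)) + 2 * (S - (\<Sum>n<N. (a t n)\<^sup>2)))" for s
  have c: "((\<lambda>s. a s n) \<longlongrightarrow> a t n) (at t within {0..})" for n
    using cont[of n] t by (auto simp: continuous_on_def)
  have "(B \<longlongrightarrow> B t) (at t within {0..})"
    unfolding B_def by (intro tendsto_intros c)
  moreover have "B t < e" using N by (simp add: B_def)
  ultimately have "\<forall>\<^sub>F s in at t within {0..}. B s < e" by (rule order_tendstoD(2))
  moreover have "\<forall>\<^sub>F s in at t within {0..}. s \<in> {0..}" by (simp add: eventually_at_filter)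
  ultimately show "\<forall>\<^sub>F s in at t within {0..}. dist (\<Sum>n. (a s n - a t n)\<^sup>2) 0 < e"
  proof eventually_elim
    case (elim s)
    then have s: "s \<ge> 0" by simp
    have "l2_bound (a s) S" "l2_bound (a t) S"
      using S[OF s] S[OF t] by (auto simp: l2_bound_iff_suminf sums_iff)
    from l2_bound_diff[OF this] have sd: "summable (\<lambda>n. (a s n - a t n)\<^sup>2)"
      by (simp add: l2_bound_iff_suminf)
    have "(\<Sum>n. (a s n - a t n)\<^sup>2) \<le> B s"
    proof (rule suminf_le_const[OF sd])
      fix M
      have "(\<Sum>n<M. (a s n - a t n)\<^sup>2) \<le> (\<Sum>n<max N M. (a s n - a t n)\<^sup>2)"
        by (intro sum_mono2) auto
      also have "\<dots> = (\<Sum>n<N. (a s n - a t n)\<^sup>2) + (\<Sum>n=N..<max N M. (a s n - a t n)\<^sup>2)"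
        by (simp add: sum.atLeastLessThan_concat[of 0 N "max N M", symmetric] atLeast0LessThan[symmetric])
      also have "(\<Sum>n=N..<max N M. (a s n - a t n)\<^sup>2)
          \<le> (\<Sum>n=N..<max N M. 2 * (a s n)\<^sup>2 + 2 * (a t n)\<^sup>2)"
      proof (rule sum_mono)
        show "(a s n - a t n)\<^sup>2 \<le> 2 * (a s n)\<^sup>2 + 2 * (a t n)\<^sup>2" for n
          using sum_squares_bound[of "a s n" "- a t n"] by (simp add: power2_diff)
      qed
      also have "\<dots> = 2 * (\<Sum>n=N..<max N M. (a s n)\<^sup>2) + 2 * (\<Sum>n=N..<max N M. (a t n)\<^sup>2)"
        by (simp add: sum.distrib sum_distrib_left)
      also have "\<dots> \<le> 2 * (S - (\<Sum>n<N. (a s n)\<^sup>2)) + 2 * (S - (\<Sum>n<N. (a t n)\<^sup>2))"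
      proof -
        have "(\<Sum>n=N..<max N M. (a r n)\<^sup>2) \<le> S - (\<Sum>n<N. (a r n)\<^sup>2)" if "r \<ge> 0" for r
        proof -
          have "(\<Sum>n<max N M. (a r n)\<^sup>2) \<le> S"
            using S[OF that] by (auto simp: sums_iff intro: sum_le_suminf)
          moreover have "(\<Sum>n<max N M. (a r n)\<^sup>2) = (\<Sum>n<N. (a r n)\<^sup>2) + (\<Sum>n=N..<max N M. (a r n)\<^sup>2)"
            by (simp add: sum.atLeastLessThan_concat[of 0 N "max N M", symmetric] atLeast0LessThan[symmetric])
          ultimately show ?thesis by simp
        qed
        from this[OF s] this[OF t] show ?thesis by simp
      qed
      finally show "(\<Sum>n<M. (a s n - a t n)\<^sup>2) \<le> B s" by (simp add: B_def)
    qed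
    moreover have "(\<Sum>n. (a s n - a t n)\<^sup>2) \<ge> 0" by (intro suminf_nonneg sd) auto
    ultimately show ?case using elim by (simp add: dist_real_def)
  qed
qed

section \<open>Passage to complex coordinates\<close>

definition rotate_coords :: "(nat \<Rightarrow> real) \<Rightarrow> nat \<Rightarrow> complex" where
  "rotate_coords a n = of_real (a n) / \<i> ^ n"

lemma cmod_rotate_coords [simp]: "cmod (rotate_coords a n) = \<bar>a n\<bar>"
  by (simp add: rotate_coords_def norm_divide norm_power)

lemma ell2_rotate_coords:
  assumes "a 0 = 0"
  shows "ell2 (rotate_coords a) \<longleftrightarrow> summable (\<lambda>n. (a n)\<^sup>2)"
    and "summable (\<lambda>n. (a n)\<^sup>2) \<Longrightarrow> ell2_norm (rotate_coords a) = sqrt (\<Sum>n. (a n)\<^sup>2)"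
proof -
  have "(\<lambda>n. (cmod (rotate_coords a n))\<^sup>2) summable_on {1..} \<longleftrightarrow> (\<lambda>n. (a n)\<^sup>2) summable_on UNIV"
    using assms by (intro summable_on_cong_neutral) (auto simp: not_le)
  then show "ell2 (rotate_coords a) \<longleftrightarrow> summable (\<lambda>n. (a n)\<^sup>2)"
    by (simp add: ell2_def summable_on_UNIV_nonneg_real_iff)
  assume s: "summable (\<lambda>n. (a n)\<^sup>2)"
  have "(\<Sum>\<^sub>\<infinity>n\<in>{1..}. (cmod (rotate_coords a n))\<^sup>2) = (\<Sum>\<^sub>\<infinity>n\<in>UNIV. (a n)\<^sup>2)"
    using assms by (intro infsum_cong_neutral) (auto simp: not_le)
  also have "\<dots> = (\<Sum>n. (a n)\<^sup>2)"
    using sums_nonneg_imp_has_sum[OF summable_sums[OF s]] by (simp add: infsumI)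
  finally show "ell2_norm (rotate_coords a) = sqrt (\<Sum>n. (a n)\<^sup>2)"
    by (simp add: ell2_norm_def)
qed

lemma rotate_coords_diff: "rotate_coords a n - rotate_coords b n = rotate_coords (\<lambda>n. a n - b n) n"
  by (simp add: rotate_coords_def diff_divide_distrib)

text \<open>The neighbours of n carry the extra phases 1 / \<i> = - \<i> and \<i>, whose opposite
  signs turn the symmetric expression into the skew one. Hence \<i> / 2 times \<open>jacobi\<close>
  becomes \<open>skew / 2\<close>.\<close>

lemma jacobi_rotate_coords: "jacobi (rotate_coords a) n = - \<i> * rotate_coords (skew a) n"
proof (cases n)
  case (Suc m)
  have "of_real z / \<i> ^ m = \<i> * (of_real z / \<i> ^ n)" for z
    by (simp add: Suc)
  then show ?thesis
    by (simp add: Suc jacobi_def rotate_coords_def skew_def field_simps)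
qed (simp add: jacobi_def rotate_coords_def)

text \<open>The prefactor \<i> cancels the phase at index 1 and so realizes the normalization
  \<open>v 1 = 1\<close>.\<close>

lemma jacobi_null_unique:
  fixes v :: "nat \<Rightarrow> complex"
  assumes "v 1 = 1" "\<forall>n\<ge>1. jacobi v n = 0" "n \<ge> 1"
  shows "v n = \<i> * rotate_coords jacobi_null n"
  using assms(3)
proof (induction n rule: jacobi_null.induct)
  case (3 n)
  have w: "jacobi_weight (Suc n) > 0" by (rule jacobi_weight_pos) simp
  have "jacobi v (Suc n) = 0" using assms(2) by simp
  then have "of_real (jacobi_weight (Suc n)) * v (Suc (Suc n)) = - (of_real (jacobi_weight n) * v n)"
    by (simp add: jacobi_def eq_neg_iff_add_eq_0)
  moreover have "of_real (jacobi_weight n) * v n = of_real (jacobi_weight n) * (\<i> * rotate_coords jacobi_null n)"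
    using 3 by (cases "n = 0") auto
  moreover have "of_real (jacobi_weight (Suc n)) * (\<i> * rotate_coords jacobi_null (Suc (Suc n)))
      = - (of_real (jacobi_weight n) * (\<i> * rotate_coords jacobi_null n))"
    using w by (simp add: rotate_coords_def field_simps)
  ultimately have "of_real (jacobi_weight (Suc n)) * v (Suc (Suc n))
      = of_real (jacobi_weight (Suc n)) * (\<i> * rotate_coords jacobi_null (Suc (Suc n)))" by simp
  then show ?case using w by (simp only: mult_cancel_left) simp
qed (use assms(1) in \<open>auto simp: rotate_coords_def\<close>)

lemma jacobi_null_rotate:
  "\<i> * rotate_coords jacobi_null 1 = 1" "n \<ge> 1 \<Longrightarrow> jacobi (\<lambda>n. \<i> * rotate_coords jacobi_null n) n = 0"
proof -
  show "\<i> * rotate_coords jacobi_null 1 = 1" by (simp add: rotate_coords_def)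
  assume "n \<ge> 1"
  then have "skew jacobi_null n = 0" using jacobi_null_step[of n] by (simp add: skew_def)
  moreover have "jacobi (\<lambda>n. \<i> * rotate_coords jacobi_null n) n = \<i> * jacobi (rotate_coords jacobi_null) n"
    by (simp add: jacobi_def algebra_simps)
  ultimately show "jacobi (\<lambda>n. \<i> * rotate_coords jacobi_null n) n = 0"
    by (simp add: jacobi_rotate_coords) (simp add: rotate_coords_def)
qed

text \<open>Both products carry the same phase, so in modulus the complex Wronskian is the real
  one.\<close>

lemma wronskian_rotate:
  "cmod (of_real (jacobi_weight n) * (\<i> * rotate_coords jacobi_null n * rotate_coords a (n + 1)
      - \<i> * rotate_coords jacobi_null (n + 1) * rotate_coords a n))
    = jacobi_weight n * \<bar>jacobi_null n * a (n + 1) - jacobi_null (n + 1) * a n\<bar>"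
proof -
  have "\<i> * rotate_coords jacobi_null n * rotate_coords a (n + 1)
      - \<i> * rotate_coords jacobi_null (n + 1) * rotate_coords a n
      = of_real (jacobi_null n * a (n + 1) - jacobi_null (n + 1) * a n) / (\<i> ^ n * \<i> ^ n)"
    by (simp add: rotate_coords_def field_simps)
  then show ?thesis
    by (simp only: norm_mult norm_divide norm_power norm_of_real) simp
qed

text \<open>Uniqueness on positive indices collapses the existential over v to the explicit null
  solution. In modulus, the Wronskian sequence then interleaves two copies, shifted by one, of the
  sequence on the right.\<close>

lemma boundary_condition_iff:
  "(\<exists>v. v 1 = 1 \<and> (\<forall>n\<ge>1. jacobi v n = 0) \<and>
       (\<lambda>n. of_real (jacobi_weight n) * (v n * rotate_coords a (n + 1) - v (n + 1) * rotate_coords a n)) \<longlonglongrightarrow> 0)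
    \<longleftrightarrow> (\<lambda>k. null_flux k * a (2 * k)) \<longlonglongrightarrow> 0" (is "?L \<longleftrightarrow> ?R")
proof -
  define W where "W n = jacobi_weight n * \<bar>jacobi_null n * a (n + 1) - jacobi_null (n + 1) * a n\<bar>" for n
  have We: "W (2 * k) = \<bar>null_flux k * a (2 * k)\<bar>" for k
    by (simp add: W_def jacobi_null_even null_flux_def null_odd_def abs_mult)
  have Wo: "W (2 * k + 1) = \<bar>null_flux (Suc k) * a (2 * Suc k)\<bar>" for k
  proof -
    have "jacobi_null (2 * k + 1 + 1) = 0" using jacobi_null_even[of "Suc k"] by simp
    then show ?thesis
      unfolding W_def null_flux_Suc by (simp add: null_odd_def abs_mult del: jacobi_null.simps)
  qed
  have W: "W \<longlonglongrightarrow> 0 \<longleftrightarrow> ?R"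
  proof
    assume "W \<longlonglongrightarrow> 0"
    then have "(W \<circ> (\<lambda>k. 2 * k)) \<longlonglongrightarrow> 0"
      by (rule LIMSEQ_subseq_LIMSEQ) (simp add: strict_mono_def)
    then show ?R by (simp add: o_def We tendsto_rabs_zero_iff)
  next
    assume R: ?R
    show "W \<longlonglongrightarrow> 0"
    proof (rule limseq_even_odd)
      show "(\<lambda>n. W (2 * n)) \<longlonglongrightarrow> 0" using R by (simp only: We tendsto_rabs_zero_iff)
      show "(\<lambda>n. W (2 * n + 1)) \<longlonglongrightarrow> 0"
        using LIMSEQ_Suc[OF R] by (simp only: Wo tendsto_rabs_zero_iff)
    qed
  qed
  show ?thesis
  proof
    assume ?L
    then obtain v where v: "v 1 = 1" "\<forall>n\<ge>1. jacobi v n = 0" and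
      lim: "(\<lambda>n. of_real (jacobi_weight n) * (v n * rotate_coords a (n + 1) - v (n + 1) * rotate_coords a n)) \<longlonglongrightarrow> 0"
      by blast
    have "cmod (of_real (jacobi_weight n) * (v n * rotate_coords a (n + 1) - v (n + 1) * rotate_coords a n)) = W n" for n
    \<comment> \<open>\<open>v 0\<close> is undetermined, but at n = 0 the weight in front is
      0.\<close>
    proof (cases "n = 0")
      case False
      then have "v n = \<i> * rotate_coords jacobi_null n" "v (n + 1) = \<i> * rotate_coords jacobi_null (n + 1)"
        using jacobi_null_unique[OF v] by simp_all
      then show ?thesis unfolding W_def by (simp only: wronskian_rotate)
    qed (simp add: W_def)
    with tendsto_norm_zero[OF lim] have "W \<longlonglongrightarrow> 0" by simp
    then show ?R using W by simp
  next
    assume ?R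
    then have "W \<longlonglongrightarrow> 0" using W by simp
    then have "(\<lambda>n. of_real (jacobi_weight n) * (\<i> * rotate_coords jacobi_null n * rotate_coords a (n + 1)
      - \<i> * rotate_coords jacobi_null (n + 1) * rotate_coords a n)) \<longlonglongrightarrow> 0"
      unfolding W_def wronskian_rotate[symmetric] by (rule tendsto_norm_zero_cancel)
    with jacobi_null_rotate show ?L by (intro exI[of _ "\<lambda>n. \<i> * rotate_coords jacobi_null n"] conjI allI impI)
  qed
qed

lemma jacobi_dom_rotate:
  assumes "a 0 = 0"
  shows "rotate_coords a \<in> jacobi_dom \<longleftrightarrow>
    summable (\<lambda>n. (a n)\<^sup>2) \<and> summable (\<lambda>n. (skew a n)\<^sup>2) \<and> (\<lambda>k. null_flux k * a (2 * k)) \<longlonglongrightarrow> 0"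
proof -
  have "ell2 (jacobi (rotate_coords a)) \<longleftrightarrow> ell2 (rotate_coords (skew a))"
    unfolding ell2_def jacobi_rotate_coords by (simp add: norm_mult)
  then show ?thesis
    unfolding jacobi_dom_def mem_Collect_eq boundary_condition_iff
    by (simp add: ell2_rotate_coords assms)
qed

section \<open>Mild solutions in real and complex coordinates\<close>

lemma integral_rotate_coords:
  assumes "\<And>n. (\<lambda>s. a s n) integrable_on A"
  shows "(\<lambda>n. integral A (\<lambda>s. rotate_coords (a s) n)) = rotate_coords (\<lambda>n. integral A (\<lambda>s. a s n))"
proof
  fix n
  show "integral A (\<lambda>s. rotate_coords (a s) n) = rotate_coords (\<lambda>n. integral A (\<lambda>s. a s n)) n"
    unfolding rotate_coords_def
    by (rule integral_unique, intro has_integral_divide has_integral_of_real integrable_integral assms)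
qed

lemma mild_equation_rotate:
  "rotate_coords a n = rotate_coords x n + \<i> / 2 * jacobi (rotate_coords F) n \<longleftrightarrow> a n = x n + skew F n / 2"
proof -
  have "rotate_coords x n + \<i> / 2 * jacobi (rotate_coords F) n = of_real (x n + skew F n / 2) / \<i> ^ n"
    unfolding jacobi_rotate_coords by (simp add: rotate_coords_def field_simps)
  then show ?thesis unfolding rotate_coords_def by (simp only: divide_cancel_right of_real_eq_iff) simp
qed

text \<open>Minkowski's integral inequality by duality: pairing a finite section of the primitive
  with itself and applying Cauchy-Schwarz under the integral gives x \<le> t sqrt (x S) for its
  square sum x, and x cancels.\<close>

lemma l2_bound_integral:
  fixes a :: "real \<Rightarrow> nat \<Rightarrow> real"
  assumes int: "\<And>n. (\<lambda>s. a s n) integrable_on {0..t}" and t: "t \<ge> 0"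
    and S: "\<And>s. s \<in> {0..t} \<Longrightarrow> l2_bound (a s) S"
  shows "l2_bound (\<lambda>n. integral {0..t} (\<lambda>s. a s n)) (t\<^sup>2 * S)"
  unfolding l2_bound_def
proof
  fix N
  define F where "F n = integral {0..t} (\<lambda>s. a s n)" for n
  define x where "x = (\<Sum>n<N. (F n)\<^sup>2)"
  have x0: "x \<ge> 0" unfolding x_def by (intro sum_nonneg) auto
  have S0: "S \<ge> 0" using l2_bound_nonneg S t by auto
  have "((\<lambda>s. \<Sum>n<N. F n * a s n) has_integral (\<Sum>n<N. F n * F n)) {0..t}"
    unfolding F_def by (intro has_integral_sum has_integral_mult_right integrable_integral int) auto
  then have "norm (\<Sum>n<N. F n * F n) \<le> sqrt (x * S) * measure lborel {0..t}"
  proof (rule has_integral_bound_real[rotated 2])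
    show "norm (\<Sum>n<N. F n * a s n) \<le> sqrt (x * S)" if "s \<in> {0..t} - {}" for s
      using l2_bound_pair_sum[OF S, of s "{..<N}" "\<lambda>n. n" F x] that by (simp add: x_def)
  qed (use x0 S0 in auto)
  then have "x \<le> t * sqrt (x * S)"
    using t x0 by (simp add: x_def power2_eq_square mult.commute)
  then have "x\<^sup>2 \<le> (t * sqrt (x * S))\<^sup>2" using x0 by (rule power_mono)
  then have "x * x \<le> x * (t\<^sup>2 * S)" using x0 S0 by (simp add: power2_eq_square[of x] power_mult_distrib mult_ac)
  then have "x \<le> t\<^sup>2 * S" using x0 S0 by (cases "x = 0") auto
  then show "(\<Sum>n<N. (integral {0..t} (\<lambda>s. a s n))\<^sup>2) \<le> t\<^sup>2 * S" by (simp add: x_def F_def)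
qed

lemma continuous_on_halfline:
  fixes f :: "real \<Rightarrow> real"
  assumes "\<And>T. continuous_on {0..T} f"
  shows "continuous_on {0..} f"
  unfolding continuous_on_eq_continuous_within
proof
  fix s assume s: "s \<in> {0::real..}"
  have "continuous (at s within {0..s + 1}) f"
    using assms[of "s + 1"] s by (simp add: continuous_on_eq_continuous_within)
  moreover have "at s within {0..s + 1} = at s within {0..}"
    by (rule at_within_nhd[of s "{..<s + 1}"]) auto
  ultimately show "continuous (at s within {0..}) f" by simp
qed

text \<open>The primitive lies in the domain because it is square summable by Minkowski and
  \<open>skew\<close> of it is 2 (a t - a 0). Norm continuity comes from the conserved norm.\<close>

lemma jacobi_evolution_rotate:
  assumes a: "\<And>T. skew_evolution T x a" and a0: "\<And>t. a t 0 = 0"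
    and ini: "\<And>n. a 0 n = x n" and S: "\<And>t. t \<ge> 0 \<Longrightarrow> (\<lambda>n. (a t n)\<^sup>2) sums S"
  shows "jacobi_evolution (\<lambda>t. rotate_coords (a t))"
  unfolding jacobi_evolution_def
proof (intro conjI allI impI)
  fix t :: real assume t: "t \<ge> 0"
  have bd: "l2_bound (a s) S" if "s \<ge> 0" for s
    using S[OF that] by (auto simp: l2_bound_iff_suminf sums_iff)
  show "ell2 (rotate_coords (a t))"
    using S[OF t] by (simp add: ell2_rotate_coords a0 sums_iff)
  have cont: "continuous_on {0..} (\<lambda>s. a s n)" for n
  proof (rule continuous_on_halfline)
    show "continuous_on {0..T} (\<lambda>s. a s n)" for T
      using a[of T] unfolding skew_evolution_def by simp
  qed
  show "((\<lambda>s. ell2_norm (\<lambda>n. rotate_coords (a s) n - rotate_coords (a t) n)) \<longlongrightarrow> 0) (at t within {0..})"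
  proof -
    have "((\<lambda>s. sqrt (\<Sum>n. (a s n - a t n)\<^sup>2)) \<longlongrightarrow> sqrt 0) (at t within {0..})"
      by (intro tendsto_real_sqrt norm_continuous_if_conservative[OF cont S t])
    moreover have "\<forall>\<^sub>F s in at t within {0..}. sqrt (\<Sum>n. (a s n - a t n)\<^sup>2)
        = ell2_norm (\<lambda>n. rotate_coords (a s) n - rotate_coords (a t) n)"
      unfolding eventually_at_filter
    proof (intro always_eventually allI impI)
      fix s assume "s \<in> {0::real..}"
      then have "summable (\<lambda>n. (a s n - a t n)\<^sup>2)"
        using l2_bound_diff[OF bd bd, of s t] t by (simp add: l2_bound_iff_suminf)
      then show "sqrt (\<Sum>n. (a s n - a t n)\<^sup>2)
          = ell2_norm (\<lambda>n. rotate_coords (a s) n - rotate_coords (a t) n)"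
        using ell2_rotate_coords(2)[of "\<lambda>n. a s n - a t n"] a0 by (simp add: rotate_coords_diff)
    qed
    ultimately have "((\<lambda>s. ell2_norm (\<lambda>n. rotate_coords (a s) n - rotate_coords (a t) n)) \<longlongrightarrow> sqrt 0)
        (at t within {0..})"
      by (rule Lim_transform_eventually)
    then show ?thesis by simp
  qed
  have int: "(\<lambda>s. a s n) integrable_on {0..t}" for n
    using skew_evolution_integrable[OF a, of t t n] t by simp
  define F where "F n = integral {0..t} (\<lambda>s. a s n)" for n
  have eq: "a t n = x n + skew F n / 2" if "n \<ge> 1" for n
    using a[of t] t that unfolding skew_evolution_def F_def by auto
  have F0: "F 0 = 0" by (simp add: F_def a0)
  have "l2_bound F (t\<^sup>2 * S)"
    unfolding F_def by (intro l2_bound_integral int t bd) auto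
  moreover have "l2_bound (skew F) (2\<^sup>2 * (2 * S + 2 * S))"
  proof (rule l2_bound_abs_le)
    show "l2_bound (\<lambda>n. 2 * (a t n - a 0 n)) (2\<^sup>2 * (2 * S + 2 * S))"
      by (intro l2_bound_cmult l2_bound_diff bd t) auto
    show "\<bar>skew F n\<bar> \<le> \<bar>2 * (a t n - a 0 n)\<bar>" for n
      using eq[of n] ini[of n] by (cases "n = 0") auto
  qed
  moreover have "(\<lambda>k. null_flux k * F (2 * k)) \<longlonglongrightarrow> 0"
    using a[of t] t unfolding skew_evolution_def F_def by auto
  ultimately show "(\<lambda>n. integral {0..t} (\<lambda>s. rotate_coords (a s) n)) \<in> jacobi_dom"
    unfolding integral_rotate_coords[OF int] F_def[symmetric]
    by (simp add: jacobi_dom_rotate F0 l2_bound_iff_suminf)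
  show "rotate_coords (a t) n = rotate_coords (a 0) n
      + \<i> / 2 * jacobi (\<lambda>n. integral {0..t} (\<lambda>s. rotate_coords (a s) n)) n" if "n \<ge> 1" for n
    unfolding integral_rotate_coords[OF int] mild_equation_rotate
    using eq[OF that] by (simp add: ini F_def[symmetric])
qed

text \<open>Converse passage, needed for arbitrary solutions. Norm continuity yields continuity of
  the entries and, by compactness of the time interval, the uniform bound that uniqueness
  requires.\<close>

lemma jacobi_evolution_imp_skew:
  assumes j: "jacobi_evolution (\<lambda>t. rotate_coords (a t))" and a0: "\<And>t. a t 0 = 0" and T: "T \<ge> 0"
  shows "skew_evolution T (a 0) a" "\<exists>M. \<forall>t\<in>{0..T}. l2_bound (a t) M"
proof -
  have sm: "summable (\<lambda>n. (a t n)\<^sup>2)" if "t \<ge> 0" for t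
    using j that unfolding jacobi_evolution_def by (simp add: ell2_rotate_coords a0)
  have smd: "summable (\<lambda>n. (a s n - a t n)\<^sup>2)" if "s \<ge> 0" "t \<ge> 0" for s t
    using l2_bound_diff[of "a s" "\<Sum>n. (a s n)\<^sup>2" "a t" "\<Sum>n. (a t n)\<^sup>2"] sm that
    by (simp add: l2_bound_iff_suminf)
  have nc: "((\<lambda>s. sqrt (\<Sum>n. (a s n - a t n)\<^sup>2)) \<longlongrightarrow> 0) (at t within {0..})" if t: "t \<ge> 0" for t
  proof (rule Lim_transform_eventually)
    show "((\<lambda>s. ell2_norm (\<lambda>n. rotate_coords (a s) n - rotate_coords (a t) n)) \<longlongrightarrow> 0) (at t within {0..})"
      using j t unfolding jacobi_evolution_def by simp
    show "\<forall>\<^sub>F s in at t within {0..}. ell2_norm (\<lambda>n. rotate_coords (a s) n - rotate_coords (a t) n)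
        = sqrt (\<Sum>n. (a s n - a t n)\<^sup>2)"
      unfolding eventually_at_filter
      using ell2_rotate_coords(2)[OF _ smd[OF _ t]] a0
      by (intro always_eventually allI impI) (simp add: rotate_coords_diff)
  qed
  have le: "\<bar>a s n - a t n\<bar> \<le> sqrt (\<Sum>n. (a s n - a t n)\<^sup>2)" if "s \<ge> 0" "t \<ge> 0" for s t n
    using sum_le_suminf[OF smd[OF that], of "{n}"] by (simp add: real_le_rsqrt)
  have cont: "continuous_on {0..} (\<lambda>s. a s n)" for n
    unfolding continuous_on_def
  proof
    fix t assume "t \<in> {0::real..}"
    then have t: "t \<ge> 0" by simp
    have "((\<lambda>s. a s n - a t n) \<longlongrightarrow> 0) (at t within {0..})"
      by (rule Lim_null_comparison[OF _ nc[OF t]]) (auto simp: eventually_at_filter le t)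
    then show "((\<lambda>s. a s n) \<longlongrightarrow> a t n) (at t within {0..})" by (simp add: LIM_zero_iff)
  qed
  have contT: "continuous_on {0..t} (\<lambda>s. a s n)" for t n
    by (rule continuous_on_subset[OF cont]) auto
  show "skew_evolution T (a 0) a"
    unfolding skew_evolution_def
  proof (intro conjI allI ballI impI contT)
    fix t assume "t \<in> {0..T}"
    then have t: "t \<ge> 0" by simp
    have int: "(\<lambda>s. a s n) integrable_on {0..t}" for n
      by (rule integrable_continuous_real[OF contT])
    have F0: "integral {0..t} (\<lambda>s. a s 0) = 0" by (simp add: a0)
    have dom: "rotate_coords (\<lambda>n. integral {0..t} (\<lambda>s. a s n)) \<in> jacobi_dom"
      using j t unfolding jacobi_evolution_def integral_rotate_coords[OF int, symmetric] by blast
    then show "(\<lambda>k. null_flux k * integral {0..t} (\<lambda>s. a s (2 * k))) \<longlonglongrightarrow> 0"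
      using jacobi_dom_rotate[of "\<lambda>n. integral {0..t} (\<lambda>s. a s n)"] F0 by simp
    show "a t n = a 0 n + skew (\<lambda>n. integral {0..t} (\<lambda>s. a s n)) n / 2" if "n \<ge> 1" for n
      using j t that unfolding mild_equation_rotate[symmetric] jacobi_evolution_def
        integral_rotate_coords[OF int, symmetric] by blast
  qed
  \<comment> \<open>The guard \<open>t \<ge> 0\<close> is there because the small intervals in
    Bolzano's principle may extend to the left of 0.\<close>
  define P where "P p q \<longleftrightarrow> (\<exists>M. \<forall>t\<in>{p..q}. t \<ge> 0 \<longrightarrow> l2_bound (a t) M)" for p q
  have "P 0 T"
    using T
  proof (induction rule: Bolzano)
    case (trans p q r)
    then obtain M R where M: "\<forall>t\<in>{p..q}. t \<ge> 0 \<longrightarrow> l2_bound (a t) M"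
      and R: "\<forall>t\<in>{q..r}. t \<ge> 0 \<longrightarrow> l2_bound (a t) R"
      unfolding P_def by auto
    have "l2_bound (a t) (max M R)" if t: "t \<in> {p..r}" "t \<ge> 0" for t
    proof (cases "t \<le> q")
      case True
      then have "l2_bound (a t) M" using M t by auto
      then show ?thesis by (auto simp: l2_bound_def le_max_iff_disj)
    next
      case False
      then have "l2_bound (a t) R" using R t by auto
      then show ?thesis by (auto simp: l2_bound_def le_max_iff_disj)
    qed
    then show ?case unfolding P_def by (intro exI[of _ "max M R"]) auto
  next
    case (local t)
    have "\<forall>\<^sub>F s in at t within {0..}. sqrt (\<Sum>n. (a s n - a t n)\<^sup>2) < 1"
      using nc[of t] local by (intro order_tendstoD(2)[of _ 0]) auto
    then obtain d where d: "d > 0"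
      "\<And>s. s \<in> {0..} \<Longrightarrow> s \<noteq> t \<and> dist s t < d \<Longrightarrow> sqrt (\<Sum>n. (a s n - a t n)\<^sup>2) < 1"
      unfolding eventually_at by metis
    \<comment> \<open>\<open>a s\<close> is written as (a s - a t) - (- a t) so that the bound for
      differences applies, with 1 for the first part.\<close>
    define S where "S = 2 * 1 + 2 * (\<Sum>n. (- a t n)\<^sup>2)"
    have S: "l2_bound (a s) S" if "s \<ge> 0" "dist s t < d" for s
    proof -
      have "(\<Sum>n. (a s n - a t n)\<^sup>2) \<le> 1"
        using d(2)[of s] that by (cases "s = t") (auto simp: less_imp_le)
      then have "l2_bound (\<lambda>n. a s n - a t n) 1"
        using smd that local by (simp add: l2_bound_iff_suminf)
      moreover have "l2_bound (\<lambda>n. - a t n) (\<Sum>n. (- a t n)\<^sup>2)"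
        using sm local by (simp add: l2_bound_iff_suminf)
      ultimately have "l2_bound (\<lambda>n. (a s n - a t n) - (- a t n)) S" unfolding S_def by (rule l2_bound_diff)
      then show ?thesis by simp
    qed
    show ?case
    proof (intro exI[of _ d] conjI allI impI d(1))
      fix p q assume pq: "p \<le> t \<and> t \<le> q \<and> q - p < d"
      show "P p q"
        unfolding P_def using pq by (intro exI[of _ S] ballI impI S) (auto simp: dist_real_def)
    qed
  qed
  then show "\<exists>M. \<forall>t\<in>{0..T}. l2_bound (a t) M" unfolding P_def by auto
qed

section \<open>Smooth cutoffs\<close>

text \<open>The algebra generated by \<open>B\<close>. By the Leibniz rule it is closed under
  \<open>deriv\<close> as soon as the derivatives of the generators lie in it, so smoothness needs
  checking on generators only.\<close>

inductive alg_closure :: "((real \<Rightarrow> real) \<Rightarrow> bool) \<Rightarrow> (real \<Rightarrow> real) \<Rightarrow> bool" for B where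
  base: "B f \<Longrightarrow> alg_closure B f"
| cmult: "alg_closure B f \<Longrightarrow> alg_closure B (\<lambda>x. c * f x)"
| add: "alg_closure B f \<Longrightarrow> alg_closure B g \<Longrightarrow> alg_closure B (\<lambda>x. f x + g x)"
| mult: "alg_closure B f \<Longrightarrow> alg_closure B g \<Longrightarrow> alg_closure B (\<lambda>x. f x * g x)"

definition smooth :: "(real \<Rightarrow> real) \<Rightarrow> bool" where
  "smooth f \<longleftrightarrow> (\<forall>k x. ((deriv ^^ k) f) differentiable (at x))"

lemma smooth_coinduct:
  assumes "P f" "\<And>g. P g \<Longrightarrow> (\<forall>x. g differentiable (at x)) \<and> P (deriv g)"
  shows "smooth f"
proof -
  have "P ((deriv ^^ k) f)" for k
    by (induction k) (use assms in auto)
  then show ?thesis using assms(2) by (auto simp: smooth_def)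
qed

lemma differentiable_has_deriv:
  "f differentiable (at x) \<Longrightarrow> (f has_real_derivative deriv f x) (at x)"
  by (metis DERIV_imp_deriv real_differentiable_def)

lemma smooth_alg_closure:
  assumes B: "\<And>f. B f \<Longrightarrow> (\<forall>x. f differentiable (at x)) \<and> alg_closure B (deriv f)"
    and f: "alg_closure B f"
  shows "smooth f"
proof (rule smooth_coinduct[of "alg_closure B", OF f])
  fix g assume "alg_closure B g"
  then show "(\<forall>x. g differentiable (at x)) \<and> alg_closure B (deriv g)"
  proof induction
    case (base f)
    then show ?case by (rule B)
  next
    case (cmult f c)
    have "deriv (\<lambda>x. c * f x) = (\<lambda>x. c * deriv f x)"
      using cmult.IH by (intro ext DERIV_imp_deriv DERIV_cmult differentiable_has_deriv) auto
    then show ?case using cmult alg_closure.cmult by (auto intro: derivative_intros)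
  next
    case (add f g)
    have "deriv (\<lambda>x. f x + g x) = (\<lambda>x. deriv f x + deriv g x)"
      using add.IH by (intro ext DERIV_imp_deriv DERIV_add differentiable_has_deriv) auto
    then show ?case using add alg_closure.add by (auto intro: derivative_intros)
  next
    case (mult f g)
    have "deriv (\<lambda>x. f x * g x) = (\<lambda>x. deriv f x * g x + deriv g x * f x)"
      using mult.IH by (intro ext DERIV_imp_deriv DERIV_mult differentiable_has_deriv) auto
    moreover have "alg_closure B (\<lambda>x. deriv f x * g x + deriv g x * f x)"
      using mult by (intro alg_closure.add alg_closure.mult) auto
    ultimately show ?case using mult by (auto intro: derivative_intros)
  qed
qed

lemma smooth_deriv: "smooth f \<Longrightarrow> smooth (deriv f)"
  unfolding smooth_def by (metis comp_apply funpow_Suc_right)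

lemma smooth_has_deriv: "smooth f \<Longrightarrow> (f has_real_derivative deriv f x) (at x)"
  unfolding smooth_def by (metis differentiable_has_deriv funpow_0)

lemma smooth_continuous: "smooth f \<Longrightarrow> continuous_on A f"
  by (intro continuous_at_imp_continuous_on ballI DERIV_isCont[OF smooth_has_deriv])

lemma smooth_mult:
  assumes "smooth f" "smooth g" shows "smooth (\<lambda>x. f x * g x)"
proof (rule smooth_alg_closure[of smooth])
  show "(\<forall>x. h differentiable at x) \<and> alg_closure smooth (deriv h)" if "smooth h" for h
    using smooth_has_deriv[OF that] alg_closure.base[of smooth, OF smooth_deriv[OF that]]
    by (auto simp: real_differentiable_def)
qed (intro alg_closure.mult alg_closure.base assms)

lemma smooth_affine:
  assumes "smooth f" shows "smooth (\<lambda>x. f (a * x + b))"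
proof (rule smooth_coinduct[of "\<lambda>h. \<exists>g c. smooth g \<and> h = (\<lambda>x. c * g (a * x + b))"])
  show "\<exists>g c. smooth g \<and> (\<lambda>x. f (a * x + b)) = (\<lambda>x. c * g (a * x + b))"
    using assms by (intro exI[of _ f] exI[of _ 1]) auto
  fix h assume "\<exists>g c. smooth g \<and> h = (\<lambda>x. c * g (a * x + b))"
  then obtain g c where g: "smooth g" and h: "h = (\<lambda>x. c * g (a * x + b))" by blast
  have d: "(h has_real_derivative c * a * deriv g (a * x + b)) (at x)" for x
  proof -
    have "((\<lambda>x. g (a * x + b)) has_real_derivative deriv g (a * x + b) * a) (at x)"
      by (rule DERIV_chain2[OF smooth_has_deriv[OF g]]) (auto intro!: derivative_eq_intros)
    from DERIV_cmult[OF this, of c] show ?thesis by (simp add: h mult_ac)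
  qed
  have "deriv h = (\<lambda>x. (c * a) * deriv g (a * x + b))"
    using d by (intro ext DERIV_imp_deriv)
  then show "(\<forall>x. h differentiable at x) \<and> (\<exists>g c. smooth g \<and> deriv h = (\<lambda>x. c * g (a * x + b)))"
    using d smooth_deriv[OF g] by (auto simp: real_differentiable_def)
qed

text \<open>Unlike \<open>exp (- 1 / y)\<close> alone, this class of functions is closed under differentiation.\<close>

definition flat :: "real poly \<Rightarrow> real \<Rightarrow> real" where
  "flat p y = (if y \<le> 0 then 0 else poly p (1 / y) * exp (- (1 / y)))"

lemma poly_exp_tendsto_0: "((\<lambda>z::real. poly p z * exp (- z)) \<longlongrightarrow> 0) at_top"
proof -
  have "((\<lambda>z. \<Sum>i\<le>degree p. coeff p i * (z ^ i / exp z)) \<longlongrightarrow> (\<Sum>i\<le>degree p. coeff p i * 0)) at_top"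
    by (intro tendsto_sum tendsto_mult tendsto_const tendsto_power_div_exp_0)
  moreover have "(\<Sum>i\<le>degree p. coeff p i * (z ^ i / exp z)) = poly p z * exp (- z)" for z
    by (simp add: poly_altdef sum_distrib_right exp_minus divide_inverse mult.assoc)
  ultimately show ?thesis by simp
qed

text \<open>With z = 1 / y one has d/dy = - z^2 d/dz, and p(z) exp (- z) has z-derivative (p' - p)
  exp (- z); this is the origin of z^2 (p - p').\<close>

lemma flat_deriv:
  "(flat p has_real_derivative flat ([:0, 0, 1:] * (p - pderiv p)) y) (at y)"
proof -
  consider "y < 0" | "y = 0" | "y > 0" by linarith
  then show ?thesis
  proof cases
    case 1
    have "((\<lambda>_. 0) has_real_derivative 0) (at y)" by simp
    then have "(flat p has_real_derivative 0) (at y)"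
      by (rule has_field_derivative_transform_within_open[of _ _ _ "{..<0}"]) (use 1 in \<open>auto simp: flat_def\<close>)
    then show ?thesis using 1 by (simp add: flat_def)
  next
    case 2
    have "((\<lambda>h. (flat p h - flat p 0) / (h - 0)) \<longlongrightarrow> 0) (at 0)"
    proof (rule filterlim_split_at)
      have "\<forall>\<^sub>F h in at_left 0. 0 = (flat p h - flat p 0) / (h - 0)"
        by (auto simp: eventually_at_filter flat_def)
      then show "((\<lambda>h. (flat p h - flat p 0) / (h - 0)) \<longlongrightarrow> 0) (at_left 0)"
        by (rule Lim_transform_eventually[OF tendsto_const])
      \<comment> \<open>Dividing by h multiplies the polynomial in 1 / h by its variable, which is
        \<open>pCons 0\<close>.\<close>
      have "((\<lambda>h. poly (pCons 0 p) (inverse h) * exp (- inverse h)) \<longlongrightarrow> 0) (at_right 0)"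
        by (rule filterlim_compose[OF poly_exp_tendsto_0 filterlim_inverse_at_top_right])
      moreover have "\<forall>\<^sub>F h in at_right 0. poly (pCons 0 p) (inverse h) * exp (- inverse h) = (flat p h - flat p 0) / (h - 0)"
        by (auto simp: eventually_at_filter flat_def field_simps)
      ultimately show "((\<lambda>h. (flat p h - flat p 0) / (h - 0)) \<longlongrightarrow> 0) (at_right 0)"
        by (rule Lim_transform_eventually)
    qed
    then show ?thesis using 2 by (simp add: has_field_derivative_iff flat_def)
  next
    case 3
    have "((\<lambda>y. poly p (1 / y) * exp (- (1 / y))) has_real_derivative
        (poly (pderiv p) (1 / y) * (- (1 / y\<^sup>2))) * exp (- (1 / y))
        + exp (- (1 / y)) * (1 / y\<^sup>2) * poly p (1 / y)) (at y)"
    proof (rule DERIV_mult)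
      have i: "((\<lambda>y. 1 / y) has_real_derivative (- (1 / y\<^sup>2))) (at y)"
        using 3 by (auto intro!: derivative_eq_intros simp: power2_eq_square)
      show "((\<lambda>y. poly p (1 / y)) has_real_derivative poly (pderiv p) (1 / y) * (- (1 / y\<^sup>2))) (at y)"
        by (rule DERIV_chain2[OF poly_DERIV i])
      show "((\<lambda>y. exp (- (1 / y))) has_real_derivative exp (- (1 / y)) * (1 / y\<^sup>2)) (at y)"
        using DERIV_chain2[OF DERIV_exp DERIV_minus[OF i]] by simp
    qed
    moreover have "(poly (pderiv p) (1 / y) * (- (1 / y\<^sup>2))) * exp (- (1 / y))
        + exp (- (1 / y)) * (1 / y\<^sup>2) * poly p (1 / y) = flat ([:0, 0, 1:] * (p - pderiv p)) y"
      using 3 by (simp add: flat_def power2_eq_square field_simps)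
    ultimately show ?thesis
      by (intro has_field_derivative_transform_within_open[of _ _ _ "{0<..}" "flat p"])
        (use 3 in \<open>auto simp: flat_def\<close>)
  qed
qed

lemma smooth_flat: "smooth (flat p)"
proof (rule smooth_coinduct[of "\<lambda>h. \<exists>p. h = flat p"])
  fix g assume "\<exists>p. g = flat p"
  then obtain p where g: "g = flat p" by blast
  have "deriv g = flat ([:0, 0, 1:] * (p - pderiv p))"
    unfolding g by (intro ext DERIV_imp_deriv flat_deriv)
  then show "(\<forall>x. g differentiable at x) \<and> (\<exists>p. deriv g = flat p)"
    unfolding g using flat_deriv by (auto simp: real_differentiable_def)
qed auto

text \<open>One factor dies for x \<ge> 1, the other for x \<le> -1. The constant
  \<open>exp 1\<close> normalizes the value at 0 to 1, and the arguments are spelled out to match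
  \<open>smooth_affine\<close>.\<close>

definition bump :: "real \<Rightarrow> real" where
  "bump x = flat [:exp 1:] ((- 1) * x + 1) * flat [:exp 1:] (1 * x + 1)"

lemma smooth_bump: "smooth bump"
  unfolding bump_def[abs_def] by (intro smooth_mult smooth_affine smooth_flat)

lemma bump_0: "bump 0 = 1"
  by (simp add: bump_def flat_def exp_add[symmetric])

lemma bump_outside: "\<bar>x\<bar> \<ge> 1 \<Longrightarrow> bump x = 0"
  by (auto simp: bump_def flat_def abs_if split: if_splits)

lemma smooth_compact_support_bounded:
  assumes "smooth f" "\<And>x. \<bar>x\<bar> > R \<Longrightarrow> f x = 0"
  shows "\<exists>C\<ge>0. \<forall>x. \<bar>f x\<bar> \<le> C"
proof -
  have "compact (f ` {-R..R})"
    by (intro compact_continuous_image smooth_continuous assms) auto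
  then obtain C where C: "\<And>y. y \<in> f ` {-R..R} \<Longrightarrow> \<bar>y\<bar> \<le> C"
    using compact_imp_bounded bounded_real by metis
  have "\<bar>f x\<bar> \<le> \<bar>C\<bar>" for x
    using C[of "f x"] assms(2)[of x] by (cases "\<bar>x\<bar> > R") (auto simp: abs_if split: if_splits)
  then show ?thesis using abs_ge_zero by blast
qed

lemma deriv_zero_outside:
  assumes "\<And>x. \<bar>x\<bar> \<ge> R \<Longrightarrow> f x = (0::real)" "\<bar>x\<bar> > R"
  shows "deriv f x = 0"
proof (rule DERIV_imp_deriv)
  have "open {y::real. R < \<bar>y\<bar>}" by (intro open_Collect_less continuous_intros)
  then show "(f has_real_derivative 0) (at x)"
    by (intro has_field_derivative_transform_within_open[of "\<lambda>_. 0" 0 x "{y. R < \<bar>y\<bar>}" f])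
       (use assms in auto)
qed

lemma bump_bounds:
  obtains C where "C \<ge> 0" "\<And>x. \<bar>bump x\<bar> \<le> C" "\<And>x. \<bar>deriv bump x\<bar> \<le> C"
proof -
  obtain C1 where C1: "C1 \<ge> 0" "\<And>x. \<bar>bump x\<bar> \<le> C1"
    using smooth_compact_support_bounded[OF smooth_bump, of 1] bump_outside by auto
  obtain C2 where C2: "C2 \<ge> 0" "\<And>x. \<bar>deriv bump x\<bar> \<le> C2"
    using smooth_compact_support_bounded[OF smooth_deriv[OF smooth_bump], of 1] deriv_zero_outside[of 1 bump] bump_outside
    by auto
  show ?thesis
    by (rule that[of "max C1 C2"]) (use C1 C2 in \<open>auto simp: le_max_iff_disj\<close>)
qed

lemma bump_scaled_deriv:
  "((\<lambda>x. bump (x / R)) has_real_derivative deriv bump (x / R) / R) (at x)"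
proof -
  have "((\<lambda>x. bump (x / R)) has_real_derivative deriv bump (x / R) * (1 / R)) (at x)"
    by (rule DERIV_chain2[OF smooth_has_deriv[OF smooth_bump]]) (rule DERIV_cdivide[OF DERIV_ident])
  then show ?thesis by simp
qed

lemma test_function_cutoff:
  assumes "smooth f" "R > 0"
  shows "test_function (\<lambda>x. f x * bump (x / R))"
proof -
  have "smooth (\<lambda>x. f x * bump ((1 / R) * x + 0))"
    by (intro smooth_mult smooth_affine smooth_bump assms)
  then have "smooth (\<lambda>x. f x * bump (x / R))" by simp
  moreover have "{x. f x * bump (x / R) \<noteq> 0} \<subseteq> {-R..R}"
  proof
    fix x assume "x \<in> {x. f x * bump (x / R) \<noteq> 0}"
    then have "\<not> \<bar>x / R\<bar> \<ge> 1" using bump_outside by auto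
    then show "x \<in> {-R..R}" using assms(2) by (auto simp: field_simps abs_if split: if_splits)
  qed
  then have "compact (closure {x. f x * bump (x / R) \<noteq> 0})"
    using compact_closure bounded_subset[OF bounded_closed_interval] by blast
  ultimately show ?thesis by (simp add: test_function_def smooth_def)
qed

lemma test_function_smooth: "test_function f \<Longrightarrow> smooth f"
  by (simp add: test_function_def smooth_def)

lemma test_function_support:
  assumes "test_function f" obtains R where "R > 0" "\<And>x. \<bar>x\<bar> \<ge> R \<Longrightarrow> f x = 0"
proof -
  have "bounded {x. f x \<noteq> 0}"
    using assms unfolding test_function_def by (meson bounded_closure_image bounded_subset closure_subset compact_imp_bounded)
  then obtain R where "\<And>x. f x \<noteq> 0 \<Longrightarrow> \<bar>x\<bar> \<le> R" by (auto simp: bounded_real)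
  then show ?thesis by (intro that[of "\<bar>R\<bar> + 1"]) (force simp: abs_if split: if_splits)+
qed

section \<open>Integration by parts without boundary terms\<close>

lemma integral_compact_deriv_zero:
  assumes d: "\<And>x. (f has_real_derivative f' x) (at x)" and c: "continuous_on UNIV f'"
    and R: "R > 0" "\<And>x. \<bar>x\<bar> \<ge> R \<Longrightarrow> f x = 0"
  shows "(\<integral>x. f' x \<partial>lborel) = 0"
proof -
  have z: "f' x = 0" if "\<bar>x\<bar> > R" for x
    using deriv_zero_outside[of R f x] R(2) that DERIV_imp_deriv[OF d] by simp
  have "(\<integral>x. indicator {-R..R} x *\<^sub>R f' x \<partial>lborel) = f R - f (-R)"
    using R(1) by (intro integral_FTC_Icc continuous_on_subset[OF c])
      (auto simp: has_real_derivative_iff_has_vector_derivative[symmetric] intro: DERIV_subset[OF d])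
  moreover have "(\<lambda>x. indicator {-R..R} x *\<^sub>R f' x) = f'"
    using z by (force simp: fun_eq_iff indicator_def)
  ultimately show ?thesis using R by simp
qed

lemma cutoff_tendsto:
  "(\<lambda>n. bump (x / real (Suc n))) \<longlonglongrightarrow> 1"
proof -
  have "(\<lambda>n. x / real (Suc n)) \<longlonglongrightarrow> 0"
    using LIMSEQ_Suc[OF lim_const_over_n[of x]] by simp
  moreover have "isCont bump 0" using DERIV_isCont[OF smooth_has_deriv[OF smooth_bump]] .
  ultimately have "(\<lambda>n. bump (x / real (Suc n))) \<longlonglongrightarrow> bump 0" by (rule isCont_tendsto_compose[rotated])
  then show ?thesis by (simp add: bump_0)
qed

text \<open>The integrand has the shape of the derivative of f times a cutoff, with g in the role of
  f'. The term with the derivative of the cutoff carries the factor 1 / (n + 1) and drops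
  out.\<close>

lemma cutoff_limit:
  assumes g: "integrable lborel g" and f: "integrable lborel f"
  shows "(\<lambda>n. \<integral>x. g x * bump (x / real (Suc n)) + f x * (deriv bump (x / real (Suc n)) / real (Suc n)) \<partial>lborel)
    \<longlonglongrightarrow> (\<integral>x. g x \<partial>lborel)"
proof -
  obtain C where C: "C \<ge> 0" "\<And>x. \<bar>bump x\<bar> \<le> C" "\<And>x. \<bar>deriv bump x\<bar> \<le> C"
    using bump_bounds by blast
  have bm: "bump \<in> borel_measurable borel" "deriv bump \<in> borel_measurable borel"
    by (auto intro!: borel_measurable_continuous_onI smooth_continuous smooth_bump smooth_deriv)
  have fm: "f \<in> borel_measurable lborel" "g \<in> borel_measurable lborel" using f g by auto
  show ?thesis
  proof (rule integral_dominated_convergence[where w = "\<lambda>x. C * \<bar>g x\<bar> + C * \<bar>f x\<bar>"])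
    show "g \<in> borel_measurable lborel" using g by auto
    show "integrable lborel (\<lambda>x. C * \<bar>g x\<bar> + C * \<bar>f x\<bar>)" using f g by auto
    show "(\<lambda>x. g x * bump (x / real (Suc n)) + f x * (deriv bump (x / real (Suc n)) / real (Suc n)))
        \<in> borel_measurable lborel" for n
      using fm measurable_compose[OF _ bm(1), of "\<lambda>x. x / real (Suc n)" lborel]
        measurable_compose[OF _ bm(2), of "\<lambda>x. x / real (Suc n)" lborel] by measurable
    show "AE x in lborel. (\<lambda>n. g x * bump (x / real (Suc n))
        + f x * (deriv bump (x / real (Suc n)) / real (Suc n))) \<longlonglongrightarrow> g x"
    proof (rule AE_I2)
      fix x
      have "(\<lambda>n. deriv bump (x / real (Suc n)) / real (Suc n)) \<longlonglongrightarrow> 0"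
      proof (rule Lim_null_comparison)
        show "\<forall>\<^sub>F n in sequentially. norm (deriv bump (x / real (Suc n)) / real (Suc n)) \<le> C / real (Suc n)"
          using C(3) by (intro always_eventually allI) (simp add: divide_right_mono)
        show "(\<lambda>n. C / real (Suc n)) \<longlonglongrightarrow> 0"
          using LIMSEQ_Suc[OF lim_const_over_n[of C]] by simp
      qed
      then have "(\<lambda>n. g x * bump (x / real (Suc n)) + f x * (deriv bump (x / real (Suc n)) / real (Suc n)))
          \<longlonglongrightarrow> g x * 1 + f x * 0"
        by (intro tendsto_intros cutoff_tendsto)
      then show "(\<lambda>n. g x * bump (x / real (Suc n)) + f x * (deriv bump (x / real (Suc n)) / real (Suc n)))
          \<longlonglongrightarrow> g x" by simp
    qed
    show "AE x in lborel. norm (g x * bump (x / real (Suc n)) + f x * (deriv bump (x / real (Suc n)) / real (Suc n)))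
        \<le> C * \<bar>g x\<bar> + C * \<bar>f x\<bar>" for n
    proof (rule AE_I2)
      fix x
      have "C / real (Suc n) \<le> C / 1" using C(1) by (intro divide_left_mono) auto
      then have "\<bar>deriv bump (x / real (Suc n)) / real (Suc n)\<bar> \<le> C"
        using divide_right_mono[OF C(3)[of "x / real (Suc n)"], of "real (Suc n)"] by simp
      then have "\<bar>f x * (deriv bump (x / real (Suc n)) / real (Suc n))\<bar> \<le> \<bar>f x\<bar> * C"
        unfolding abs_mult by (intro mult_left_mono) auto
      moreover have "\<bar>g x * bump (x / real (Suc n))\<bar> \<le> \<bar>g x\<bar> * C"
        unfolding abs_mult by (intro mult_left_mono C) auto
      ultimately show "norm (g x * bump (x / real (Suc n)) + f x * (deriv bump (x / real (Suc n)) / real (Suc n)))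
        \<le> C * \<bar>g x\<bar> + C * \<bar>f x\<bar>"
        unfolding real_norm_def by (intro order_trans[OF abs_triangle_ineq]) (simp only: mult.commute add_mono)
    qed
  qed
qed

lemma integral_deriv_zero:
  assumes d: "\<And>x. (f has_real_derivative f' x) (at x)" and c: "continuous_on UNIV f'"
    and f: "integrable lborel f" and f': "integrable lborel f'"
  shows "(\<integral>x. f' x \<partial>lborel) = 0"
proof (rule LIMSEQ_unique[OF cutoff_limit[OF f' f]])
  have "(\<integral>x. f' x * bump (x / real (Suc n)) + f x * (deriv bump (x / real (Suc n)) / real (Suc n)) \<partial>lborel) = 0" for n
  proof (rule integral_compact_deriv_zero[where f = "\<lambda>x. f x * bump (x / real (Suc n))" and R = "real (Suc n)"])
    show "((\<lambda>x. f x * bump (x / real (Suc n))) has_real_derivative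
        f' x * bump (x / real (Suc n)) + f x * (deriv bump (x / real (Suc n)) / real (Suc n))) (at x)" for x
      using DERIV_mult[OF d bump_scaled_deriv] by (simp add: mult.commute)
    have "continuous_on UNIV f" by (intro continuous_at_imp_continuous_on ballI DERIV_isCont[OF d])
    then show "continuous_on UNIV (\<lambda>x. f' x * bump (x / real (Suc n))
        + f x * (deriv bump (x / real (Suc n)) / real (Suc n)))"
      by (intro continuous_intros c continuous_on_compose2[OF smooth_continuous[OF smooth_bump, of UNIV]]
          continuous_on_compose2[OF smooth_continuous[OF smooth_deriv[OF smooth_bump], of UNIV]]) auto
    show "f x * bump (x / real (Suc n)) = 0" if "\<bar>x\<bar> \<ge> real (Suc n)" for x
      using that bump_outside[of "x / real (Suc n)"] by simp
  qed simp
  then show "(\<lambda>n. \<integral>x. f' x * bump (x / real (Suc n)) + f x * (deriv bump (x / real (Suc n)) / real (Suc n)) \<partial>lborel)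
      \<longlonglongrightarrow> 0" by simp
qed

section \<open>Orthonormality of the Hermite functions\<close>

text \<open>The ladder relations express the derivative of a Hermite function through its two
  neighbours, so these functions generate an algebra closed under differentiation.\<close>

lemma smooth_hermite_fun: "smooth (hermite_fun n)"
proof (rule smooth_alg_closure[of "\<lambda>f. \<exists>n. f = hermite_fun n"])
  show "alg_closure (\<lambda>f. \<exists>n. f = hermite_fun n) (hermite_fun n)"
    by (rule alg_closure.base) auto
  fix f assume "\<exists>n. f = hermite_fun n"
  then obtain n where f: "f = hermite_fun n" by blast
  have "deriv f = (\<lambda>x. (sqrt n / 2) * hermite_fun (n - 1) x + (- sqrt (n + 1) / 2) * hermite_fun (Suc n) x)"
    unfolding f deriv_hermite_fun by (auto simp: fun_eq_iff field_simps)
  moreover have "alg_closure (\<lambda>f. \<exists>n. f = hermite_fun n)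
      (\<lambda>x. (sqrt n / 2) * hermite_fun (n - 1) x + (- sqrt (n + 1) / 2) * hermite_fun (Suc n) x)"
    by (intro alg_closure.add alg_closure.cmult alg_closure.base) auto
  moreover have "f differentiable at x" for x
    unfolding f using hermite_fun_deriv real_differentiable_def by blast
  ultimately show "(\<forall>x. f differentiable at x) \<and> alg_closure (\<lambda>f. \<exists>n. f = hermite_fun n) (deriv f)"
    by simp
qed

section \<open>Algebra of the inner product\<close>

lemma square_int_scaled: "square_int f \<Longrightarrow> square_int (\<lambda>x. a * f x)"
  using square_int_lin[of f f a 0] by simp

lemma square_int_add: "square_int f \<Longrightarrow> square_int g \<Longrightarrow> square_int (\<lambda>x. f x + g x)"
  using square_int_lin[of f g 1 1] by simp

lemma square_int_diff: "square_int f \<Longrightarrow> square_int g \<Longrightarrow> square_int (\<lambda>x. f x - g x)"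
  using square_int_lin[of f g 1 "-1"] by simp

lemma square_int_zero: "square_int (\<lambda>x. 0)"
  by (simp add: square_int_def)

lemma square_int_sum:
  "(\<And>n. n \<in> A \<Longrightarrow> square_int (f n)) \<Longrightarrow> square_int (\<lambda>x. \<Sum>n\<in>A. f n x)"
  by (induction A rule: infinite_finite_induct) (simp_all add: square_int_zero square_int_add)

lemma L2_inner_commute: "L2_inner f g = L2_inner g f"
  by (simp add: L2_inner_def mult.commute)

lemma L2_inner_lin:
  assumes "square_int f" "square_int g" "square_int h"
  shows "L2_inner h (\<lambda>x. a * f x + b * g x) = a * L2_inner h f + b * L2_inner h g"
proof -
  have "L2_inner h (\<lambda>x. a * f x + b * g x) = (\<integral>x. a * (h x * f x) + b * (h x * g x) \<partial>lborel)"
    unfolding L2_inner_def by (intro Bochner_Integration.integral_cong) (auto simp: algebra_simps)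
  then show ?thesis
    by (simp add: L2_inner_def Bochner_Integration.integral_add square_int_integrable_mult assms)
qed

lemma L2_inner_sum:
  assumes "\<And>n. n \<in> A \<Longrightarrow> square_int (f n)" "square_int h"
  shows "L2_inner h (\<lambda>x. \<Sum>n\<in>A. f n x) = (\<Sum>n\<in>A. L2_inner h (f n))"
proof -
  have "L2_inner h (\<lambda>x. \<Sum>n\<in>A. f n x) = (\<integral>x. (\<Sum>n\<in>A. h x * f n x) \<partial>lborel)"
    unfolding L2_inner_def by (simp add: sum_distrib_left)
  then show ?thesis
    by (simp add: L2_inner_def Bochner_Integration.integral_sum square_int_integrable_mult assms)
qed

lemma L2_inner_scaled: "L2_inner h (\<lambda>x. a * f x) = a * L2_inner h f"
  by (simp add: L2_inner_def mult.left_commute)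

lemma L2_inner_cong_AE:
  assumes "AE x in lborel. f x = g x" "f \<in> borel_measurable lborel" "g \<in> borel_measurable lborel"
    "h \<in> borel_measurable lborel"
  shows "L2_inner h f = L2_inner h g"
  unfolding L2_inner_def
  by (rule integral_cong_AE) (use assms in \<open>auto intro: borel_measurable_times elim: eventually_mono\<close>)

lemma L2_Cauchy_Schwarz:
  assumes f: "square_int f" and g: "square_int g"
  shows "(L2_inner f g)\<^sup>2 \<le> L2_inner f f * L2_inner g g"
proof -
  define A where "A = L2_inner f f"
  define B where "B = L2_inner g g"
  define C where "C = L2_inner f g"
  have q: "s\<^sup>2 * A + 2 * s * t * C + t\<^sup>2 * B \<ge> 0" for s t
  proof -
    let ?k = "\<lambda>x. s * f x + t * g x"
    have k: "square_int ?k" by (intro square_int_lin f g)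
    have "L2_inner ?k ?k = s * L2_inner f ?k + t * L2_inner g ?k"
      using L2_inner_lin[OF f g k, of s t] by (simp add: L2_inner_commute)
    also have "\<dots> = s\<^sup>2 * A + 2 * s * t * C + t\<^sup>2 * B"
      using L2_inner_commute[of g f]
      by (simp add: L2_inner_lin f g A_def B_def C_def power2_eq_square algebra_simps)
    finally have "L2_inner ?k ?k = s\<^sup>2 * A + 2 * s * t * C + t\<^sup>2 * B" .
    moreover have "L2_inner ?k ?k \<ge> 0" unfolding L2_inner_def by (simp flip: power2_eq_square)
    ultimately show ?thesis by simp
  qed
  have B0: "B \<ge> 0" unfolding B_def L2_inner_def by (simp flip: power2_eq_square)
  show ?thesis
  proof (cases "B = 0")
    case True
    have "C = 0"
    proof (rule ccontr)
      assume "C \<noteq> 0"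
      \<comment> \<open>For B = 0 this choice makes the quadratic form equal to A - (A + 1) =
        -1.\<close>
      with q[of 1 "- (A + 1) / (2 * C)"] True show False by (simp add: field_simps)
    qed
    then show ?thesis using True by (simp add: A_def B_def C_def)
  next
    case False
    \<comment> \<open>s = B and t = - C minimize the form up to scaling, leaving B times the Gram
      determinant.\<close>
    have "B * (A * B - C\<^sup>2) \<ge> 0" using q[of B "- C"] by (simp add: power2_eq_square algebra_simps)
    then have "A * B - C\<^sup>2 \<ge> 0" using False B0 by (simp add: zero_le_mult_iff)
    then show ?thesis by (simp add: A_def B_def C_def)
  qed
qed

text \<open>Raising and lowering operators are adjoint. Differentiating the product with the raising
  form on one factor and the lowering form on the other cancels the terms in x / 2.\<close>

lemma hermite_ladder_inner:
  "sqrt (n + 1) * L2_inner (hermite_fun (Suc n)) (hermite_fun m)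
    = sqrt m * L2_inner (hermite_fun n) (hermite_fun (m - 1))"
proof -
  let ?h = hermite_fun
  define D where "D x = sqrt m * (?h n x * ?h (m - 1) x) - sqrt (n + 1) * (?h (Suc n) x * ?h m x)" for x
  have i: "integrable lborel (\<lambda>x. ?h j x * ?h k x)" for j k
    by (intro square_int_integrable_mult square_int_hermite_fun)
  have "(\<integral>x. D x \<partial>lborel) = 0"
  proof (rule integral_deriv_zero[of "\<lambda>x. ?h n x * ?h m x"])
    show "((\<lambda>x. ?h n x * ?h m x) has_real_derivative D x) (at x)" for x
      using DERIV_mult[OF hermite_fun_deriv_raise[of n x] hermite_fun_deriv[of m x]]
      by (simp add: D_def algebra_simps)
    show "continuous_on UNIV D"
      unfolding D_def by (intro continuous_intros smooth_continuous smooth_hermite_fun)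
  qed (auto simp: D_def i)
  then show ?thesis by (simp add: D_def L2_inner_def i)
qed

text \<open>The ladder relation lowers both indices at once. It ends either at index 0 on one side
  only, where the factor sqrt 0 gives 0, or at the ground state, whose square is the standard normal
  density.\<close>

lemma hermite_orthonormal: "L2_inner (hermite_fun n) (hermite_fun m) = (if n = m then 1 else 0)"
proof (induction n arbitrary: m)
  case 0
  have z: "L2_inner (hermite_fun (Suc k)) (hermite_fun 0) = 0" for k
    using hermite_ladder_inner[of k 0] by simp
  have "(hermite_fun 0 x) * (hermite_fun 0 x) = std_normal_density x" for x
    by (simp add: hermite_fun_def std_normal_density_def power2_eq_square[symmetric] power_divide
        exp_double[symmetric])
  then have "L2_inner (hermite_fun 0) (hermite_fun 0) = 1"
    by (simp add: L2_inner_def)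
  then show ?case using z[of "m - 1"] by (cases m) (auto simp: L2_inner_commute)
next
  case (Suc n)
  show ?case
  proof (cases m)
    case 0
    then show ?thesis using hermite_ladder_inner[of n 0] by simp
  next
    case (Suc k)
    have "sqrt (n + 1) * L2_inner (hermite_fun (Suc n)) (hermite_fun m)
        = sqrt (k + 1) * L2_inner (hermite_fun n) (hermite_fun k)"
      using hermite_ladder_inner[of n m] by (simp add: Suc add.commute)
    then show ?thesis using Suc.IH[of k] by (cases "n = k") (auto simp: Suc)
  qed
qed

lemma hermite_coeff_hermite_sum:
  assumes "finite A"
  shows "hermite_coeff m (\<lambda>x. \<Sum>n\<in>A. c n * hermite_fun n x) = (if m \<in> A then c m else 0)"
  unfolding hermite_coeff_def
  using assms by (subst L2_inner_sum)
    (auto simp: square_int_scaled square_int_hermite_fun L2_inner_scaled hermite_orthonormal if_distrib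
      cong: if_cong)

lemma square_int_hermite_sum: "square_int (\<lambda>x. \<Sum>n\<in>A. c n * hermite_fun n x)"
  by (intro square_int_sum square_int_scaled square_int_hermite_fun)

lemma L2_inner_hermite_sum:
  assumes "finite A" "square_int u"
  shows "L2_inner (\<lambda>x. \<Sum>n\<in>A. c n * hermite_fun n x) u = (\<Sum>n\<in>A. c n * hermite_coeff n u)"
  unfolding hermite_coeff_def L2_inner_commute[of _ u]
  by (subst L2_inner_sum) (auto simp: square_int_scaled square_int_hermite_fun L2_inner_scaled assms)

text \<open>Hermite functions lack compact support and are no test functions; they are cut off, and
  the cutoff is removed in the limit.\<close>

lemma weak_deriv_hermite:
  assumes u: "square_int u" and g: "square_int g" and w: "is_weak_deriv u g"
  shows "L2_inner u (deriv (hermite_fun n)) = - L2_inner g (hermite_fun n)"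
proof -
  let ?h = "hermite_fun n"
  have dh: "square_int (deriv ?h)"
    using square_int_lin[OF square_int_hermite_fun[of "n - 1"] square_int_hermite_fun[of "Suc n"],
        of "sqrt n / 2" "- sqrt (n + 1) / 2"]
    unfolding deriv_hermite_fun by (simp add: field_simps)
  define p where "p k = (\<lambda>x. ?h x * bump (x / real (Suc k)))" for k
  have l1: "(\<lambda>k. L2_inner u (deriv (p k))) \<longlonglongrightarrow> L2_inner u (deriv ?h)"
  proof -
    have "deriv (p k) = (\<lambda>x. deriv ?h x * bump (x / real (Suc k))
        + ?h x * (deriv bump (x / real (Suc k)) / real (Suc k)))" for k
    proof (intro ext DERIV_imp_deriv)
      show "(p k has_real_derivative deriv ?h x * bump (x / real (Suc k))
          + ?h x * (deriv bump (x / real (Suc k)) / real (Suc k))) (at x)" for x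
        unfolding p_def
        using DERIV_mult[OF smooth_has_deriv[OF smooth_hermite_fun[of n], of x] bump_scaled_deriv[of "real (Suc k)" x]]
        by (simp add: mult.commute add.commute)
    qed
    then have "L2_inner u (deriv (p k)) = (\<integral>x. (u x * deriv ?h x) * bump (x / real (Suc k))
        + (u x * ?h x) * (deriv bump (x / real (Suc k)) / real (Suc k)) \<partial>lborel)" for k
      by (simp add: L2_inner_def distrib_left mult.assoc)
    then show ?thesis
      unfolding L2_inner_def[of u "deriv ?h"]
      by (simp only: cutoff_limit square_int_integrable_mult u dh square_int_hermite_fun)
  qed
  have eq: "L2_inner u (deriv (p k)) = - L2_inner g (p k)" for k
    using w test_function_cutoff[OF smooth_hermite_fun, of "real (Suc k)" n]
    unfolding is_weak_deriv_def p_def by simp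
  have l2: "(\<lambda>k. L2_inner g (p k)) \<longlonglongrightarrow> L2_inner g ?h"
    using cutoff_limit[OF square_int_integrable_mult[OF g square_int_hermite_fun[of n]], of "\<lambda>x. 0"]
    by (simp add: L2_inner_def p_def mult.assoc)
  show ?thesis
    by (rule LIMSEQ_unique[OF l1]) (unfold eq, rule tendsto_minus[OF l2])
qed

lemma hermite_fun_mult_x: "square_int (\<lambda>x. x * hermite_fun n x)"
  unfolding hermite_fun_three_term by (intro square_int_lin square_int_hermite_fun)

text \<open>x / 2 + d/dx and x / 2 - d/dx are the annihilation and creation operators, so on
  coefficients they are weighted shifts. The explicit factors 1 and -1 match the form of
  \<open>L2_inner_lin\<close>.\<close>

lemma weak_deriv_coeffs:
  assumes u: "square_int u" and xu: "square_int (\<lambda>x. x * u x)" and g: "square_int g" and w: "is_weak_deriv u g"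
  shows "hermite_coeff n (\<lambda>x. 1 / 2 * (x * u x) + 1 * g x) = sqrt (n + 1) * hermite_coeff (Suc n) u"
    and "hermite_coeff n (\<lambda>x. 1 / 2 * (x * u x) + (- 1) * g x) = sqrt n * hermite_coeff (n - 1) u"
proof -
  let ?h = hermite_fun
  have x: "L2_inner (?h n) (\<lambda>x. x * u x) = L2_inner u (\<lambda>x. x * ?h n x)"
    by (simp add: L2_inner_def mult_ac)
  have d: "deriv (?h n) = (\<lambda>x. (1 / 2) * (x * ?h n x) + (- sqrt (n + 1)) * ?h (Suc n) x)"
    "deriv (?h n) = (\<lambda>x. sqrt n * ?h (n - 1) x + (- 1 / 2) * (x * ?h n x))"
    using DERIV_imp_deriv[OF hermite_fun_deriv_raise] DERIV_imp_deriv[OF hermite_fun_deriv]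
    by (auto simp: fun_eq_iff)
  have 1: "L2_inner u (deriv (?h n)) = 1 / 2 * L2_inner u (\<lambda>x. x * ?h n x) - sqrt (n + 1) * hermite_coeff (Suc n) u"
    unfolding d(1) by (subst L2_inner_lin)
      (simp_all add: hermite_fun_mult_x square_int_hermite_fun u hermite_coeff_def L2_inner_commute[of u "?h (Suc n)"])
  have 2: "L2_inner u (deriv (?h n)) = sqrt n * hermite_coeff (n - 1) u - 1 / 2 * L2_inner u (\<lambda>x. x * ?h n x)"
    unfolding d(2) by (subst L2_inner_lin)
      (simp_all add: hermite_fun_mult_x square_int_hermite_fun u hermite_coeff_def L2_inner_commute[of u "?h (n - Suc 0)"])
  have 3: "L2_inner (?h n) g = - L2_inner u (deriv (?h n))"
    using weak_deriv_hermite[OF u g w, of n] by (simp add: L2_inner_commute)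
  show "hermite_coeff n (\<lambda>x. 1 / 2 * (x * u x) + 1 * g x) = sqrt (n + 1) * hermite_coeff (Suc n) u"
    unfolding hermite_coeff_def[of n] L2_inner_lin[OF xu g square_int_hermite_fun] x 3 1 by simp
  show "hermite_coeff n (\<lambda>x. 1 / 2 * (x * u x) + (- 1) * g x) = sqrt n * hermite_coeff (n - 1) u"
    unfolding hermite_coeff_def[of n] L2_inner_lin[OF xu g square_int_hermite_fun] x 3 2 by simp
qed

text \<open>Positive and negative parts of g have equal Fourier transforms, hence equal mass at
  frequency 0. If that mass is positive, normalization yields two probability densities with the
  same characteristic function, and Levy's theorem identifies them.\<close>

lemma fourier_zero:
  fixes g :: "real \<Rightarrow> real"
  assumes g: "integrable lborel g" and zero: "\<And>t. (\<integral>x. iexp (t * x) * of_real (g x) \<partial>lborel) = 0"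
  shows "AE x in lborel. g x = 0"
proof -
  define p where "p x = max 0 (g x)" for x
  define q where "q x = max 0 (- g x)" for x
  have pi: "integrable lborel p" "integrable lborel q"
    using g by (auto simp: p_def[abs_def] q_def[abs_def])
  have pm: "p \<in> borel_measurable lborel" "q \<in> borel_measurable lborel" using pi by auto
  have nn: "p x \<ge> 0" "q x \<ge> 0" for x by (auto simp: p_def q_def)
  have gpq: "g x = p x - q x" for x by (auto simp: p_def q_def max_def)
  have ei: "integrable lborel (\<lambda>x. iexp (t * x) * complex_of_real (f x))" if "integrable lborel f" for f t
  proof (rule Bochner_Integration.integrable_bound[OF that])
    show "(\<lambda>x. iexp (t * x) * complex_of_real (f x)) \<in> borel_measurable lborel"
      using that by measurable
  qed (auto simp: norm_mult)
  have eq: "(\<integral>x. iexp (t * x) * of_real (p x) \<partial>lborel) = (\<integral>x. iexp (t * x) * of_real (q x) \<partial>lborel)" for t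
  proof -
    have "(\<integral>x. iexp (t * x) * of_real (g x) \<partial>lborel)
        = (\<integral>x. iexp (t * x) * of_real (p x) - iexp (t * x) * of_real (q x) \<partial>lborel)"
      by (simp only: gpq of_real_diff right_diff_distrib)
    also have "\<dots> = (\<integral>x. iexp (t * x) * of_real (p x) \<partial>lborel) - (\<integral>x. iexp (t * x) * of_real (q x) \<partial>lborel)"
      by (intro Bochner_Integration.integral_diff ei pi)
    finally show ?thesis using zero[of t] by simp
  qed
  define m where "m = (\<integral>x. p x \<partial>lborel)"
  have mq: "(\<integral>x. q x \<partial>lborel) = m"
    using eq[of 0] by (simp add: m_def)
  have m0: "m \<ge> 0" unfolding m_def using nn by (intro integral_nonneg_AE) auto
  show ?thesis
  proof (cases "m = 0")
    case True
    have "AE x in lborel. p x = 0"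
      using True pi(1) nn integral_nonneg_eq_0_iff_AE[of lborel p] by (simp add: m_def)
    moreover have "AE x in lborel. q x = 0"
      using True mq pi(2) nn integral_nonneg_eq_0_iff_AE[of lborel q] by simp
    ultimately show ?thesis by eventually_elim (simp add: gpq)
  next
    case False
    with m0 have m: "m > 0" by simp
    define D where "D f = density lborel (\<lambda>x. ennreal (f x / m))" for f :: "real \<Rightarrow> real"
    have rd: "real_distribution (D f)" if "integrable lborel f" "\<And>x. f x \<ge> 0" "(\<integral>x. f x \<partial>lborel) = m" for f
    proof -
      have "(\<integral>\<^sup>+x. ennreal (f x / m) \<partial>lborel) = ennreal (\<integral>x. f x / m \<partial>lborel)"
        using that m by (intro nn_integral_eq_integral) auto
      also have "\<dots> = 1" using that m by simp
      finally have "emeasure (D f) (space (D f)) = 1"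
        using that by (simp add: D_def emeasure_density)
      then have "prob_space (D f)" by (rule prob_spaceI)
      then show ?thesis
        by (simp add: real_distribution_def real_distribution_axioms_def D_def)
    qed
    have ch: "char (D f) t = (\<integral>x. iexp (t * x) * of_real (f x) \<partial>lborel) / m"
      if "integrable lborel f" "\<And>x. f x \<ge> 0" for f t
    proof -
      have "char (D f) t = (\<integral>x. (f x / m) *\<^sub>R iexp (t * x) \<partial>lborel)"
        unfolding char_def D_def using that m by (intro integral_density) auto
      also have "\<dots> = (\<integral>x. iexp (t * x) * of_real (f x) / m \<partial>lborel)"
        by (intro Bochner_Integration.integral_cong) (auto simp: scaleR_conv_of_real)
      finally show ?thesis by simp
    qed
    have "D p = D q"
    proof (rule Levy_uniqueness)
      show "char (D p) = char (D q)"
        by (rule ext) (simp only: ch[OF pi(1) nn(1)] ch[OF pi(2) nn(2)] eq)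
    qed (simp_all add: rd pi nn mq m_def[symmetric])
    then have "AE x in lborel. ennreal (p x / m) = ennreal (q x / m)"
      unfolding D_def by (rule sigma_finite_measure.density_unique[OF sigma_finite_lborel, rotated 2]) (use pm in auto)
    then show ?thesis
      by eventually_elim (use m nn in \<open>simp add: gpq\<close>)
  qed
qed

section \<open>Completeness of the Hermite functions\<close>

lemma abs_le_exp: "\<bar>x :: real\<bar> \<le> exp \<bar>x\<bar>"
  using exp_ge_add_one_self[of "\<bar>x\<bar>"] by linarith

lemma abs_power_le_exp: "\<bar>x :: real\<bar> ^ k \<le> exp (real k * \<bar>x\<bar>)"
proof -
  have "\<bar>x\<bar> ^ k \<le> exp \<bar>x\<bar> ^ k" by (intro power_mono abs_le_exp) auto
  then show ?thesis by (simp add: exp_of_nat_mult)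
qed

text \<open>Exponential growth is cruder than the polynomial truth but easy to carry through the
  recursion, and the Gaussian absorbs it.\<close>

lemma hermite_growth: "\<exists>C\<ge>0. \<forall>y. \<bar>hermite n y\<bar> \<le> C * exp (real n * \<bar>y\<bar>)"
proof (induction n rule: induct_nat_012)
  case 0
  show ?case by (intro exI[of _ 1]) auto
next
  case 1
  have "\<bar>2 * y\<bar> \<le> 2 * exp \<bar>y\<bar>" for y :: real
    using abs_le_exp[of y] by (simp only: abs_mult abs_numeral)
  then show ?case by (intro exI[of _ 2]) auto
next
  case (ge2 n)
  then obtain C D where C: "C \<ge> 0" "\<And>y. \<bar>hermite (Suc n) y\<bar> \<le> C * exp (real (Suc n) * \<bar>y\<bar>)"
    and D: "D \<ge> 0" "\<And>y. \<bar>hermite n y\<bar> \<le> D * exp (real n * \<bar>y\<bar>)" by blast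
  have "\<bar>hermite (Suc (Suc n)) y\<bar> \<le> (2 * C + 2 * real (Suc n) * D) * exp (real (Suc (Suc n)) * \<bar>y\<bar>)" for y
  proof -
    have "\<bar>2 * y * hermite (Suc n) y\<bar> \<le> 2 * exp \<bar>y\<bar> * (C * exp (real (Suc n) * \<bar>y\<bar>))"
      unfolding abs_mult using abs_le_exp[of y] C by (intro mult_mono) auto
    also have "real (Suc (Suc n)) * \<bar>y\<bar> = \<bar>y\<bar> + real (Suc n) * \<bar>y\<bar>" by (simp add: distrib_right)
    then have "2 * exp \<bar>y\<bar> * (C * exp (real (Suc n) * \<bar>y\<bar>)) = 2 * C * exp (real (Suc (Suc n)) * \<bar>y\<bar>)"
      by (simp only: exp_add mult_ac)
    finally have 1: "\<bar>2 * y * hermite (Suc n) y\<bar> \<le> 2 * C * exp (real (Suc (Suc n)) * \<bar>y\<bar>)" .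
    have "\<bar>2 * real (Suc n) * hermite n y\<bar> \<le> 2 * real (Suc n) * (D * exp (real n * \<bar>y\<bar>))"
      unfolding abs_mult using D by (intro mult_mono) auto
    also have "\<dots> \<le> 2 * real (Suc n) * (D * exp (real (Suc (Suc n)) * \<bar>y\<bar>))"
      using D by (intro mult_left_mono) (auto intro!: mult_right_mono)
    finally have 2: "\<bar>2 * real (Suc n) * hermite n y\<bar> \<le> 2 * real (Suc n) * D * exp (real (Suc (Suc n)) * \<bar>y\<bar>)"
      by (simp only: mult.assoc)
    have "\<bar>hermite (Suc (Suc n)) y\<bar> \<le> \<bar>2 * y * hermite (Suc n) y\<bar> + \<bar>2 * real (Suc n) * hermite n y\<bar>"
      unfolding hermite.simps by (rule abs_triangle_ineq4)
    then show ?thesis using 1 2 unfolding distrib_right by linarith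
  qed
  then show ?case using C(1) D(1) by (intro exI[of _ "2 * C + 2 * real (Suc n) * D"]) auto
qed

lemma hermite_fun_growth:
  obtains C where "C \<ge> 0" "\<And>x. \<bar>hermite_fun n x\<bar> \<le> C * exp (real n * \<bar>x\<bar> - x\<^sup>2 / 4)"
proof -
  obtain C where C: "C \<ge> 0" "\<And>y. \<bar>hermite n y\<bar> \<le> C * exp (real n * \<bar>y\<bar>)"
    using hermite_growth by blast
  define D where "D = sqrt (2 ^ n * fact n * sqrt (2 * pi))"
  have D: "D > 0" by (simp add: D_def)
  show ?thesis
  proof (rule that[of "C / D"])
    show "C / D \<ge> 0" using C D by simp
    fix x :: real
    have "\<bar>x / sqrt 2\<bar> \<le> \<bar>x\<bar>"
      by (simp add: field_simps mult_le_cancel_left1)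
    then have "real n * \<bar>x / sqrt 2\<bar> \<le> real n * \<bar>x\<bar>" by (rule mult_left_mono) simp
    then have "C * exp (real n * \<bar>x / sqrt 2\<bar>) \<le> C * exp (real n * \<bar>x\<bar>)"
      using C(1) by (intro mult_left_mono) simp_all
    then have "\<bar>hermite n (x / sqrt 2)\<bar> \<le> C * exp (real n * \<bar>x\<bar>)"
      using C(2)[of "x / sqrt 2"] by linarith
    then have "\<bar>hermite n (x / sqrt 2)\<bar> * exp (- (x\<^sup>2 / 4)) / D \<le> C * exp (real n * \<bar>x\<bar>) * exp (- (x\<^sup>2 / 4)) / D"
      using D by (intro divide_right_mono mult_right_mono) auto
    moreover have "exp (real n * \<bar>x\<bar> - x\<^sup>2 / 4) = exp (real n * \<bar>x\<bar>) * exp (- (x\<^sup>2 / 4))"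
      by (simp flip: exp_add)
    ultimately show "\<bar>hermite_fun n x\<bar> \<le> C / D * exp (real n * \<bar>x\<bar> - x\<^sup>2 / 4)"
      using D by (simp add: hermite_fun_def D_def[symmetric] abs_mult)
  qed
qed

text \<open>A class larger than the square integrable functions and closed under multiplication by
  x. Completeness can thus be applied to x u before x u is known to be square integrable.\<close>

definition gauss_integrable :: "(real \<Rightarrow> real) \<Rightarrow> bool" where
  "gauss_integrable q \<longleftrightarrow> q \<in> borel_measurable lborel \<and>
     (\<forall>r. integrable lborel (\<lambda>x. q x * exp (r * \<bar>x\<bar> - x\<^sup>2 / 4)))"

lemma integrable_exp_gauss: "integrable lborel (\<lambda>x :: real. exp (s * x - x\<^sup>2 / 2))"
proof -
  have "exp (s * x - x\<^sup>2 / 2) = sqrt (2 * pi) * exp (s\<^sup>2 / 2) * normal_density s 1 x" for x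
    by (simp add: normal_density_def power2_diff field_simps flip: exp_add)
  then show ?thesis by simp
qed

lemma square_int_exp_gauss: "square_int (\<lambda>x. exp (r * \<bar>x\<bar> - x\<^sup>2 / 4))"
  unfolding square_int_def
proof
  show "integrable lborel (\<lambda>x :: real. (exp (r * \<bar>x\<bar> - x\<^sup>2 / 4))\<^sup>2)"
  proof (rule Bochner_Integration.integrable_bound)
    show "integrable lborel (\<lambda>x :: real. exp ((2 * r) * x - x\<^sup>2 / 2) + exp ((- 2 * r) * x - x\<^sup>2 / 2))"
      by (intro Bochner_Integration.integrable_add integrable_exp_gauss)
    have "(exp (r * \<bar>x\<bar> - x\<^sup>2 / 4))\<^sup>2 \<le> exp ((2 * r) * x - x\<^sup>2 / 2) + exp ((- 2 * r) * x - x\<^sup>2 / 2)" for x :: real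
    proof -
      have "(exp (r * \<bar>x\<bar> - x\<^sup>2 / 4))\<^sup>2 = exp (2 * r * \<bar>x\<bar> - x\<^sup>2 / 2)"
        by (simp flip: exp_double)
      then show ?thesis by (cases "x \<ge> 0") auto
    qed
    then show "AE x in lborel. norm ((exp (r * \<bar>x\<bar> - x\<^sup>2 / 4))\<^sup>2)
        \<le> norm (exp ((2 * r) * x - x\<^sup>2 / 2) + exp ((- 2 * r) * x - x\<^sup>2 / 2))"
      by (intro AE_I2) simp
  qed measurable
qed measurable

lemma gauss_integrable_square_int: "square_int u \<Longrightarrow> gauss_integrable u"
  by (auto simp: gauss_integrable_def square_int_def[of u]
      intro: square_int_integrable_mult square_int_exp_gauss)

lemma gauss_integrable_mult_x: "gauss_integrable u \<Longrightarrow> gauss_integrable (\<lambda>x. x * u x)"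
  unfolding gauss_integrable_def
proof (intro conjI allI)
  assume u: "u \<in> borel_measurable lborel \<and> (\<forall>r. integrable lborel (\<lambda>x. u x * exp (r * \<bar>x\<bar> - x\<^sup>2 / 4)))"
  then have [measurable]: "u \<in> borel_measurable borel" by simp
  show m: "(\<lambda>x. x * u x) \<in> borel_measurable lborel" by measurable
  fix r :: real
  show "integrable lborel (\<lambda>x. x * u x * exp (r * \<bar>x\<bar> - x\<^sup>2 / 4))"
  proof (rule Bochner_Integration.integrable_bound)
    show "integrable lborel (\<lambda>x. u x * exp ((r + 1) * \<bar>x\<bar> - x\<^sup>2 / 4))" using u by blast
    show "(\<lambda>x. x * u x * exp (r * \<bar>x\<bar> - x\<^sup>2 / 4)) \<in> borel_measurable lborel" using m by measurable
    show "AE x in lborel. norm (x * u x * exp (r * \<bar>x\<bar> - x\<^sup>2 / 4)) \<le> norm (u x * exp ((r + 1) * \<bar>x\<bar> - x\<^sup>2 / 4))"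
    proof (rule AE_I2)
      fix x :: real
      have "\<bar>x\<bar> * (\<bar>u x\<bar> * exp (r * \<bar>x\<bar> - x\<^sup>2 / 4)) \<le> exp \<bar>x\<bar> * (\<bar>u x\<bar> * exp (r * \<bar>x\<bar> - x\<^sup>2 / 4))"
        using abs_power_le_exp[of x 1] by (intro mult_right_mono) auto
      moreover have "exp ((r + 1) * \<bar>x\<bar> - x\<^sup>2 / 4) = exp \<bar>x\<bar> * exp (r * \<bar>x\<bar> - x\<^sup>2 / 4)"
        by (simp add: algebra_simps flip: exp_add)
      ultimately show "norm (x * u x * exp (r * \<bar>x\<bar> - x\<^sup>2 / 4)) \<le> norm (u x * exp ((r + 1) * \<bar>x\<bar> - x\<^sup>2 / 4))"
        by (simp add: abs_mult mult_ac)
    qed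
  qed
qed

lemma gauss_integrable_diff:
  "gauss_integrable p \<Longrightarrow> gauss_integrable q \<Longrightarrow> gauss_integrable (\<lambda>x. p x - q x)"
  by (auto simp: gauss_integrable_def left_diff_distrib)

lemma gauss_integrable_hermite:
  assumes "gauss_integrable q"
  shows "integrable lborel (\<lambda>x. hermite_fun n x * q x)"
proof -
  obtain C where C: "C \<ge> 0" "\<And>x. \<bar>hermite_fun n x\<bar> \<le> C * exp (real n * \<bar>x\<bar> - x\<^sup>2 / 4)"
    using hermite_fun_growth by blast
  show ?thesis
  proof (rule Bochner_Integration.integrable_bound)
    show "integrable lborel (\<lambda>x. C * (q x * exp (real n * \<bar>x\<bar> - x\<^sup>2 / 4)))"
      using assms unfolding gauss_integrable_def by auto
    show "(\<lambda>x. hermite_fun n x * q x) \<in> borel_measurable lborel"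
      using assms square_int_hermite_fun[of n] unfolding gauss_integrable_def square_int_def by auto
    have "\<bar>hermite_fun n x\<bar> * \<bar>q x\<bar> \<le> (C * exp (real n * \<bar>x\<bar> - x\<^sup>2 / 4)) * \<bar>q x\<bar>" for x
      using C(2) by (intro mult_right_mono) auto
    then show "AE x in lborel. norm (hermite_fun n x * q x) \<le> norm (C * (q x * exp (real n * \<bar>x\<bar> - x\<^sup>2 / 4)))"
      using C(1) by (intro AE_I2) (simp add: abs_mult mult_ac)
  qed
qed

text \<open>The moments of \<open>q x * exp (- x\<^sup>2 / 4)\<close> vanish, hence so does its Fourier transform.\<close>

lemma hermite_complete:
  assumes q: "gauss_integrable q" and zero: "\<And>n. L2_inner (hermite_fun n) q = 0"
  shows "AE x in lborel. q x = 0"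
proof -
  have qk: "gauss_integrable (\<lambda>x. x ^ k * q x)" for k
    by (induction k) (use q gauss_integrable_mult_x in \<open>auto simp: mult.assoc\<close>)
  \<comment> \<open>Each power of x is moved onto the Hermite function by the three-term relation,
    which again produces Hermite functions.\<close>
  have mom: "(\<integral>x. hermite_fun n x * (x ^ k * q x) \<partial>lborel) = 0" for k n
  proof (induction k arbitrary: n)
    case 0
    show ?case using zero[of n] by (simp add: L2_inner_def)
  next
    case (Suc k)
    have "hermite_fun n x * (x ^ Suc k * q x) = sqrt (n + 1) * (hermite_fun (Suc n) x * (x ^ k * q x))
        + sqrt n * (hermite_fun (n - 1) x * (x ^ k * q x))" for x
    proof -
      have "hermite_fun n x * (x ^ Suc k * q x) = (x * hermite_fun n x) * (x ^ k * q x)" by simp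
      then show ?thesis unfolding hermite_fun_three_term by (simp add: algebra_simps)
    qed
    then show ?case
      using Suc.IH[of "Suc n"] Suc.IH[of "n - 1"]
      by (simp add: Bochner_Integration.integral_add gauss_integrable_hermite[OF qk])
  qed
  define g where "g x = q x * exp (- (x\<^sup>2 / 4))" for x
  define c where "c = sqrt (sqrt (2 * pi))"
  have c: "c > 0" by (simp add: c_def)
  have h0: "hermite_fun 0 x = exp (- (x\<^sup>2 / 4)) / c" for x by (simp add: hermite_fun_def c_def)
  have gi: "integrable lborel (\<lambda>x. x ^ k * g x)" for k
    using Bochner_Integration.integrable_mult_right[OF gauss_integrable_hermite[OF qk, of 0 k], of c] c
    by (simp add: h0 g_def mult_ac)
  have gm: "(\<integral>x. x ^ k * g x \<partial>lborel) = 0" for k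
    using mom[of 0 k] c by (simp add: h0 g_def mult_ac)
  have "AE x in lborel. g x = 0"
  proof (rule fourier_zero)
    show "integrable lborel g" using gi[of 0] by simp
    fix t :: real
    define s where "s N x = (\<Sum>k<N. ((\<i> * of_real t) ^ k / fact k) * of_real (x ^ k * g x))" for N x
    have cgi: "integrable lborel (\<lambda>x. z * complex_of_real (x ^ k * g x))" for z k
      using gi by (intro Bochner_Integration.integrable_mult_right integrable_of_real)
    have sN: "(\<integral>x. s N x \<partial>lborel) = 0" for N
    proof -
      have "(\<integral>x. s N x \<partial>lborel) = (\<Sum>k<N. \<integral>x. ((\<i> * of_real t) ^ k / fact k) * complex_of_real (x ^ k * g x) \<partial>lborel)"
        unfolding s_def by (intro Bochner_Integration.integral_sum cgi)
      also have "\<dots> = 0"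
        by (intro sum.neutral ballI) (simp only: integral_mult_right_zero integral_complex_of_real gm, simp)
      finally show ?thesis .
    qed
    have s_eq: "s N x = (\<Sum>k<N. (\<i> * of_real (t * x)) ^ k /\<^sub>R fact k) * of_real (g x)" for N x
      unfolding s_def sum_distrib_right
      by (intro sum.cong) (auto simp: power_mult_distrib scaleR_conv_of_real field_simps)
    \<comment> \<open>Every partial sum of the exponential series is bounded by exp |t x|, and the
      Gaussian factor makes this majorant integrable for each t.\<close>
    have "(\<lambda>N. \<integral>x. s N x \<partial>lborel) \<longlonglongrightarrow> (\<integral>x. iexp (t * x) * of_real (g x) \<partial>lborel)"
    proof (rule integral_dominated_convergence[where w = "\<lambda>x. \<bar>q x * exp (\<bar>t\<bar> * \<bar>x\<bar> - x\<^sup>2 / 4)\<bar>"])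
      show "(\<lambda>x. iexp (t * x) * complex_of_real (g x)) \<in> borel_measurable lborel"
        using borel_measurable_integrable[OF gi[of 0]] by simp
      show "s N \<in> borel_measurable lborel" for N
        unfolding s_def by (intro borel_measurable_sum borel_measurable_integrable[OF cgi])
      show "integrable lborel (\<lambda>x. \<bar>q x * exp (\<bar>t\<bar> * \<bar>x\<bar> - x\<^sup>2 / 4)\<bar>)"
        using q unfolding gauss_integrable_def by auto
      show "AE x in lborel. (\<lambda>N. s N x) \<longlonglongrightarrow> iexp (t * x) * complex_of_real (g x)"
      proof (rule AE_I2)
        fix x
        have "(\<lambda>N. \<Sum>k<N. (\<i> * of_real (t * x)) ^ k /\<^sub>R fact k) \<longlonglongrightarrow> iexp (t * x)"
          using exp_converges[of "\<i> * complex_of_real (t * x)"] unfolding sums_def .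
        then show "(\<lambda>N. s N x) \<longlonglongrightarrow> iexp (t * x) * complex_of_real (g x)"
          unfolding s_eq by (intro tendsto_mult tendsto_const)
      qed
      show "AE x in lborel. norm (s N x) \<le> \<bar>q x * exp (\<bar>t\<bar> * \<bar>x\<bar> - x\<^sup>2 / 4)\<bar>" for N
      proof (rule AE_I2)
        fix x
        have "norm (\<Sum>k<N. (\<i> * complex_of_real (t * x)) ^ k /\<^sub>R fact k) \<le> (\<Sum>k<N. \<bar>t * x\<bar> ^ k /\<^sub>R fact k)"
          by (intro sum_norm_le) (simp add: norm_mult norm_power abs_mult)
        also have "\<dots> \<le> exp \<bar>t * x\<bar>"
          unfolding exp_def by (intro sum_le_suminf summable_exp_generic) auto
        finally have *: "norm (s N x) \<le> exp \<bar>t * x\<bar> * \<bar>g x\<bar>"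
          unfolding s_eq norm_mult by (intro mult_mono) auto
        have e: "exp (\<bar>t\<bar> * \<bar>x\<bar> - x\<^sup>2 / 4) = exp \<bar>t * x\<bar> * exp (- (x\<^sup>2 / 4))"
          by (simp add: abs_mult flip: exp_add)
        have "exp \<bar>t * x\<bar> * \<bar>g x\<bar> = \<bar>q x * exp (\<bar>t\<bar> * \<bar>x\<bar> - x\<^sup>2 / 4)\<bar>"
          unfolding e g_def by (simp only: abs_mult[of "q x"] abs_mult[of "exp _"] abs_exp_cancel mult_ac)
        with * show "norm (s N x) \<le> \<bar>q x * exp (\<bar>t\<bar> * \<bar>x\<bar> - x\<^sup>2 / 4)\<bar>" by simp
      qed
    qed
    then show "(\<integral>x. iexp (t * x) * of_real (g x) \<partial>lborel) = 0"
      unfolding sN by (rule LIMSEQ_unique[OF _ tendsto_const])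
  qed
  then show ?thesis by eventually_elim (simp add: g_def)
qed

lemma hermite_coeff_eq_imp_AE_eq:
  assumes "gauss_integrable u" "gauss_integrable v" "\<And>n. hermite_coeff n u = hermite_coeff n v"
  shows "AE x in lborel. u x = v x"
proof -
  have "AE x in lborel. u x - v x = 0"
  proof (rule hermite_complete)
    show "gauss_integrable (\<lambda>x. u x - v x)" by (intro gauss_integrable_diff assms)
    show "L2_inner (hermite_fun n) (\<lambda>x. u x - v x) = 0" for n
      using assms(3)[of n] gauss_integrable_hermite[OF assms(1)] gauss_integrable_hermite[OF assms(2)]
      by (simp add: L2_inner_def hermite_coeff_def right_diff_distrib)
  qed
  then show ?thesis by eventually_elim simp
qed

section \<open>Hermite series\<close>

lemma nn_integral_square:
  "square_int f \<Longrightarrow> (\<integral>\<^sup>+x. ennreal ((f x)\<^sup>2) \<partial>lborel) = ennreal (L2_inner f f)"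
  unfolding L2_inner_def
  by (subst nn_integral_eq_integral) (auto simp: square_int_def power2_eq_square)

lemma square_int_nn_integral:
  assumes "f \<in> borel_measurable lborel" "(\<integral>\<^sup>+x. ennreal ((f x)\<^sup>2) \<partial>lborel) \<le> ennreal B"
  shows "square_int f"
  using assms by (auto simp: square_int_def intro!: integrableI_bounded intro: le_less_trans)

text \<open>A fast subsequence converges almost everywhere; Fatou's lemma then gives convergence in \<open>L\<^sup>2\<close>.\<close>

lemma L2_complete:
  assumes S: "\<And>n. square_int (S n)"
    and Cauchy: "\<And>e. e > 0 \<Longrightarrow> \<exists>N. \<forall>m\<ge>N. \<forall>n\<ge>N. L2_inner (\<lambda>x. S m x - S n x) (\<lambda>x. S m x - S n x) < e"
  obtains u where "square_int u" "(\<lambda>n. L2_inner (\<lambda>x. S n x - u x) (\<lambda>x. S n x - u x)) \<longlonglongrightarrow> 0"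
proof -
  define D where "D m n = L2_inner (\<lambda>x. S m x - S n x) (\<lambda>x. S m x - S n x)" for m n
  have Sd: "square_int (\<lambda>x. S m x - S n x)" for m n by (intro square_int_diff S)
  have meas[measurable]: "S n \<in> borel_measurable borel" for n using S[of n] by (simp add: square_int_def)
  have "\<forall>k. \<exists>N. \<forall>m\<ge>N. \<forall>n\<ge>N. D m n < (1 / 4) ^ k" using Cauchy unfolding D_def by simp
  then obtain N where N: "\<And>k m n. m \<ge> N k \<Longrightarrow> n \<ge> N k \<Longrightarrow> D m n < (1 / 4) ^ k" by metis
  \<comment> \<open>Summation makes \<open>r k\<close> dominate all earlier thresholds, hence
    monotone.\<close>
  define r where "r k = (\<Sum>j\<le>k. N j)" for k
  have r_ge: "r k \<ge> N i" if "i \<le> k" for i k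
    unfolding r_def using that by (intro member_le_sum) auto
  define d where "d k x = S (r (Suc k)) x - S (r k) x" for k x
  have [measurable]: "d k \<in> borel_measurable borel" for k unfolding d_def by measurable
  \<comment> \<open>The weight 2^k still leaves the summable bound 2^(-k) against 4^(-k). Almost
    everywhere finiteness then forces the increments to decay like 2^(-k/2).\<close>
  have "(\<integral>\<^sup>+x. (\<Sum>k. ennreal (2 ^ k * (d k x)\<^sup>2)) \<partial>lborel) = (\<Sum>k. \<integral>\<^sup>+x. ennreal (2 ^ k * (d k x)\<^sup>2) \<partial>lborel)"
    by (intro nn_integral_suminf) measurable
  also have "\<dots> \<le> (\<Sum>k. ennreal ((1 / 2) ^ k))"
  proof (rule suminf_le)
    fix k
    have "(\<integral>\<^sup>+x. ennreal (2 ^ k * (d k x)\<^sup>2) \<partial>lborel) = ennreal (2 ^ k) * ennreal (D (r (Suc k)) (r k))"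
      using nn_integral_square[OF Sd, of "r (Suc k)" "r k"]
      by (simp add: ennreal_mult nn_integral_cmult d_def D_def)
    also have "\<dots> = ennreal (2 ^ k * D (r (Suc k)) (r k))" by (simp add: ennreal_mult')
    also have "\<dots> \<le> ennreal (2 ^ k * (1 / 4) ^ k)"
      using N[of k "r (Suc k)" "r k"] r_ge by (intro ennreal_leI mult_left_mono) auto
    also have "2 ^ k * (1 / 4) ^ k = (1 / 2 :: real) ^ k" by (simp add: power_mult_distrib[symmetric])
    finally show "(\<integral>\<^sup>+x. ennreal (2 ^ k * (d k x)\<^sup>2) \<partial>lborel) \<le> ennreal ((1 / 2) ^ k)" .
  qed auto
  also have "\<dots> = ennreal (\<Sum>k. (1 / 2) ^ k)" by (intro suminf_ennreal2) auto
  also have "\<dots> < \<infinity>" by simp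
  finally have "AE x in lborel. (\<Sum>k. ennreal (2 ^ k * (d k x)\<^sup>2)) \<noteq> \<infinity>"
    by (intro nn_integral_noteq_infinite) (auto simp: less_top)
  then have conv: "AE x in lborel. convergent (\<lambda>k. S (r k) x)"
  proof eventually_elim
    case (elim x)
    have "summable (\<lambda>k. 2 ^ k * (d k x)\<^sup>2)"
      by (rule summable_suminf_not_top) (use elim in auto)
    then obtain B where B: "\<And>k. 2 ^ k * (d k x)\<^sup>2 \<le> B"
      using summable_imp_Bseq[of "\<lambda>k. 2 ^ k * (d k x)\<^sup>2"] by (auto simp: Bseq_def)
    have "summable (\<lambda>k. d k x)"
    proof (rule summable_comparison_test')
      show "summable (\<lambda>k. sqrt B * (1 / sqrt 2) ^ k)"
        by (intro summable_mult summable_geometric) simp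
      show "norm (d k x) \<le> sqrt B * (1 / sqrt 2) ^ k" for k
      proof -
        have "\<bar>d k x\<bar> = sqrt ((d k x)\<^sup>2)" by simp
        also have "\<dots> \<le> sqrt (B / 2 ^ k)"
          using B[of k] by (intro real_sqrt_le_mono) (simp add: field_simps)
        also have "\<dots> = sqrt B * (1 / sqrt 2) ^ k"
          by (simp add: real_sqrt_divide real_sqrt_power power_one_over)
        finally show ?thesis by simp
      qed
    qed
    then have "convergent (\<lambda>k. \<Sum>j<k. d j x)" by (simp add: summable_iff_convergent)
    then have "convergent (\<lambda>k. S (r 0) x + (\<Sum>j<k. d j x))" by (intro convergent_add convergent_const)
    moreover have "S (r 0) x + (\<Sum>j<k. d j x) = S (r k) x" for k
      unfolding d_def using sum_lessThan_telescope[of "\<lambda>j. S (r j) x" k] by simp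
    ultimately show ?case by simp
  qed
  define u where "u x = lim (\<lambda>k. S (r k) x)" for x
  have um[measurable]: "u \<in> borel_measurable borel" unfolding u_def by measurable
  have lim: "AE x in lborel. (\<lambda>k. S (r k) x) \<longlonglongrightarrow> u x"
    using conv by eventually_elim (simp add: u_def convergent_LIMSEQ_iff)
  \<comment> \<open>The bound holds for every n beyond \<open>N k\<close>, not just along the
    subsequence, and so gives convergence of the whole sequence.\<close>
  have fatou: "(\<integral>\<^sup>+x. ennreal ((S n x - u x)\<^sup>2) \<partial>lborel) \<le> ennreal ((1 / 4) ^ k)" if n: "n \<ge> N k" for n k
  proof -
    have "(\<integral>\<^sup>+x. ennreal ((S n x - u x)\<^sup>2) \<partial>lborel)
        = (\<integral>\<^sup>+x. liminf (\<lambda>j. ennreal ((S n x - S (r j) x)\<^sup>2)) \<partial>lborel)"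
    proof (rule nn_integral_cong_AE)
      show "AE x in lborel. ennreal ((S n x - u x)\<^sup>2) = liminf (\<lambda>j. ennreal ((S n x - S (r j) x)\<^sup>2))"
        using lim
      proof eventually_elim
        case (elim x)
        have "(\<lambda>j. ennreal ((S n x - S (r j) x)\<^sup>2)) \<longlonglongrightarrow> ennreal ((S n x - u x)\<^sup>2)"
          by (intro tendsto_ennrealI tendsto_intros elim)
        then show ?case by (intro lim_imp_Liminf[symmetric]) auto
      qed
    qed
    also have "\<dots> \<le> liminf (\<lambda>j. \<integral>\<^sup>+x. ennreal ((S n x - S (r j) x)\<^sup>2) \<partial>lborel)"
      by (intro nn_integral_liminf) measurable
    also have "\<dots> \<le> ennreal ((1 / 4) ^ k)"
    proof (rule order_trans[OF Liminf_le_Limsup Limsup_bounded], simp, rule eventually_sequentiallyI)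
      fix j assume "k \<le> j"
      then have "D n (r j) \<le> (1 / 4) ^ k" using N[OF n, of "r j"] r_ge by (simp add: less_imp_le)
      then show "(\<integral>\<^sup>+x. ennreal ((S n x - S (r j) x)\<^sup>2) \<partial>lborel) \<le> ennreal ((1 / 4) ^ k)"
        using nn_integral_square[OF Sd, of n "r j"] by (simp add: D_def ennreal_leI)
    qed
    finally show ?thesis .
  qed
  have du: "square_int (\<lambda>x. S n x - u x)" if "n \<ge> N k" for n k
    by (rule square_int_nn_integral[OF _ fatou[OF that]]) measurable
  have u: "square_int u"
    using square_int_diff[OF S[of "N 0"] du[of 0 "N 0"]] by simp
  have Du: "L2_inner (\<lambda>x. S n x - u x) (\<lambda>x. S n x - u x) \<le> (1 / 4) ^ k" if "n \<ge> N k" for n k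
    using fatou[OF that] nn_integral_square[OF du[OF that]] by simp
  show ?thesis
  proof (rule that[OF u], rule tendstoI)
    fix e :: real assume e: "e > 0"
    have "(\<lambda>k. (1 / 4 :: real) ^ k) \<longlonglongrightarrow> 0" by (rule LIMSEQ_power_zero) simp
    then have "\<forall>\<^sub>F k in sequentially. (1 / 4 :: real) ^ k < e" by (rule order_tendstoD(2)) (rule e)
    then obtain k where k: "(1 / 4 :: real) ^ k < e" using eventually_happens' sequentially_bot by blast
    show "\<forall>\<^sub>F n in sequentially. dist (L2_inner (\<lambda>x. S n x - u x) (\<lambda>x. S n x - u x)) 0 < e"
    proof (rule eventually_sequentiallyI)
      fix n assume "N k \<le> n"
      then have "L2_inner (\<lambda>x. S n x - u x) (\<lambda>x. S n x - u x) < e" using Du[of k n] k by simp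
      moreover have "L2_inner (\<lambda>x. S n x - u x) (\<lambda>x. S n x - u x) \<ge> 0"
        unfolding L2_inner_def by (simp flip: power2_eq_square)
      ultimately show "dist (L2_inner (\<lambda>x. S n x - u x) (\<lambda>x. S n x - u x)) 0 < e" by simp
    qed
  qed
qed

definition hermite_sum :: "(nat \<Rightarrow> real) \<Rightarrow> nat \<Rightarrow> real \<Rightarrow> real" where
  "hermite_sum c N x = (\<Sum>n<N. c n * hermite_fun n x)"

lemma square_int_hermite_partial: "square_int (hermite_sum c N)"
  using square_int_hermite_sum[of c "{..<N}"] unfolding hermite_sum_def[abs_def] .

lemma L2_norm_hermite_sum:
  assumes "finite A"
  shows "L2_inner (\<lambda>x. \<Sum>n\<in>A. c n * hermite_fun n x) (\<lambda>x. \<Sum>n\<in>A. c n * hermite_fun n x) = (\<Sum>n\<in>A. (c n)\<^sup>2)"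
  using assms by (subst L2_inner_hermite_sum)
    (auto simp: square_int_hermite_sum hermite_coeff_hermite_sum power2_eq_square)

text \<open>By orthonormality, squared distances of partial sums are differences of partial sums of
  squared coefficients, so summability gives a Cauchy sequence. The coefficients of the limit follow
  since they are continuous in the norm.\<close>

lemma hermite_series:
  assumes c: "summable (\<lambda>n. (c n)\<^sup>2)"
  obtains u where "square_int u" "\<And>n. hermite_coeff n u = c n"
    "(\<lambda>N. L2_inner (\<lambda>x. hermite_sum c N x - u x) (\<lambda>x. hermite_sum c N x - u x)) \<longlonglongrightarrow> 0"
proof -
  have diff: "L2_inner (\<lambda>x. hermite_sum c m x - hermite_sum c n x) (\<lambda>x. hermite_sum c m x - hermite_sum c n x)
      = \<bar>(\<Sum>k<m. (c k)\<^sup>2) - (\<Sum>k<n. (c k)\<^sup>2)\<bar>" for m n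
  proof -
    have *: "L2_inner (\<lambda>x. hermite_sum c m x - hermite_sum c n x) (\<lambda>x. hermite_sum c m x - hermite_sum c n x)
      = (\<Sum>k<m. (c k)\<^sup>2) - (\<Sum>k<n. (c k)\<^sup>2)" if "n \<le> m" for m n
    proof -
      have split: "(\<Sum>k<m. f k) - (\<Sum>k<n. f k) = (\<Sum>k=n..<m. f k)" for f :: "nat \<Rightarrow> real"
        using sum_diff_nat_ivl[of 0 n m f] that by (simp add: atLeast0LessThan)
      show ?thesis
        unfolding hermite_sum_def split by (rule L2_norm_hermite_sum) simp
    qed
    have sym: "L2_inner (\<lambda>x. f x - g x) (\<lambda>x. f x - g x) = L2_inner (\<lambda>x. g x - f x) (\<lambda>x. g x - f x)"
      for f g :: "real \<Rightarrow> real"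
      unfolding L2_inner_def by (intro Bochner_Integration.integral_cong) (auto simp: algebra_simps)
    have nn: "L2_inner f f \<ge> 0" for f unfolding L2_inner_def by (simp flip: power2_eq_square)
    show ?thesis
    proof (cases "n \<le> m")
      case True
      then show ?thesis using *[OF True] nn[of "\<lambda>x. hermite_sum c m x - hermite_sum c n x"] by simp
    next
      case False
      then have "m \<le> n" by simp
      then show ?thesis
        using *[of m n] nn[of "\<lambda>x. hermite_sum c n x - hermite_sum c m x"] sym[of "hermite_sum c m" "hermite_sum c n"]
        by simp
    qed
  qed
  have "Cauchy (\<lambda>n. \<Sum>k<n. (c k)\<^sup>2)"
    using c by (simp add: summable_iff_convergent convergent_Cauchy)
  then have "\<exists>N. \<forall>m\<ge>N. \<forall>n\<ge>N. L2_inner (\<lambda>x. hermite_sum c m x - hermite_sum c n x)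
      (\<lambda>x. hermite_sum c m x - hermite_sum c n x) < e" if "e > 0" for e
    unfolding diff using metric_CauchyD[of "\<lambda>n. \<Sum>k<n. (c k)\<^sup>2" e] that by (simp add: dist_real_def)
  from L2_complete[of "hermite_sum c", OF square_int_hermite_partial this]
  obtain u where u: "square_int u"
    and lim: "(\<lambda>N. L2_inner (\<lambda>x. hermite_sum c N x - u x) (\<lambda>x. hermite_sum c N x - u x)) \<longlonglongrightarrow> 0" .
  have cu: "hermite_coeff n u = c n" for n
  proof -
    have l1: "(\<lambda>N. hermite_coeff n (hermite_sum c N) - hermite_coeff n u) \<longlonglongrightarrow> 0"
    proof (rule Lim_null_comparison)
      show "\<forall>\<^sub>F N in sequentially. norm (hermite_coeff n (hermite_sum c N) - hermite_coeff n u)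
          \<le> sqrt (L2_inner (\<lambda>x. hermite_sum c N x - u x) (\<lambda>x. hermite_sum c N x - u x))"
      proof (intro always_eventually allI)
        fix N
        have "hermite_coeff n (hermite_sum c N) - hermite_coeff n u = L2_inner (hermite_fun n) (\<lambda>x. hermite_sum c N x - u x)"
          using L2_inner_lin[OF square_int_hermite_partial u square_int_hermite_fun, of n 1 c N "-1"]
          by (simp add: hermite_coeff_def)
        moreover have "(L2_inner (hermite_fun n) (\<lambda>x. hermite_sum c N x - u x))\<^sup>2
            \<le> L2_inner (\<lambda>x. hermite_sum c N x - u x) (\<lambda>x. hermite_sum c N x - u x)"
          using L2_Cauchy_Schwarz[OF square_int_hermite_fun[of n] square_int_diff[OF square_int_hermite_partial[of c N] u]]
          by (simp add: hermite_orthonormal)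
        ultimately show "norm (hermite_coeff n (hermite_sum c N) - hermite_coeff n u)
          \<le> sqrt (L2_inner (\<lambda>x. hermite_sum c N x - u x) (\<lambda>x. hermite_sum c N x - u x))"
          by (simp add: real_le_rsqrt)
      qed
      show "(\<lambda>N. sqrt (L2_inner (\<lambda>x. hermite_sum c N x - u x) (\<lambda>x. hermite_sum c N x - u x))) \<longlonglongrightarrow> 0"
        using tendsto_real_sqrt[OF lim] by simp
    qed
    have l2: "(\<lambda>N. hermite_coeff n (hermite_sum c N) - hermite_coeff n u) \<longlonglongrightarrow> c n - hermite_coeff n u"
    proof (rule tendsto_eventually, rule eventually_sequentiallyI)
      fix N assume "Suc n \<le> N"
      then show "hermite_coeff n (hermite_sum c N) - hermite_coeff n u = c n - hermite_coeff n u"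
        unfolding hermite_sum_def[abs_def] by (simp add: hermite_coeff_hermite_sum)
    qed
    show ?thesis using LIMSEQ_unique[OF l2 l1] by simp
  qed
  show ?thesis by (rule that[OF u cu lim])
qed

lemma L2_dist_hermite_sum:
  assumes u: "square_int u"
  defines "c \<equiv> \<lambda>n. hermite_coeff n u"
  shows "L2_inner (\<lambda>x. hermite_sum c N x - u x) (\<lambda>x. hermite_sum c N x - u x) = L2_inner u u - (\<Sum>n<N. (c n)\<^sup>2)"
proof -
  let ?S = "hermite_sum c N"
  let ?d = "\<lambda>x. 1 * ?S x + (- 1) * u x"
  have d: "square_int ?d" by (intro square_int_lin square_int_hermite_partial u)
  have SS: "L2_inner ?S ?S = (\<Sum>n<N. (c n)\<^sup>2)"
    unfolding hermite_sum_def[abs_def] by (simp add: L2_norm_hermite_sum)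
  have Su: "L2_inner ?S u = (\<Sum>n<N. (c n)\<^sup>2)"
    unfolding hermite_sum_def[abs_def] by (simp add: L2_inner_hermite_sum u c_def power2_eq_square)
  have "L2_inner ?d ?d = 1 * L2_inner ?d ?S + (- 1) * L2_inner ?d u"
    by (rule L2_inner_lin[OF square_int_hermite_partial u d])
  also have "L2_inner ?d ?S = 1 * L2_inner ?S ?S + (- 1) * L2_inner ?S u"
    unfolding L2_inner_commute[of ?d] by (rule L2_inner_lin[OF square_int_hermite_partial u square_int_hermite_partial])
  also have "L2_inner ?d u = 1 * L2_inner u ?S + (- 1) * L2_inner u u"
    unfolding L2_inner_commute[of ?d] by (rule L2_inner_lin[OF square_int_hermite_partial u u])
  finally show ?thesis using SS Su by (simp add: L2_inner_commute[of u ?S])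
qed

text \<open>Bessel's inequality makes the coefficients square summable, their series has a limit
  with the same coefficients, and completeness identifies this limit with u. The distance to the
  partial sums therefore tends to 0.\<close>

lemma hermite_Parseval:
  assumes u: "square_int u"
  shows "(\<lambda>n. (hermite_coeff n u)\<^sup>2) sums L2_inner u u"
proof -
  define c where "c = (\<lambda>n. hermite_coeff n u)"
  have dist: "L2_inner (\<lambda>x. hermite_sum c N x - u x) (\<lambda>x. hermite_sum c N x - u x)
      = L2_inner u u - (\<Sum>n<N. (c n)\<^sup>2)" for N
    unfolding c_def by (rule L2_dist_hermite_sum[OF u])
  have "(\<Sum>n<N. (c n)\<^sup>2) \<le> L2_inner u u" for N
  proof -
    have "L2_inner f f \<ge> 0" for f unfolding L2_inner_def by (simp flip: power2_eq_square)
    from this[of "\<lambda>x. hermite_sum c N x - u x"] show ?thesis unfolding dist by simp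
  qed
  then have sm: "summable (\<lambda>n. (c n)\<^sup>2)" by (intro summableI_nonneg_bounded) auto
  obtain v where v: "square_int v" "\<And>n. hermite_coeff n v = c n"
    and lim: "(\<lambda>N. L2_inner (\<lambda>x. hermite_sum c N x - v x) (\<lambda>x. hermite_sum c N x - v x)) \<longlonglongrightarrow> 0"
    by (rule hermite_series[OF sm]) (rule that)
  have ae: "AE x in lborel. u x = v x"
    by (rule hermite_coeff_eq_imp_AE_eq) (auto simp: gauss_integrable_square_int u v c_def)
  have "L2_inner (\<lambda>x. hermite_sum c N x - v x) (\<lambda>x. hermite_sum c N x - v x)
      = L2_inner (\<lambda>x. hermite_sum c N x - u x) (\<lambda>x. hermite_sum c N x - u x)" for N
  proof -
    have [measurable]: "u \<in> borel_measurable borel" "v \<in> borel_measurable borel"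
      "hermite_sum c N \<in> borel_measurable borel"
      using u v square_int_hermite_partial[of c N] by (auto simp: square_int_def)
    show ?thesis unfolding L2_inner_def
      by (rule integral_cong_AE) (measurable, use ae in \<open>auto elim: eventually_mono\<close>)
  qed
  then have "(\<lambda>N. L2_inner u u - (\<Sum>n<N. (c n)\<^sup>2)) \<longlonglongrightarrow> 0"
    using lim by (simp only: dist)
  then have "(\<lambda>N. L2_inner u u - (L2_inner u u - (\<Sum>n<N. (c n)\<^sup>2))) \<longlonglongrightarrow> L2_inner u u - 0"
    by (intro tendsto_diff tendsto_const)
  then show ?thesis by (simp add: sums_def c_def)
qed

lemma hermite_Parseval_inner:
  assumes u: "square_int u" and v: "square_int v"
  shows "(\<lambda>n. hermite_coeff n u * hermite_coeff n v) sums L2_inner u v"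
proof -
  have c: "hermite_coeff n (\<lambda>x. 1 * u x + s * v x) = hermite_coeff n u + s * hermite_coeff n v" for n s
    unfolding hermite_coeff_def using L2_inner_lin[OF u v square_int_hermite_fun, of n 1 s] by simp
  have i: "L2_inner (\<lambda>x. 1 * u x + s * v x) (\<lambda>x. 1 * u x + s * v x)
      = L2_inner u u + 2 * s * L2_inner u v + s\<^sup>2 * L2_inner v v" for s
  proof -
    let ?k = "\<lambda>x. 1 * u x + s * v x"
    have "L2_inner ?k ?k = 1 * L2_inner ?k u + s * L2_inner ?k v"
      by (rule L2_inner_lin[OF u v square_int_lin[OF u v]])
    also have "L2_inner ?k u = 1 * L2_inner u u + s * L2_inner u v"
      unfolding L2_inner_commute[of ?k] by (rule L2_inner_lin[OF u v u])
    also have "L2_inner ?k v = 1 * L2_inner v u + s * L2_inner v v"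
      unfolding L2_inner_commute[of ?k] by (rule L2_inner_lin[OF u v v])
    finally show ?thesis using L2_inner_commute[of v u] by (simp add: power2_eq_square algebra_simps)
  qed
  have p: "(\<lambda>n. (hermite_coeff n u + s * hermite_coeff n v)\<^sup>2)
      sums (L2_inner u u + 2 * s * L2_inner u v + s\<^sup>2 * L2_inner v v)" for s
    using hermite_Parseval[OF square_int_lin[OF u v, of 1 s]] unfolding c i .
  have "(\<lambda>n. ((hermite_coeff n u + 1 * hermite_coeff n v)\<^sup>2 - (hermite_coeff n u + (- 1) * hermite_coeff n v)\<^sup>2) / 4)
      sums (((L2_inner u u + 2 * 1 * L2_inner u v + 1\<^sup>2 * L2_inner v v)
        - (L2_inner u u + 2 * (- 1) * L2_inner u v + (- 1)\<^sup>2 * L2_inner v v)) / 4)"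
    by (intro sums_divide sums_diff p)
  then show ?thesis by (simp add: power2_eq_square algebra_simps)
qed

section \<open>Hermite coefficients of elements of the energy space\<close>

text \<open>\<open>V\<close> is a nonzero multiple of the ground state, so the constraint in
  \<open>X_c\<close> is c_0 = 0.\<close>

lemma V_inner_eq_0_iff: "L2_inner V u = 0 \<longleftrightarrow> hermite_coeff 0 u = 0"
proof -
  have "V x = exp (1 / 2) * sqrt (sqrt (2 * pi)) * hermite_fun 0 x" for x
  proof -
    have "exp (1 / 2 - x\<^sup>2 / 4) = exp (1 / 2) * exp (- (x\<^sup>2 / 4))" by (simp flip: exp_add)
    then show ?thesis unfolding V_def hermite_fun_def by (simp only:) simp
  qed
  then have "L2_inner V u = (\<integral>x. (exp (1 / 2) * sqrt (sqrt (2 * pi))) * (hermite_fun 0 x * u x) \<partial>lborel)"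
    by (simp add: L2_inner_def mult.assoc)
  then show ?thesis by (simp add: hermite_coeff_def L2_inner_def)
qed

lemma in_L2_1_iff: "in_L2_1 u \<longleftrightarrow> square_int u \<and> square_int (\<lambda>x. x * u x)"
proof -
  have "integrable lborel (\<lambda>x. (1 + x\<^sup>2) * (u x)\<^sup>2) \<longleftrightarrow> integrable lborel (\<lambda>x. (x * u x)\<^sup>2)" if u: "square_int u"
  proof
    have eq: "(1 + x\<^sup>2) * (u x)\<^sup>2 = (u x)\<^sup>2 + (x * u x)\<^sup>2" for x
      by (simp add: power_mult_distrib distrib_right)
    have ui: "integrable lborel (\<lambda>x. (u x)\<^sup>2)" using u by (simp add: square_int_def)
    show "integrable lborel (\<lambda>x. (1 + x\<^sup>2) * (u x)\<^sup>2)" if "integrable lborel (\<lambda>x. (x * u x)\<^sup>2)"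
      unfolding eq using ui that by (rule Bochner_Integration.integrable_add)
    assume "integrable lborel (\<lambda>x. (1 + x\<^sup>2) * (u x)\<^sup>2)"
    from Bochner_Integration.integrable_diff[OF this ui]
    show "integrable lborel (\<lambda>x. (x * u x)\<^sup>2)" by (simp add: eq)
  qed
  moreover have "(\<lambda>x. x * u x) \<in> borel_measurable lborel" if "square_int u"
  proof -
    have [measurable]: "u \<in> borel_measurable borel" using that by (simp add: square_int_def)
    show ?thesis by measurable
  qed
  ultimately show ?thesis by (auto simp: in_L2_1_def square_int_def)
qed

lemma weak_deriv_X_c:
  assumes "u \<in> X_c"
  shows "square_int u" "square_int (\<lambda>x. x * u x)" "square_int (weak_deriv u)" "is_weak_deriv u (weak_deriv u)"
    "hermite_coeff 0 u = 0"
proof -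
  have "\<exists>g. square_int g \<and> is_weak_deriv u g" using assms by (auto simp: X_c_def in_H1_def)
  from someI_ex[OF this] show "square_int (weak_deriv u)" "is_weak_deriv u (weak_deriv u)"
    by (auto simp: weak_deriv_def)
  show "square_int u" "square_int (\<lambda>x. x * u x)" "hermite_coeff 0 u = 0"
    using assms by (auto simp: X_c_def in_L2_1_iff V_inner_eq_0_iff)
qed

text \<open>Parseval's identity is applied to \<open>x u / 2 \<plusminus> u'\<close>, on which the ladder operators act by shifts.\<close>

lemma E_c_sums:
  assumes u: "u \<in> X_c"
  shows "(\<lambda>n. (real n - 1) * (hermite_coeff n u)\<^sup>2) sums E_c u"
proof -
  define c where "c n = hermite_coeff n u" for n
  define g where "g = weak_deriv u"
  note U = weak_deriv_X_c[OF u]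
  define p where "p = (\<lambda>x. 1 / 2 * (x * u x) + 1 * g x)"
  define q where "q = (\<lambda>x. 1 / 2 * (x * u x) + (- 1) * g x)"
  have pq: "square_int p" "square_int q"
    unfolding p_def q_def g_def by (intro square_int_lin U)+
  note cf = weak_deriv_coeffs[OF U(1-4), folded g_def, folded p_def q_def c_def]
  have "(\<lambda>n. (sqrt (n + 1) * c (Suc n))\<^sup>2) sums L2_inner p p"
    using hermite_Parseval[OF pq(1)] by (simp only: cf)
  then have "(\<lambda>n. real (Suc n) * (c (Suc n))\<^sup>2) sums L2_inner p p"
    by (simp add: power_mult_distrib add.commute)
  from sums_Suc[of "\<lambda>n. real n * (c n)\<^sup>2", OF this] have 1: "(\<lambda>n. real n * (c n)\<^sup>2) sums L2_inner p p" by simp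
  have "(\<lambda>n. (sqrt n * c (n - 1))\<^sup>2) sums L2_inner q q"
    using hermite_Parseval[OF pq(2)] by (simp only: cf)
  then have "(\<lambda>n. real n * (c (n - 1))\<^sup>2) sums L2_inner q q"
    by (simp add: power_mult_distrib)
  then have 2: "(\<lambda>n. real (Suc n) * (c n)\<^sup>2) sums L2_inner q q"
    using sums_Suc_iff[of "\<lambda>n. real n * (c (n - 1))\<^sup>2" "L2_inner q q"] by simp
  have 3: "(\<lambda>n. (c n)\<^sup>2) sums L2_inner u u" unfolding c_def by (rule hermite_Parseval[OF U(1)])
  \<comment> \<open>In p^2 + q^2 the cross terms x u u' cancel, so half of it is the kinetic plus
    potential density. On coefficients this is (n + (n + 1)) / 2 - 3 / 2 = n - 1.\<close>
  have "(\<lambda>n. (real n * (c n)\<^sup>2 + real (Suc n) * (c n)\<^sup>2) / 2 - 3 / 2 * (c n)\<^sup>2)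
      sums ((L2_inner p p + L2_inner q q) / 2 - 3 / 2 * L2_inner u u)"
    by (intro sums_diff sums_divide sums_add sums_mult 1 2 3)
  moreover have "(real n * (c n)\<^sup>2 + real (Suc n) * (c n)\<^sup>2) / 2 - 3 / 2 * (c n)\<^sup>2 = (real n - 1) * (c n)\<^sup>2" for n
    by (simp add: field_simps)
  moreover have "E_c u = (L2_inner p p + L2_inner q q) / 2 - 3 / 2 * L2_inner u u"
  proof -
    have i: "integrable lborel (\<lambda>x. p x * p x)" "integrable lborel (\<lambda>x. q x * q x)" "integrable lborel (\<lambda>x. u x * u x)"
      by (intro square_int_integrable_mult pq U)+
    have "E_c u = (\<integral>x. (p x * p x + q x * q x) / 2 - 3 / 2 * (u x * u x) \<partial>lborel)"
      unfolding E_c_def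
      by (intro Bochner_Integration.integral_cong)
        (auto simp: p_def q_def g_def power2_eq_square field_simps)
    also have "\<dots> = (L2_inner p p + L2_inner q q) / 2 - 3 / 2 * L2_inner u u"
      unfolding L2_inner_def using i by simp
    finally show ?thesis .
  qed
  ultimately show ?thesis by (simp add: c_def)
qed

text \<open>The only negative eigenvalue sits at index 0, excluded by c_0 = 0. Shifting by one turns
  n - 1 into n, so the energy is the squared norm of the sequence a_n.\<close>

lemma E_c_sums_jacobi:
  assumes u: "u \<in> X_c"
  shows "(\<lambda>n. (sqrt n * hermite_coeff (n + 1) u)\<^sup>2) sums E_c u"
proof -
  have "(\<lambda>n. (real (Suc n) - 1) * (hermite_coeff (Suc n) u)\<^sup>2) sums E_c u"
    using E_c_sums[OF u] weak_deriv_X_c(5)[OF u]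
    by (subst sums_Suc_iff) simp
  then show ?thesis by (simp add: power_mult_distrib)
qed

section \<open>Reconstruction of elements of the energy space from coefficients\<close>

lemma square_int_compact_support:
  assumes f: "smooth f" and R: "\<And>x. \<bar>x\<bar> > R \<Longrightarrow> f x = 0"
  shows "square_int f"
proof -
  obtain C where C: "\<And>x. \<bar>f x\<bar> \<le> C" using smooth_compact_support_bounded[OF f R] by blast
  have m: "f \<in> borel_measurable lborel"
    using borel_measurable_continuous_onI[OF smooth_continuous[OF f]] by simp
  have "integrable lborel (\<lambda>x. (f x)\<^sup>2)"
  proof (rule Bochner_Integration.integrable_bound)
    show "integrable lborel (\<lambda>x. C\<^sup>2 * indicator {-R..R} x)"
      by (intro Bochner_Integration.integrable_mult_right integrable_real_indicator) (auto simp: emeasure_lborel_Icc_eq)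
    show "(\<lambda>x. (f x)\<^sup>2) \<in> borel_measurable lborel" using m by measurable
    show "AE x in lborel. norm ((f x)\<^sup>2) \<le> norm (C\<^sup>2 * indicator {-R..R} x :: real)"
    proof (rule AE_I2)
      fix x
      have "(f x)\<^sup>2 \<le> C\<^sup>2" using C[of x] by (simp add: abs_le_square_iff[symmetric])
      then show "norm ((f x)\<^sup>2) \<le> norm (C\<^sup>2 * indicator {-R..R} x :: real)"
        using R[of x] by (auto simp: indicator_def)
    qed
  qed
  then show ?thesis using m by (simp add: square_int_def)
qed

lemma test_function_coeffs:
  assumes "test_function \<phi>"
  shows "square_int \<phi>" "square_int (deriv \<phi>)"
    "hermite_coeff n (deriv \<phi>) = (sqrt (n + 1) * hermite_coeff (Suc n) \<phi> - sqrt n * hermite_coeff (n - 1) \<phi>) / 2"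
proof -
  have s: "smooth \<phi>" by (rule test_function_smooth[OF assms])
  obtain R where R: "R > 0" "\<And>x. \<bar>x\<bar> \<ge> R \<Longrightarrow> \<phi> x = 0" using test_function_support[OF assms] by blast
  show sq: "square_int \<phi>" by (rule square_int_compact_support[OF s, of R]) (simp add: R(2))
  have dz: "deriv \<phi> x = 0" if "\<bar>x\<bar> > R" for x
    by (rule deriv_zero_outside[of R \<phi>]) (use that R(2) in auto)
  show sqd: "square_int (deriv \<phi>)"
    by (rule square_int_compact_support[OF smooth_deriv[OF s], of R]) (rule dz)
  let ?h = "hermite_fun n"
  have dh: "square_int (deriv ?h)"
    using square_int_lin[OF square_int_hermite_fun[of "n - 1"] square_int_hermite_fun[of "Suc n"],
        of "sqrt n / 2" "- sqrt (n + 1) / 2"]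
    unfolding deriv_hermite_fun by (simp add: field_simps)
  have "(\<integral>x. deriv ?h x * \<phi> x + ?h x * deriv \<phi> x \<partial>lborel) = 0"
  proof (rule integral_compact_deriv_zero[of "\<lambda>x. ?h x * \<phi> x" _ R])
    show "((\<lambda>x. ?h x * \<phi> x) has_real_derivative deriv ?h x * \<phi> x + ?h x * deriv \<phi> x) (at x)" for x
      using DERIV_mult[OF smooth_has_deriv[OF smooth_hermite_fun[of n], of x] smooth_has_deriv[OF s, of x]]
      by (simp add: mult.commute)
    show "continuous_on UNIV (\<lambda>x. deriv ?h x * \<phi> x + ?h x * deriv \<phi> x)"
      by (intro continuous_intros smooth_continuous smooth_deriv smooth_hermite_fun s)
  qed (use R in auto)
  then have "hermite_coeff n (deriv \<phi>) = - L2_inner \<phi> (deriv ?h)"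
    by (simp add: hermite_coeff_def L2_inner_def square_int_integrable_mult dh sq sqd square_int_hermite_fun mult.commute)
  also have "deriv ?h = (\<lambda>x. (sqrt n / 2) * hermite_fun (n - 1) x + (- sqrt (n + 1) / 2) * hermite_fun (Suc n) x)"
    unfolding deriv_hermite_fun by (auto simp: fun_eq_iff field_simps)
  also have "L2_inner \<phi> \<dots> = (sqrt n / 2) * hermite_coeff (n - 1) \<phi> + (- sqrt (n + 1) / 2) * hermite_coeff (Suc n) \<phi>"
    unfolding hermite_coeff_def L2_inner_commute[of _ \<phi>]
    by (rule L2_inner_lin[OF square_int_hermite_fun square_int_hermite_fun sq])
  finally show "hermite_coeff n (deriv \<phi>) = (sqrt (n + 1) * hermite_coeff (Suc n) \<phi> - sqrt n * hermite_coeff (n - 1) \<phi>) / 2"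
    by (simp add: field_simps)
qed

lemma Riesz_Fischer:
  assumes "summable (\<lambda>n. (c n)\<^sup>2)"
  shows "\<exists>u. square_int u \<and> (\<forall>n. hermite_coeff n u = c n)"
  by (rule hermite_series[OF assms]) auto

text \<open>Candidates p and q for x u / 2 + u' and x u / 2 - u' are built from the shifted
  coefficients, both square summable by hypothesis. Then x u = p + q and u' = (p - q) / 2 are
  recovered, the former by completeness and the latter by Parseval against test functions.\<close>

lemma X_c_of_coeffs:
  assumes c0: "c 0 = 0" and sm: "summable (\<lambda>n. real n * (c n)\<^sup>2)"
  obtains u where "u \<in> X_c" "\<And>n. hermite_coeff n u = c n"
proof -
  \<comment> \<open>The factor n dominates 1 except at n = 0, where the coefficient is 0.\<close>
  have sc: "summable (\<lambda>n. (c n)\<^sup>2)"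
  proof (rule summable_comparison_test'[OF sm])
    show "norm ((c n)\<^sup>2) \<le> real n * (c n)\<^sup>2" for n
      using c0 by (cases n) (auto simp: mult_le_cancel_right1)
  qed
  have "summable (\<lambda>n. (sqrt (n + 1) * c (n + 1))\<^sup>2)"
    using summable_Suc_iff[THEN iffD2, OF sm] by (simp add: power_mult_distrib add.commute)
  from Riesz_Fischer[OF this] obtain p where p: "square_int p"
    and pc: "\<And>n. hermite_coeff n p = sqrt (n + 1) * c (n + 1)" by blast
  have "summable (\<lambda>n. (sqrt (Suc n) * c (Suc n - 1))\<^sup>2)"
    using summable_add[OF sm sc] by (simp add: power_mult_distrib distrib_right add.commute)
  then have "summable (\<lambda>n. (sqrt n * c (n - 1))\<^sup>2)"
    using summable_Suc_iff[of "\<lambda>n. (sqrt n * c (n - 1))\<^sup>2"] by simp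
  from Riesz_Fischer[OF this] obtain q where q: "square_int q"
    and qc: "\<And>n. hermite_coeff n q = sqrt n * c (n - 1)" by blast
  from Riesz_Fischer[OF sc] obtain u where u: "square_int u" and uc: "\<And>n. hermite_coeff n u = c n"
    by blast
  have um[measurable]: "u \<in> borel_measurable borel" using u by (simp add: square_int_def)
  define r where "r = (\<lambda>x. 1 * p x + 1 * q x)"
  have r: "square_int r" unfolding r_def by (intro square_int_lin p q)
  have rm[measurable]: "r \<in> borel_measurable borel" using r by (simp add: square_int_def)
  have ae: "AE x in lborel. r x = x * u x"
  proof (rule hermite_coeff_eq_imp_AE_eq)
    show "gauss_integrable r" by (rule gauss_integrable_square_int[OF r])
    show "gauss_integrable (\<lambda>x. x * u x)" by (intro gauss_integrable_mult_x gauss_integrable_square_int u)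
    fix n
    have "hermite_coeff n (\<lambda>x. x * u x) = L2_inner u (\<lambda>x. x * hermite_fun n x)"
      by (simp add: hermite_coeff_def L2_inner_def mult_ac)
    also have "\<dots> = sqrt (n + 1) * hermite_coeff (Suc n) u + sqrt n * hermite_coeff (n - 1) u"
      unfolding hermite_fun_three_term hermite_coeff_def L2_inner_commute[of _ u]
      by (rule L2_inner_lin[OF square_int_hermite_fun square_int_hermite_fun u])
    also have "\<dots> = hermite_coeff n r"
      unfolding r_def hermite_coeff_def[of n] L2_inner_lin[OF p q square_int_hermite_fun]
      by (simp add: hermite_coeff_def[symmetric] pc qc uc)
    finally show "hermite_coeff n r = hermite_coeff n (\<lambda>x. x * u x)" by simp
  qed
  have xu: "square_int (\<lambda>x. x * u x)"
  proof -
    have "integrable lborel (\<lambda>x. (r x)\<^sup>2)" using r by (simp add: square_int_def)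
    then have "integrable lborel (\<lambda>x. (x * u x)\<^sup>2)"
      by (rule integrable_cong_AE_imp) (use ae in \<open>auto elim: eventually_mono\<close>)
    then show ?thesis by (simp add: square_int_def)
  qed
  define g where "g = (\<lambda>x. (1 / 2) * p x + (- 1 / 2) * q x)"
  have g: "square_int g" unfolding g_def by (intro square_int_lin p q)
  have "is_weak_deriv u g"
    unfolding is_weak_deriv_def
  proof (intro allI impI)
    fix \<phi> assume "test_function \<phi>"
    note T = test_function_coeffs[OF this]
    define f where "f n = hermite_coeff n \<phi>" for n
    have "(\<lambda>n. (sqrt (n + 1) * c (n + 1)) * f n) sums L2_inner p \<phi>"
      using hermite_Parseval_inner[OF p T(1)] by (simp only: pc f_def)
    then have "(\<lambda>n. sqrt (Suc n) * c (Suc n) * f (Suc n - 1)) sums L2_inner p \<phi>"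
      by (simp add: add.commute)
    from sums_Suc[of "\<lambda>n. sqrt n * c n * f (n - 1)", OF this]
    have 1: "(\<lambda>n. sqrt n * c n * f (n - 1)) sums L2_inner p \<phi>" by simp
    have "(\<lambda>n. sqrt n * c (n - 1) * f n) sums L2_inner q \<phi>"
      using hermite_Parseval_inner[OF q T(1)] by (simp only: qc f_def)
    then have 2: "(\<lambda>n. sqrt (Suc n) * c n * f (Suc n)) sums L2_inner q \<phi>"
      using sums_Suc_iff[of "\<lambda>n. sqrt n * c (n - 1) * f n" "L2_inner q \<phi>"] by simp
    have s1: "(\<lambda>n. (sqrt (Suc n) * c n * f (Suc n) - sqrt n * c n * f (n - 1)) / 2)
        sums ((L2_inner q \<phi> - L2_inner p \<phi>) / 2)"
      by (intro sums_divide sums_diff 1 2)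
    have s2: "(\<lambda>n. c n * ((sqrt (n + 1) * f (Suc n) - sqrt n * f (n - 1)) / 2)) sums L2_inner u (deriv \<phi>)"
      using hermite_Parseval_inner[OF u T(2)] by (simp only: uc f_def T(3))
    have "c n * ((sqrt (n + 1) * f (Suc n) - sqrt n * f (n - 1)) / 2)
        = (sqrt (Suc n) * c n * f (Suc n) - sqrt n * c n * f (n - 1)) / 2" for n
      by (simp add: algebra_simps)
    from s2[unfolded this] s1 have "L2_inner u (deriv \<phi>) = (L2_inner q \<phi> - L2_inner p \<phi>) / 2"
      by (rule sums_unique2)
    moreover have "L2_inner g \<phi> = (1 / 2) * L2_inner p \<phi> + (- 1 / 2) * L2_inner q \<phi>"
      unfolding g_def L2_inner_commute[of _ \<phi>] by (rule L2_inner_lin[OF p q T(1)])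
    ultimately show "L2_inner u (deriv \<phi>) = - L2_inner g \<phi>" by (simp add: field_simps)
  qed
  then have "in_H1 u" using u g by (auto simp: in_H1_def)
  moreover have "in_L2_1 u" using u xu by (simp add: in_L2_1_iff)
  moreover have "L2_inner V u = 0" by (simp add: V_inner_eq_0_iff uc c0)
  ultimately have "u \<in> X_c" by (simp add: X_c_def)
  then show ?thesis using uc by (rule that)
qed

section \<open>Solutions of the linearized equation\<close>

lemma jacobi_coords_rotate:
  "jacobi_coords w = rotate_coords (\<lambda>n. sqrt n * hermite_coeff (n + 1) w)"
  by (simp add: fun_eq_iff jacobi_coords_def rotate_coords_def)

lemma skew_evolution_cong:
  assumes "skew_evolution T x a" "\<And>t. t \<in> {0..T} \<Longrightarrow> a t = b t"
  shows "skew_evolution T x b"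
proof -
  have int: "integral {0..t} (\<lambda>s. b s n) = integral {0..t} (\<lambda>s. a s n)" if "t \<in> {0..T}" for t n
    using that assms(2) by (intro Henstock_Kurzweil_Integration.integral_cong) auto
  show ?thesis
    unfolding skew_evolution_def
  proof (intro conjI allI ballI impI)
    fix n
    have "continuous_on {0..T} (\<lambda>s. a s n)" using assms(1) unfolding skew_evolution_def by simp
    then show "continuous_on {0..T} (\<lambda>s. b s n)"
      by (rule continuous_on_eq) (simp add: assms(2))
  next
    fix t and n :: nat assume t: "t \<in> {0..T}" "n \<ge> 1"
    have "a t n = x n + skew (\<lambda>n. integral {0..t} (\<lambda>s. a s n)) n / 2"
      using assms(1) t unfolding skew_evolution_def by simp
    then show "b t n = x n + skew (\<lambda>n. integral {0..t} (\<lambda>s. b s n)) n / 2"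
      by (simp only: int[OF t(1)] assms(2)[OF t(1), symmetric])
  next
    fix t assume t: "t \<in> {0..T}"
    then have "(\<lambda>k. null_flux k * integral {0..t} (\<lambda>s. a s (2 * k))) \<longlonglongrightarrow> 0"
      using assms(1) unfolding skew_evolution_def by simp
    then show "(\<lambda>k. null_flux k * integral {0..t} (\<lambda>s. b s (2 * k))) \<longlonglongrightarrow> 0"
      by (simp only: int[OF t])
  qed
qed

section \<open>Differentiability of the components in time\<close>

lemma has_derivative_halfline:
  assumes "(f has_real_derivative D) (at t within {0..t + 1})"
  shows "(f has_real_derivative D) (at t within {0..})"
proof -
  have "at t within {0..t + 1} = at t within {0..}"
    by (rule at_within_nhd[of t "{..<t + 1}"]) auto
  then show ?thesis using assms by simp
qed

lemma skew_evolution_component_integral: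
  assumes a: "\<And>T. skew_evolution T x a" and t: "t \<ge> 0"
  shows "((\<lambda>s. integral {0..s} (\<lambda>r. a r n)) has_real_derivative a t n) (at t within {0..})"
proof (rule has_derivative_halfline, rule integral_has_real_derivative)
  show "continuous_on {0..t + 1} (\<lambda>s. a s n)" using a[of "t + 1"] unfolding skew_evolution_def by simp
qed (use t in auto)

lemma skew_evolution_deriv:
  assumes a: "\<And>T. skew_evolution T x a" and t: "t \<ge> 0" and n: "n \<ge> 1"
  shows "((\<lambda>s. a s n) has_real_derivative skew (a t) n / 2) (at t within {0..})"
proof (rule has_field_derivative_transform_within[of "\<lambda>s. x n + skew (\<lambda>n. integral {0..s} (\<lambda>r. a r n)) n / 2" _ _ _ 1])
  show "((\<lambda>s. x n + skew (\<lambda>n. integral {0..s} (\<lambda>r. a r n)) n / 2) has_real_derivative skew (a t) n / 2) (at t within {0..})"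
    unfolding skew_def
    by (auto intro!: derivative_eq_intros skew_evolution_component_integral[OF a t])
  show "x n + skew (\<lambda>n. integral {0..s} (\<lambda>r. a r n)) n / 2 = a s n" if "s \<in> {0..}" "dist s t < 1" for s
    using a[of s] that n unfolding skew_evolution_def by auto
qed (use t in auto)

text \<open>The equation for a_m is the lattice equation for c_n with n = m + 1, multiplied by sqrt
  m.\<close>

lemma skew_lattice:
  fixes c :: "nat \<Rightarrow> real"
  assumes "m \<ge> 1"
  shows "skew (\<lambda>n. sqrt n * c (n + 1)) m
    = sqrt m * (real (m + 1) * sqrt (m + 2) * c (m + 2) - (real m - 1) * sqrt (m + 1) * c m)"
proof -
  have 1: "jacobi_weight m * (sqrt (m + 1) * c (m + 1 + 1)) = sqrt m * (real (m + 1) * sqrt (m + 2) * c (m + 2))"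
  proof -
    have "jacobi_weight m = sqrt m * sqrt (m + 1) * sqrt (m + 2)"
      by (simp only: jacobi_weight_def real_sqrt_mult)
    moreover have "sqrt (m + 1) * sqrt (m + 1) = real (m + 1)" by (rule real_sqrt_mult_self[THEN trans]) simp
    ultimately show ?thesis by (simp add: mult_ac)
  qed
  have 2: "jacobi_weight (m - 1) * (sqrt (m - 1) * c (m - 1 + 1)) = sqrt m * ((real m - 1) * sqrt (m + 1) * c m)"
  proof -
    have m: "m - 1 + 1 = m" "m - 1 + 2 = m + 1" using assms by simp_all
    have "jacobi_weight (m - 1) = sqrt (m - 1) * sqrt m * sqrt (m + 1)"
      by (simp only: jacobi_weight_def real_sqrt_mult m)
    moreover have "sqrt (m - 1) * sqrt (m - 1) = real m - 1"
      using assms by (simp add: of_nat_diff)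
    ultimately show ?thesis unfolding m by (simp only: mult_ac) (simp add: mult.left_commute)
  qed
  show ?thesis unfolding skew_def 1 2 by (simp add: right_diff_distrib add_ac)
qed

lemma X_c_coeff_0: "u \<in> X_c \<Longrightarrow> hermite_coeff 0 u = 0"
  by (rule weak_deriv_X_c(5))

lemma solution_coeff_deriv:
  assumes "linearized_logKdV_solution u0 u" "t \<ge> 0"
  shows "((\<lambda>s. hermite_coeff n (u s)) has_real_derivative
    (real n * sqrt (n + 1) * hermite_coeff (n + 1) (u t) - (real n - 2) * sqrt n * hermite_coeff (n - 1) (u t)) / 2)
    (at t within {0..})"
proof -
  have sq: "square_int (u t)" using assms weak_deriv_X_c(1) unfolding linearized_logKdV_solution_def by blast
  show ?thesis
    using assms unfolding projected_equation_lattice[OF sq, symmetric] linearized_logKdV_solution_def by blast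
qed

text \<open>The Jacobi evolution fixes the coefficients from index 2 on, and index 0 is fixed by the
  constraint. Index 1 is invisible to a_n, but its derivative depends only on the coefficients at 2
  and 0, already known to agree.\<close>

lemma solution_unique:
  assumes u: "linearized_logKdV_solution u0 u" and w: "linearized_logKdV_solution u0 w" and t: "t \<ge> 0"
  shows "AE x in lborel. w t x = u t x"
proof -
  define a where "a v t n = sqrt n * hermite_coeff (n + 1) (v t)" for v :: "real \<Rightarrow> real \<Rightarrow> real" and t and n :: nat
  have Xc: "u s \<in> X_c" "w s \<in> X_c" if "s \<ge> 0" for s
    using u w that unfolding linearized_logKdV_solution_def by auto
  have ini: "hermite_coeff n (w 0) = hermite_coeff n (u 0)" for n
  proof -
    have "AE x in lborel. u 0 x = u0 x" "AE x in lborel. w 0 x = u0 x"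
      using u w unfolding linearized_logKdV_solution_def by auto
    then have "AE x in lborel. w 0 x = u 0 x" by eventually_elim simp
    then show ?thesis
      unfolding hermite_coeff_def
      by (rule L2_inner_cong_AE)
        (use weak_deriv_X_c(1)[OF Xc(1), of 0] weak_deriv_X_c(1)[OF Xc(2), of 0] square_int_hermite_fun[of n]
          in \<open>auto simp: square_int_def\<close>)
  qed
  have J: "jacobi_evolution (\<lambda>t. rotate_coords (a v t))" if "linearized_logKdV_solution u0 v" for v
    using that unfolding linearized_logKdV_solution_def jacobi_coords_rotate a_def by simp
  have ev: "skew_evolution t (a v 0) (a v)" "\<exists>M. \<forall>s\<in>{0..t}. l2_bound (a v s) M"
    if "linearized_logKdV_solution u0 v" "t \<ge> 0" for v t
    by (rule jacobi_evolution_imp_skew[OF J[OF that(1)] _ that(2)], simp add: a_def)+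
  have hi: "hermite_coeff (n + 1) (w t) = hermite_coeff (n + 1) (u t)" if t: "t \<ge> 0" and n: "n \<ge> 1" for t n
  proof -
    obtain M R where M: "\<forall>s\<in>{0..t}. l2_bound (a w s) M" and R: "\<forall>s\<in>{0..t}. l2_bound (a u s) R"
      using ev(2)[OF w t] ev(2)[OF u t] by auto
    have "a w 0 = a u 0" by (simp add: a_def fun_eq_iff ini)
    then have "a w t n = a u t n"
      using skew_evolution_unique[of t "a u 0" "a w" "a u" M R t n] ev(1)[OF w t] ev(1)[OF u t] M R t n by auto
    then show ?thesis using n by (simp add: a_def)
  qed
  have one: "hermite_coeff 1 (w t) = hermite_coeff 1 (u t)"
  proof -
    have "((\<lambda>s. hermite_coeff 1 (w s) - hermite_coeff 1 (u s)) has_real_derivative 0) (at s within {0..})"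
      if s: "s \<in> {0..}" for s
    proof -
      have s0: "s \<ge> 0" using s by simp
      have "hermite_coeff 2 (w s) = hermite_coeff 2 (u s)" using hi[OF s0, of 1] by (simp add: numeral_2_eq_2)
      moreover have "hermite_coeff 0 (w s) = 0" "hermite_coeff 0 (u s) = 0"
        using Xc[OF s0] X_c_coeff_0 by auto
      ultimately show ?thesis
        using DERIV_diff[OF solution_coeff_deriv[OF w s0, of 1] solution_coeff_deriv[OF u s0, of 1]]
        by (simp add: numeral_2_eq_2)
    qed
    then have "\<exists>c. \<forall>s\<in>{0::real..}. hermite_coeff 1 (w s) - hermite_coeff 1 (u s) = c"
      by (intro has_field_derivative_zero_constant) (auto simp: convex_real_interval)
    then obtain c where c: "\<And>s. s \<ge> 0 \<Longrightarrow> hermite_coeff 1 (w s) - hermite_coeff 1 (u s) = c" by auto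
    show ?thesis using c[OF t] c[of 0] ini[of 1] by simp
  qed
  have "hermite_coeff n (w t) = hermite_coeff n (u t)" for n
  proof -
    consider "n = 0" | "n = 1" | "n \<ge> 2" by linarith
    then show ?thesis
    proof cases
      case 1
      then show ?thesis using Xc[OF t] X_c_coeff_0 by simp
    next
      case 2
      then show ?thesis using one by simp
    next
      case 3
      then show ?thesis using hi[OF t, of "n - 1"] by simp
    qed
  qed
  then show ?thesis
    using weak_deriv_X_c(1)[OF Xc(1)[OF t]] weak_deriv_X_c(1)[OF Xc(2)[OF t]]
    by (intro hermite_coeff_eq_imp_AE_eq gauss_integrable_square_int)
qed

lemma solution_exists:
  assumes u0: "u0 \<in> X_c"
  shows "\<exists>u. linearized_logKdV_solution u0 u \<and> (\<forall>t\<ge>0. E_c (u t) = E_c u0)"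
proof -
  define x where "x n = sqrt n * hermite_coeff (n + 1) u0" for n :: nat
  have x: "(\<lambda>n. (x n)\<^sup>2) sums E_c u0" unfolding x_def by (rule E_c_sums_jacobi[OF u0])
  have x0: "x 0 = 0" by (simp add: x_def)
  obtain b where b: "\<And>T. skew_evolution T x b" "\<And>t. b t 0 = 0" "\<And>n. b 0 n = x n"
    "\<And>t. t \<ge> 0 \<Longrightarrow> (\<lambda>n. (b t n)\<^sup>2) sums (\<Sum>n. (x n)\<^sup>2)"
    by (rule skew_evolution_conservative[OF sums_summable[OF x] x0]) (rule that)
  \<comment> \<open>The norm of \<open>b\<close> is controlled for t \<ge> 0 only; freezing at
    negative times gives a sequence of constant norm at every real t, so that \<open>u t\<close> can
    be chosen for all t.\<close>
  define a where "a t = b (max 0 t)" for t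
  have a: "skew_evolution T x a" for T
    by (rule skew_evolution_cong[OF b(1)]) (auto simp: a_def)
  have a0: "a t 0 = 0" for t by (simp add: a_def b)
  have ai: "a 0 n = x n" for n by (simp add: a_def b)
  have as: "(\<lambda>n. (a t n)\<^sup>2) sums E_c u0" for t
    using b(4)[of "max 0 t"] sums_unique[OF x] by (simp add: a_def)
  \<comment> \<open>Inverts a_n = sqrt n c_(n+1). The coefficient at 1, lost there, is the initial
    value plus the integral of c_2 / sqrt 2, where c_2 = a_1.\<close>
  define c where "c t n = (if n = 0 then 0 else if n = 1
      then hermite_coeff 1 u0 + integral {0..t} (\<lambda>s. a s 1) / sqrt 2
      else a t (n - 1) / sqrt (n - 1))" for t and n :: nat
  have ac: "sqrt n * c t (n + 1) = a t n" for t n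
    by (cases "n = 0") (auto simp: c_def a0)
  have "\<exists>u. u \<in> X_c \<and> (\<forall>n. hermite_coeff n u = c t n)" for t
  proof -
    have "summable (\<lambda>n. real (Suc n) * (c t (Suc n))\<^sup>2)"
    proof (rule summable_comparison_test'[of _ 1])
      show "summable (\<lambda>n. 2 * (a t n)\<^sup>2)" using sums_summable[OF as] by (rule summable_mult)
      fix n :: nat assume n: "n \<ge> 1"
      \<comment> \<open>n + 1 \<le> 2 n for n \<ge> 1 gives the factor 2; the single index n = 0
        does not affect summability.\<close>
      have "real (Suc n) * (c t (Suc n))\<^sup>2 \<le> (2 * real n) * (c t (Suc n))\<^sup>2"
        using n by (intro mult_right_mono) auto
      also have "\<dots> = 2 * (sqrt n * c t (n + 1))\<^sup>2" by (simp add: power_mult_distrib)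
      finally show "norm (real (Suc n) * (c t (Suc n))\<^sup>2) \<le> 2 * (a t n)\<^sup>2"
        unfolding ac by simp
    qed
    then have sm: "summable (\<lambda>n. real n * (c t n)\<^sup>2)"
      using summable_Suc_iff[of "\<lambda>n. real n * (c t n)\<^sup>2"] by simp
    have "c t 0 = 0" by (simp add: c_def)
    then show ?thesis by (rule X_c_of_coeffs[OF _ sm]) auto
  qed
  then obtain u where u: "\<And>t. u t \<in> X_c" and uc: "\<And>t n. hermite_coeff n (u t) = c t n" by metis
  have jc: "jacobi_coords (u t) = rotate_coords (a t)" for t
    unfolding jacobi_coords_rotate uc ac ..
  have energy: "E_c (u t) = E_c u0" for t
  proof (rule sums_unique2)
    show "(\<lambda>n. (sqrt n * hermite_coeff (n + 1) (u t))\<^sup>2) sums E_c (u t)" by (rule E_c_sums_jacobi[OF u])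
    show "(\<lambda>n. (sqrt n * hermite_coeff (n + 1) (u t))\<^sup>2) sums E_c u0" unfolding uc ac by (rule as)
  qed
  have "linearized_logKdV_solution u0 u"
    unfolding linearized_logKdV_solution_def
  proof (intro conjI allI impI)
    show "u t \<in> X_c" for t by (rule u)
    show "AE x in lborel. u 0 x = u0 x"
    proof (rule hermite_coeff_eq_imp_AE_eq)
      show "hermite_coeff n (u 0) = hermite_coeff n u0" for n
      proof (cases "n \<le> 1")
        case True
        then show ?thesis unfolding uc using X_c_coeff_0[OF u0] by (cases n) (auto simp: c_def)
      next
        case False
        then obtain m where m: "n = m + 1" "m \<ge> 1" by (cases n) auto
        then show ?thesis using ac[of m 0] ai[of m] by (simp add: uc x_def)
      qed
    qed (auto intro: gauss_integrable_square_int weak_deriv_X_c(1) u u0)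
    show "jacobi_evolution (\<lambda>t. jacobi_coords (u t))"
      unfolding jc by (rule jacobi_evolution_rotate[OF a a0 ai as])
    fix n and t :: real assume t: "t \<ge> 0"
    have sq: "square_int (u t)" by (rule weak_deriv_X_c(1)[OF u])
    have "((\<lambda>s. c s n) has_real_derivative
        (real n * sqrt (n + 1) * c t (n + 1) - (real n - 2) * sqrt n * c t (n - 1)) / 2) (at t within {0..})"
    proof -
      consider "n = 0" | "n = 1" | "n \<ge> 2" by linarith
      then show ?thesis
      proof cases
        case 1
        then show ?thesis by (simp add: c_def)
      next
        case 2
        have d: "((\<lambda>s. hermite_coeff 1 u0 + integral {0..s} (\<lambda>s. a s 1) / sqrt 2) has_real_derivative a t 1 / sqrt 2)
            (at t within {0..})"
          using DERIV_add[OF DERIV_const DERIV_cdivide[OF skew_evolution_component_integral[OF a t, of 1], of "sqrt 2"],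
              of "hermite_coeff 1 u0"] by simp
        have "a t 1 / sqrt 2 = (sqrt 2 * a t 1) / (sqrt 2 * sqrt 2)"
          by (rule nonzero_mult_divide_mult_cancel_left[symmetric]) simp
        also have "\<dots> = sqrt 2 * a t 1 / 2" by simp
        also have "\<dots> = (real n * sqrt (n + 1) * c t (n + 1) - (real n - 2) * sqrt n * c t (n - 1)) / 2"
          using 2 by (simp add: c_def)
        finally have "((\<lambda>s. hermite_coeff 1 u0 + integral {0..s} (\<lambda>s. a s 1) / sqrt 2) has_real_derivative
            (real n * sqrt (n + 1) * c t (n + 1) - (real n - 2) * sqrt n * c t (n - 1)) / 2) (at t within {0..})"
          by (rule DERIV_cong[OF d])
        moreover have "(\<lambda>s. c s n) = (\<lambda>s. hermite_coeff 1 u0 + integral {0..s} (\<lambda>s. a s 1) / sqrt 2)"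
          using 2 by (simp add: c_def)
        ultimately show ?thesis by simp
      next
        case 3
        define m where "m = n - 1"
        have m: "n = m + 1" "m \<ge> 1" using 3 by (auto simp: m_def)
        have d: "((\<lambda>s. a s m / sqrt m) has_real_derivative (skew (a t) m / 2) / sqrt m) (at t within {0..})"
          by (intro DERIV_cdivide skew_evolution_deriv[OF a t m(2)])
        have "a t = (\<lambda>n. sqrt n * c t (n + 1))" by (rule ext) (rule ac[symmetric])
        then have "(skew (a t) m / 2) / sqrt m = (skew (\<lambda>n. sqrt n * c t (n + 1)) m / 2) / sqrt m" by simp
        also have "\<dots> = (real n * sqrt (n + 1) * c t (n + 1) - (real n - 2) * sqrt n * c t (n - 1)) / 2"
          unfolding skew_lattice[OF m(2)] using m by (simp add: add_ac)
        finally have "((\<lambda>s. a s m / sqrt m) has_real_derivative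
            (real n * sqrt (n + 1) * c t (n + 1) - (real n - 2) * sqrt n * c t (n - 1)) / 2) (at t within {0..})"
          by (rule DERIV_cong[OF d])
        moreover have "(\<lambda>s. c s n) = (\<lambda>s. a s m / sqrt m)" using m by (auto simp: c_def)
        ultimately show ?thesis by simp
      qed
    qed
    then show "((\<lambda>s. hermite_coeff n (u s)) has_real_derivative
        - L2_inner (L_op (deriv (hermite_fun n))) (u t)) (at t within {0..})"
      unfolding projected_equation_lattice[OF sq] uc .
  qed
  then show ?thesis using energy by blast
qed

theorem corollary4p4:
  fixes u0 :: "real \<Rightarrow> real"
  assumes "u0 \<in> X_c"
  shows "\<exists>u. linearized_logKdV_solution u0 u \<and>
           (\<forall>t\<ge>0. E_c (u t) = E_c u0) \<and>
           (\<forall>w. linearized_logKdV_solution u0 w \<longrightarrow>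
              (\<forall>t\<ge>0. AE x in lborel. w t x = u t x))"
proof -
  obtain u where u: "linearized_logKdV_solution u0 u" "\<forall>t\<ge>0. E_c (u t) = E_c u0"
    using solution_exists[OF assms] by auto
  show ?thesis
    by (intro exI[of _ u] conjI allI impI u solution_unique[OF u(1)]) (use u in auto)
qed

end
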